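(* Let $L$ be a free Lie ring of rank $2$ with free generators $x$ and $y$, and let $p$ be a prime. Then the quotient $(L')^p/[(L')^p,L]$ is (as an additive group) a direct sum of a free abelian group and an elementary abelian $p$-group. Moreover, modulo $[(L')^p,L]$, the elements $$\frac{1}{p}\sum_{i=0}^{p-2}\Big([[u,y],\underbrace{u,\dots,u}_{i},[u,x],\underbrace{u,\dots,u}_{p-2-i}]-[[u,x],\underbrace{u,\dots,u}_{i},[u,y],\underbrace{u,\dots,u}_{p-2-i}]\Big),$$ where $u=[y,x,\underbrace{x,\dots,x}_{s},\underbrace{y,\dots,y}_{t}]$ with $s,t\geq 0$ (one element for each pair $(s,t)$ of non-negative integers), form a basis, as a $\mathbb{Z}_p$-module, of the torsion subgroup of $(L')^p/[(L')^p,L]$.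
   Context: Lie rings are Lie algebras over $\mathbb{Z}$; $L$ is the (absolutely) free Lie ring. Lie products are left-normed: $[a_1,a_2,\dots,a_n]=[[a_1,\dots,a_{n-1}],a_n]$. $L'=L^2=[L,L]$ is the derived ideal of $L$, and $(L')^c$ denotes the $c$th term of the lower central series of $L'$: $(L')^1=L'$, $(L')^{c+1}=[(L')^c,L']$. $[(L')^p,L]$ is the additive subgroup (an ideal) spanned by all products $[a,b]$ with $a\in (L')^p$, $b\in L$. $\mathbb{Z}_p=\mathbb{Z}/p\mathbb{Z}$. The factor $1/p$ makes sense: the sum is divisible by $p$ in $L$ (it can be written as $p$ times a Lie polynomial with integer coefficients), and since $L$ is torsion-free as an additive group, the element $\frac1p\sum(\dots)$ of $L$ is uniquely determined. *)

theory Defs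
  imports
    "HOL-Algebra.Free_Abelian_Groups"
    "HOL-Algebra.Module"
    "HOL-Number_Theory.Residues"
    "HOL-Computational_Algebra.Group_Closure"
begin

section \<open>Lie rings\<close>

class lie_ring = ab_group_add +
  fixes lie :: "'a \<Rightarrow> 'a \<Rightarrow> 'a"
  assumes lie_add_left: "lie (a + b) c = lie a c + lie b c"
    and lie_add_right: "lie a (b + c) = lie a b + lie a c"
    and lie_self: "lie a a = 0"
    and lie_jacobi: "lie (lie a b) c + lie (lie b c) a + lie (lie c a) b = 0"

text \<open>Left-normed products: \<open>lie_products a [b\<^sub>1, \<dots>, b\<^sub>n]\<close> is \<open>[a, b\<^sub>1, \<dots>, b\<^sub>n]\<close>.\<close>

definition lie_products :: "'a::lie_ring \<Rightarrow> 'a list \<Rightarrow> 'a"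
  where "lie_products a bs = foldl lie a bs"

definition lie_hom :: "('a::lie_ring \<Rightarrow> 'b::lie_ring) \<Rightarrow> bool"
  where "lie_hom h \<longleftrightarrow>
    (\<forall>a b. h (a + b) = h a + h b) \<and> (\<forall>a b. h (lie a b) = lie (h a) (h b))"

section \<open>Free Lie rings\<close>

text \<open>The free Lie ring on a set of generators (the type \<open>'v\<close>) is the algebra of formal Lie ring
  expressions modulo the least congruence containing the Lie ring axioms.\<close>

datatype 'v lie_term =
  Gen 'v | Zero | Neg "'v lie_term" | Add "'v lie_term" "'v lie_term" | Br "'v lie_term" "'v lie_term"

inductive lie_cong :: "'v lie_term \<Rightarrow> 'v lie_term \<Rightarrow> bool" where
  cong_refl: "lie_cong a a"
| cong_sym: "lie_cong a b \<Longrightarrow> lie_cong b a"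
| cong_trans: "lie_cong a b \<Longrightarrow> lie_cong b c \<Longrightarrow> lie_cong a c"
| cong_Neg: "lie_cong a b \<Longrightarrow> lie_cong (Neg a) (Neg b)"
| cong_Add: "lie_cong a b \<Longrightarrow> lie_cong c d \<Longrightarrow> lie_cong (Add a c) (Add b d)"
| cong_Br: "lie_cong a b \<Longrightarrow> lie_cong c d \<Longrightarrow> lie_cong (Br a c) (Br b d)"
| add_assoc: "lie_cong (Add (Add a b) c) (Add a (Add b c))"
| add_commute: "lie_cong (Add a b) (Add b a)"
| add_zero: "lie_cong (Add Zero a) a"
| add_neg: "lie_cong (Add (Neg a) a) Zero"
| br_add_left: "lie_cong (Br (Add a b) c) (Add (Br a c) (Br b c))"
| br_add_right: "lie_cong (Br a (Add b c)) (Add (Br a b) (Br a c))"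
| br_self: "lie_cong (Br a a) Zero"
| br_jacobi: "lie_cong (Add (Add (Br (Br a b) c) (Br (Br b c) a)) (Br (Br c a) b)) Zero"

quotient_type 'v free_lie = "'v lie_term" / lie_cong
  by (rule equivpI) (auto intro: reflpI sympI transpI lie_cong.intros)

instantiation free_lie :: (type) lie_ring
begin

lift_definition zero_free_lie :: "'a free_lie" is Zero .

lift_definition uminus_free_lie :: "'a free_lie \<Rightarrow> 'a free_lie" is Neg
  by (rule cong_Neg)

lift_definition plus_free_lie :: "'a free_lie \<Rightarrow> 'a free_lie \<Rightarrow> 'a free_lie" is Add
  by (rule cong_Add)

lift_definition minus_free_lie :: "'a free_lie \<Rightarrow> 'a free_lie \<Rightarrow> 'a free_lie" is "\<lambda>a b. Add a (Neg b)"
  by (intro cong_Add cong_Neg)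

lift_definition lie_free_lie :: "'a free_lie \<Rightarrow> 'a free_lie \<Rightarrow> 'a free_lie" is Br
  by (rule cong_Br)

instance
  by (standard; transfer)
    (rule cong_refl add_assoc add_commute add_zero add_neg br_add_left br_add_right br_self br_jacobi)+

end

lift_definition free_gen :: "'v \<Rightarrow> 'v free_lie" is Gen .

primrec lie_eval :: "('v \<Rightarrow> 'a::lie_ring) \<Rightarrow> 'v lie_term \<Rightarrow> 'a" where
  "lie_eval g (Gen v) = g v"
| "lie_eval g Zero = 0"
| "lie_eval g (Neg a) = - lie_eval g a"
| "lie_eval g (Add a b) = lie_eval g a + lie_eval g b"
| "lie_eval g (Br a b) = lie (lie_eval g a) (lie_eval g b)"

lemma lie_eval_cong: "lie_cong a b \<Longrightarrow> lie_eval g a = lie_eval g b"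
  by (induction rule: lie_cong.induct)
    (simp_all add: add.assoc add.commute lie_add_left lie_add_right lie_self
      lie_jacobi[unfolded add.assoc])

lift_definition free_lie_lift :: "('v \<Rightarrow> 'a::lie_ring) \<Rightarrow> 'v free_lie \<Rightarrow> 'a" is lie_eval
  by (rule lie_eval_cong)

text \<open>The family \<open>g\<close> freely generates the Lie ring formed by the whole type \<open>'a\<close>.\<close>

definition free_generators :: "('v \<Rightarrow> 'a::lie_ring) \<Rightarrow> bool"
  where "free_generators g \<longleftrightarrow> bij (free_lie_lift g)"

lemma free_lie_lift_gen: "free_lie_lift g (free_gen v) = g v"
  by transfer simp

lemma free_lie_lift_hom: "lie_hom (free_lie_lift g)"
  unfolding lie_hom_def by (intro conjI allI; transfer) simp_all

lemma lie_hom_zero: "lie_hom h \<Longrightarrow> h 0 = 0"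
proof -
  assume "lie_hom h"
  then have "h (0 + 0) = h 0 + h 0" unfolding lie_hom_def by blast
  then show ?thesis by simp
qed

lemma lie_hom_minus: "lie_hom h \<Longrightarrow> h (- a) = - h a"
proof -
  assume h: "lie_hom h"
  then have "h a + h (- a) = h (a + - a)" unfolding lie_hom_def by metis
  then have "h a + h (- a) = 0" by (simp add: lie_hom_zero[OF h])
  then show "h (- a) = - h a" by (metis minus_unique)
qed

lemma lie_hom_free_unique:
  assumes h: "lie_hom h" and gen: "\<And>v. h (free_gen v) = g v"
  shows "h = free_lie_lift g"
proof
  have "h (abs_free_lie t) = lie_eval g t" for t
  proof (induction t)
    case (Gen v) then show ?case using gen[of v] by (simp add: free_gen.abs_eq)
  next
    case Zero then show ?case using lie_hom_zero[OF h] by (simp add: zero_free_lie_def)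
  next
    case (Neg t) then show ?case
      using lie_hom_minus[OF h, of "abs_free_lie t"] by (simp add: uminus_free_lie.abs_eq)
  next
    case (Add s t) then show ?case using h by (simp add: lie_hom_def flip: plus_free_lie.abs_eq)
  next
    case (Br s t) then show ?case using h by (simp add: lie_hom_def flip: lie_free_lie.abs_eq)
  qed
  then show "h a = free_lie_lift g a" for a
    by (induction a rule: free_lie.abs_induct) (simp add: free_lie_lift.abs_eq)
qed

lemma free_generators_free_gen: "free_generators (free_gen :: 'v \<Rightarrow> 'v free_lie)"
proof -
  have "lie_hom (\<lambda>a :: 'v free_lie. a)" by (simp add: lie_hom_def)
  then have "free_lie_lift free_gen = (\<lambda>a :: 'v free_lie. a)"
    by (rule lie_hom_free_unique[symmetric]) simp
  then show ?thesis by (simp add: free_generators_def bij_def surj_def)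
qed

theorem free_generators_universal:
  fixes g :: "'v \<Rightarrow> 'a::lie_ring" and f :: "'v \<Rightarrow> 'b::lie_ring"
  assumes "free_generators g"
  shows "\<exists>!h. lie_hom h \<and> (\<forall>v. h (g v) = f v)"
proof -
  let ?G = "free_lie_lift g" and ?H = "Hilbert_Choice.inv (free_lie_lift g)"
  have b: "bij ?G" using assms by (simp add: free_generators_def)
  have hG: "lie_hom ?G" by (rule free_lie_lift_hom)
  have inv1: "?H (?G a) = a" for a using b by (simp add: bij_is_inj)
  have inv2: "?G (?H a) = a" for a using b by (simp add: bij_is_surj surj_f_inv_f)
  have hom_add: "?G (a + b) = ?G a + ?G b" and hom_lie: "?G (lie a b) = lie (?G a) (?G b)" for a b
    using hG by (auto simp: lie_hom_def)
  have "?H (a + b) = ?H a + ?H b" for a b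
    using inv1[of "?H a + ?H b"] by (simp add: hom_add inv2)
  moreover have "?H (lie a b) = lie (?H a) (?H b)" for a b
    using inv1[of "lie (?H a) (?H b)"] by (simp add: hom_lie inv2)
  ultimately have "lie_hom ?H" by (simp add: lie_hom_def)
  then have "lie_hom (free_lie_lift f \<circ> ?H)"
    using free_lie_lift_hom[of f] by (simp add: lie_hom_def)
  moreover have "(free_lie_lift f \<circ> ?H) (g v) = f v" for v
    using inv1[of "free_gen v"] by (simp add: free_lie_lift_gen)
  moreover have "h = free_lie_lift f \<circ> ?H" if "lie_hom h" "\<forall>v. h (g v) = f v" for h
  proof -
    have "lie_hom (h \<circ> ?G)" using that hG by (simp add: lie_hom_def)
    then have "h \<circ> ?G = free_lie_lift f"
      by (rule lie_hom_free_unique) (simp add: free_lie_lift_gen that)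
    then show ?thesis by (metis comp_apply ext inv2)
  qed
  ultimately show ?thesis by blast
qed

section \<open>Products of ideals and the lower central series\<close>

text \<open>\<open>lie_prod A B\<close> is \<open>[A, B]\<close>, the additive subgroup spanned by all \<open>[a, b]\<close>.\<close>

definition lie_prod :: "'a::lie_ring set \<Rightarrow> 'a set \<Rightarrow> 'a set"
  where "lie_prod A B = group_closure {lie a b | a b. a \<in> A \<and> b \<in> B}"

definition derived_ideal :: "'a::lie_ring set"
  where "derived_ideal = lie_prod UNIV UNIV"

text \<open>The \<open>c\<close>-th term of the lower central series of \<open>M\<close>, numbered from \<open>c = 1\<close>; the value at
  \<open>c = 0\<close> is irrelevant.\<close>

definition lower_central :: "'a::lie_ring set \<Rightarrow> nat \<Rightarrow> 'a set"
  where "lower_central M c = ((\<lambda>A. lie_prod A M) ^^ (c - 1)) M"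

section \<open>Abelian groups and modules\<close>

definition additive_group :: "'a::ab_group_add set \<Rightarrow> 'a monoid"
  where "additive_group A = \<lparr>carrier = A, monoid.mult = (+), one = 0\<rparr>"

definition elementary_abelian :: "nat \<Rightarrow> ('a, 'b) monoid_scheme \<Rightarrow> bool"
  where "elementary_abelian p E \<longleftrightarrow>
    comm_group E \<and> (\<forall>a \<in> carrier E. a [^]\<^bsub>E\<^esub> p = \<one>\<^bsub>E\<^esub>)"

definition torsion :: "('a, 'b) monoid_scheme \<Rightarrow> 'a set"
  where "torsion G = {a \<in> carrier G. \<exists>n::nat. n > 0 \<and> a [^]\<^bsub>G\<^esub> n = \<one>\<^bsub>G\<^esub>}"

text \<open>The torsion subgroup of an abelian group, written additively, with integers acting by
  multiples. The ring multiplication that the record type provides plays no role.\<close>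

definition torsion_module :: "('a, 'b) monoid_scheme \<Rightarrow> (int, 'a) module"
  where "torsion_module G =
    \<lparr>carrier = torsion G, monoid.mult = monoid.mult G, one = one G,
     zero = one G, add = monoid.mult G, smult = (\<lambda>k a. a [^]\<^bsub>G\<^esub> k)\<rparr>"

definition module_independent ::
    "('r, 'c) ring_scheme \<Rightarrow> ('r, 'a, 'd) module_scheme \<Rightarrow> 'i set \<Rightarrow> ('i \<Rightarrow> 'a) \<Rightarrow> bool"
  where "module_independent R M I v \<longleftrightarrow>
    (\<forall>J c. finite J \<and> J \<subseteq> I \<and> c \<in> J \<rightarrow> carrier R \<and>
        (\<Oplus>\<^bsub>M\<^esub>j\<in>J. c j \<odot>\<^bsub>M\<^esub> v j) = \<zero>\<^bsub>M\<^esub> \<longrightarrow> (\<forall>j\<in>J. c j = \<zero>\<^bsub>R\<^esub>))"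

definition module_spanning ::
    "('r, 'c) ring_scheme \<Rightarrow> ('r, 'a, 'd) module_scheme \<Rightarrow> 'i set \<Rightarrow> ('i \<Rightarrow> 'a) \<Rightarrow> bool"
  where "module_spanning R M I v \<longleftrightarrow>
    (\<forall>m \<in> carrier M. \<exists>J c. finite J \<and> J \<subseteq> I \<and> c \<in> J \<rightarrow> carrier R \<and>
        m = (\<Oplus>\<^bsub>M\<^esub>j\<in>J. c j \<odot>\<^bsub>M\<^esub> v j))"

definition module_basis ::
    "('r, 'c) ring_scheme \<Rightarrow> ('r, 'a, 'd) module_scheme \<Rightarrow> 'i set \<Rightarrow> ('i \<Rightarrow> 'a) \<Rightarrow> bool"
  where "module_basis R M I v \<longleftrightarrow>
    Module.module R M \<and> v \<in> I \<rightarrow> carrier M \<and>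
    module_independent R M I v \<and> module_spanning R M I v"

section \<open>The quotient and the torsion elements\<close>

definition lower_central_quotient :: "nat \<Rightarrow> 'a::lie_ring set monoid"
  where "lower_central_quotient p =
    additive_group (lower_central derived_ideal p) Mod lie_prod (lower_central derived_ideal p) UNIV"

definition quotient_class :: "nat \<Rightarrow> 'a::lie_ring \<Rightarrow> 'a set"
  where "quotient_class p a =
    lie_prod (lower_central derived_ideal p) UNIV
      #>\<^bsub>additive_group (lower_central derived_ideal p)\<^esub> a"

text \<open>In a torsion-free group \<open>exact_div n a\<close> is the unique element \<open>z\<close> with \<open>n z = a\<close>, if there is
  one and \<open>n > 0\<close>.\<close>

definition exact_div :: "nat \<Rightarrow> 'a::ab_group_add \<Rightarrow> 'a"
  where "exact_div n a = (THE z. (\<Sum>j<n. z) = a)"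

definition u_elem :: "'a::lie_ring \<Rightarrow> 'a \<Rightarrow> nat \<Rightarrow> nat \<Rightarrow> 'a"
  where "u_elem x y s t = lie_products y ([x] @ replicate s x @ replicate t y)"

definition torsion_elem :: "nat \<Rightarrow> 'a::lie_ring \<Rightarrow> 'a \<Rightarrow> 'a \<Rightarrow> 'a"
  where "torsion_elem p x y u = exact_div p
    (\<Sum>i = 0..p - 2.
      lie_products (lie u y) (replicate i u @ [lie u x] @ replicate (p - 2 - i) u)
      - lie_products (lie u x) (replicate i u @ [lie u y] @ replicate (p - 2 - i) u))"

end

theory Submission
  imports Defs "HOL-Library.Countable"
begin

text \<open>Write \<open>R = L'\<close> and \<open>u\<^sub>s\<^sub>t = [y, x, x, \<dots>, x, y, \<dots>,
  y]\<close> with \<open>s\<close> further factors \<open>x\<close> and \<open>t\<close>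
  factors \<open>y\<close>. Eliminating \<open>x\<close> and then \<open>y\<close> from
  \<open>L\<close> shows that \<open>R\<close> is free on the \<open>u\<^sub>s\<^sub>t\<close>
  (\<open>u_map_free_inj\<close>, \<open>derived_ideal_eq\<close>). The factor of
  \<open>R\<^sup>p\<close> by the next term of the lower central series is therefore the group
  \<open>\<Lambda>\<close> of Lie elements of degree \<open>p\<close> in the free associative
  ring on letters \<open>(s, t)\<close>. Bracketing with \<open>x\<close> and \<open>y\<close>
  acts on \<open>\<Lambda>\<close> through the derivations \<open>X\<close> and
  \<open>Y\<close> that raise \<open>s\<close> and \<open>t\<close>, and the quotient of the
  theorem is \<open>\<Lambda> / (\<Lambda>X + \<Lambda>Y)\<close> (\<open>N_iff\<close>).

  Let \<open>T\<close> be the homogeneous component of degree \<open>p\<close> of the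
  associative ring. As a module over \<open>\<int>[X, Y]\<close> it is a polynomial ring in
  \<open>2 p\<close> variables on which \<open>X\<close> and \<open>Y\<close> are
  multiplication by the sums of the variables of each kind. So \<open>T / (TX + TY)\<close> is
  free abelian, and the torsion of the quotient is \<open>(\<Lambda> \<inter> (TX + TY)) /
  (\<Lambda>X + \<Lambda>Y)\<close>; the rest is a subgroup of a free abelian group of
  countable rank, hence free, and splits off.

  Two facts determine this torsion. First, \<open>X, Y\<close> is a regular sequence on
  \<open>T\<close>, over \<open>\<int>\<close> and modulo \<open>p\<close>: \<open>aX + bY =
  0\<close> forces \<open>a = cY\<close> and \<open>b = -cX\<close>
  (\<open>koszul_exact\<close>). Second, in the prime degree \<open>p\<close> an element that
  vanishes on all proper shuffles is a Lie element, and if it vanishes on them modulo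
  \<open>p\<close> it is a Lie element plus a combination of powers \<open>u\<^sup>p\<close>
  of letters plus a multiple of \<open>p\<close> (\<open>lie_elts_if_primitive\<close>,
  \<open>lie_elts_if_primitive_mod\<close>). Both statements come from Dynkin operators: the
  usual one multiplies such an element by \<open>p\<close>, the one that only brackets words
  starting with the letter \<open>a\<close> multiplies a word by its number \<open>k\<close>
  of letters \<open>a\<close>; for a letter \<open>a\<close> of the word, \<open>k\<close> and
  \<open>p\<close> are coprime unless the word is \<open>a\<^sup>p\<close>.

  Now let \<open>w = aX + bY\<close> be a Lie element. The Dynkin operator
  \<open>\<delta>\<close> commutes with \<open>X\<close> and \<open>Y\<close>, so \<open>p w =
  \<delta>(a)X + \<delta>(b)Y\<close>, whence \<open>\<delta>(a) = cY\<close> and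
  \<open>\<delta>(b) = -cX\<close> modulo \<open>p\<close>. Shuffling commutes with
  \<open>Y\<close>, so \<open>c\<close> vanishes on proper shuffles modulo \<open>p\<close>
  and is, up to Lie elements and multiples of \<open>p\<close>, a combination of powers
  \<open>u\<^sup>p\<close>. These contribute the torsion: modulo \<open>p\<close> the element
  \<open>[uY, u, \<dots>, u]\<close> equals \<open>u\<^sup>pY\<close>, and \<open>w\<close>
  becomes a combination of the elements \<open>\<tau>\<^sub>u = ([uY, u, \<dots>, u]X - [uX,
  u, \<dots>, u]Y) / p\<close> modulo \<open>\<Lambda>X + \<Lambda>Y\<close>
  (\<open>tau_spans\<close>). Expanding the derivations gives the elements of the theorem
  (\<open>tau_formula\<close>). A relation between the \<open>\<tau>\<^sub>u\<close> yields a
  Lie element of the form \<open>\<Sum> n\<^sub>u u\<^sup>p\<close> modulo \<open>p\<close>,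
  and since Lie elements have no terms \<open>u\<^sup>p\<close>, every
  \<open>n\<^sub>u\<close> is divisible by \<open>p\<close> (\<open>tau_independent\<close>).

  The passage between \<open>L\<close> and the associative ring needs that free Lie rings are
  torsion-free (\<open>free_lie_torsion_free\<close>), which also makes the division by
  \<open>p\<close> in \<open>L\<close> unique.\<close>

section \<open>Integer combinations\<close>

abbreviation lookup where "lookup \<equiv> Poly_Mapping.lookup"
abbreviation keys where "keys \<equiv> Poly_Mapping.keys"

definition zmul :: "int \<Rightarrow> 'a::ab_group_add \<Rightarrow> 'a"
  where "zmul k a = (if k \<ge> 0 then (\<Sum>i<nat k. a) else - (\<Sum>i<nat (- k). a))"

lemma zmul_0 [simp]: "zmul 0 a = 0" by (simp add: zmul_def)
lemma zmul_1 [simp]: "zmul 1 a = a" by (simp add: zmul_def)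

lemma zmul_of_nat: "zmul (int n) a = (\<Sum>i<n. a)" by (simp add: zmul_def)

lemma zmul_Suc: "zmul (k + 1) a = zmul k a + a"
proof (cases "k \<ge> 0")
  case True
  then have "nat (k + 1) = Suc (nat k)" by simp
  with True show ?thesis by (simp add: zmul_def)
next
  case False
  then have "nat (- k) = Suc (nat (- (k + 1)))" by simp
  with False show ?thesis
    by (cases "k = -1") (simp_all add: zmul_def)
qed

lemma zmul_pred: "zmul (k - 1) a = zmul k a - a"
  using zmul_Suc[of "k - 1" a] by (simp add: algebra_simps)

lemma zmul_add_left: "zmul (j + k) a = zmul j a + zmul k a"
proof (induction k rule: int_induct[where k=0])
  case (step1 k)
  then show ?case using zmul_Suc[of "j + k" a] zmul_Suc[of k a] by (simp add: add.assoc)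
next
  case (step2 k)
  have "zmul (j + (k - 1)) a = zmul ((j + k) - 1) a" by (simp add: algebra_simps)
  also have "\<dots> = zmul j a + (zmul k a - a)"
    using step2 zmul_pred[of "j + k" a] by (simp only: add_diff_eq)
  finally show ?case by (simp only: zmul_pred)
qed simp

lemma zmul_minus_left: "zmul (- k) a = - zmul k a"
  using zmul_add_left[of "- k" k a] by (simp add: eq_neg_iff_add_eq_0)

lemma zmul_diff_left: "zmul (j - k) a = zmul j a - zmul k a"
  using zmul_add_left[of j "- k" a] by (simp add: zmul_minus_left)

lemma additive_diff_fun: "additive h \<Longrightarrow> additive k \<Longrightarrow> additive (\<lambda>a. h a - k a)"
  by (simp add: additive_def algebra_simps)

lemma additive_comp: "additive h \<Longrightarrow> additive k \<Longrightarrow> additive (\<lambda>a. h (k a))"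
  by (simp add: additive_def)

lemma additive_zmul:
  assumes "additive h" shows "h (zmul k a) = zmul k (h a)"
proof -
  interpret additive h by fact
  show ?thesis
    by (induction k rule: int_induct[where k=0])
      (simp_all add: zero zmul_Suc zmul_pred add diff)
qed

lemma additive_zmul_right: "additive (zmul k)"
proof
  show "zmul k (a + b) = zmul k a + zmul k b" for a b :: 'a
    by (induction k rule: int_induct[where k=0]) (simp_all add: zmul_Suc zmul_pred algebra_simps)
qed

lemma zmul_add_right: "zmul k (a + b) = zmul k a + zmul k b"
  and zmul_diff_right: "zmul k (a - b) = zmul k a - zmul k b"
  and zmul_minus_right: "zmul k (- a) = - zmul k a"
  and zmul_zero_right [simp]: "zmul k 0 = 0"
  using additive.add[OF additive_zmul_right] additive.diff[OF additive_zmul_right]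
    additive.minus[OF additive_zmul_right] additive.zero[OF additive_zmul_right] by metis+

lemma zmul_zmul: "zmul j (zmul k a) = zmul (j * k) a"
  by (induction j rule: int_induct[where k=0])
    (simp_all add: zmul_Suc zmul_pred algebra_simps zmul_add_left zmul_diff_left)

lemma lookup_zmul [simp]: "lookup (zmul k c) w = k * (lookup c w :: int)"
  by (induction k rule: int_induct[where k=0])
    (simp_all add: zmul_Suc zmul_pred algebra_simps lookup_add lookup_minus)

lemma zmul_frag_eq_0: "zmul k (c :: 'b \<Rightarrow>\<^sub>0 int) = 0 \<longleftrightarrow> k = 0 \<or> c = 0"
  by (auto simp: poly_mapping_eq_iff fun_eq_iff)

text \<open>The homomorphism from the free abelian group on the symbols that extends \<open>h\<close>.\<close>

definition lin :: "('b \<Rightarrow> 'a::ab_group_add) \<Rightarrow> ('b \<Rightarrow>\<^sub>0 int) \<Rightarrow> 'a"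
  where "lin h c = (\<Sum>w\<in>keys c. zmul (lookup c w) (h w))"

lemma lin_superset:
  assumes "finite A" "keys c \<subseteq> A"
  shows "lin h c = (\<Sum>w\<in>A. zmul (lookup c w) (h w))"
  unfolding lin_def by (rule sum.mono_neutral_left) (use assms in \<open>auto simp: in_keys_iff\<close>)

lemma additive_lin: "additive (lin h)"
proof
  fix c d :: "'a \<Rightarrow>\<^sub>0 int"
  let ?A = "keys c \<union> keys d"
  have "keys (c + d) \<subseteq> ?A" by (rule keys_add)
  then have "lin h (c + d) = (\<Sum>w\<in>?A. zmul (lookup (c + d) w) (h w))"
    by (intro lin_superset) auto
  also have "\<dots> = lin h c + lin h d"
    by (subst (1 2) lin_superset[where A = ?A])
      (auto simp: lookup_add zmul_add_left sum.distrib)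
  finally show "lin h (c + d) = lin h c + lin h d" .
qed

lemma lin_add: "lin h (c + d) = lin h c + lin h d"
  and lin_diff: "lin h (c - d) = lin h c - lin h d"
  and lin_zero [simp]: "lin h 0 = 0"
  using additive.add[OF additive_lin] additive.diff[OF additive_lin] additive.zero[OF additive_lin]
  by metis+

lemma lin_frag_of [simp]: "lin h (frag_of w) = h w"
  by (simp add: lin_def keys_frag_of)

lemma lin_zmul: "lin h (zmul k c) = zmul k (lin h c)"
  by (rule additive_zmul[OF additive_lin])

lemma lin_cong:
  assumes "\<And>w. w \<in> keys c \<Longrightarrow> h w = h' w"
  shows "lin h c = lin h' c"
  using assms by (simp add: lin_def)

lemma additive_lin_comp:
  assumes "additive k" shows "k (lin h c) = lin (\<lambda>w. k (h w)) c"
  by (simp add: lin_def additive.sum[OF assms] additive_zmul[OF assms])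

lemma lin_expansion: "lin frag_of c = c"
proof (rule poly_mapping_eqI)
  fix w
  have "lookup (lin frag_of c) w = (\<Sum>v\<in>keys c. if v = w then lookup c v else 0)"
    unfolding lin_def lookup_sum by (rule sum.cong) auto
  also have "\<dots> = lookup c w" by (simp add: in_keys_iff)
  finally show "lookup (lin frag_of c) w = lookup c w" .
qed

lemma lookup_lin: "lookup (lin h c) z = (\<Sum>w\<in>keys c. lookup c w * lookup (h w) z)"
  by (simp add: lin_def lookup_sum)

text \<open>Closure under differences makes the set a subgroup.\<close>

definition add_closed :: "'a::ab_group_add set \<Rightarrow> bool"
  where "add_closed A \<longleftrightarrow> 0 \<in> A \<and> (\<forall>a\<in>A. \<forall>b\<in>A. a - b \<in> A)"

lemma add_closed_0: "add_closed A \<Longrightarrow> 0 \<in> A" by (simp add: add_closed_def)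
lemma add_closed_diff: "add_closed A \<Longrightarrow> a \<in> A \<Longrightarrow> b \<in> A \<Longrightarrow> a - b \<in> A"
  by (simp add: add_closed_def)
lemma add_closed_minus: "add_closed A \<Longrightarrow> a \<in> A \<Longrightarrow> - a \<in> A"
  using add_closed_diff[of A 0 a] add_closed_0[of A] by simp
lemma add_closed_add: "add_closed A \<Longrightarrow> a \<in> A \<Longrightarrow> b \<in> A \<Longrightarrow> a + b \<in> A"
  using add_closed_diff[of A a "- b"] add_closed_minus[of A b] by simp
lemma add_closed_zmul: "add_closed A \<Longrightarrow> a \<in> A \<Longrightarrow> zmul k a \<in> A"
  by (induction k rule: int_induct[where k=0])
    (simp_all add: zmul_Suc zmul_pred add_closed_0 add_closed_add add_closed_diff)
lemma add_closed_sum: "add_closed A \<Longrightarrow> (\<And>i. i \<in> I \<Longrightarrow> f i \<in> A) \<Longrightarrow> sum f I \<in> A"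
  by (induction I rule: infinite_finite_induct) (auto intro: add_closed_0 add_closed_add)
lemma add_closed_lin: "add_closed A \<Longrightarrow> (\<And>w. w \<in> keys c \<Longrightarrow> h w \<in> A) \<Longrightarrow> lin h c \<in> A"
  unfolding lin_def by (intro add_closed_sum add_closed_zmul)

lemma add_closed_vimage: "additive h \<Longrightarrow> add_closed A \<Longrightarrow> add_closed {a. h a \<in> A}"
  by (simp add: add_closed_def additive.zero additive.diff)

lemma add_closed_image: "additive h \<Longrightarrow> add_closed A \<Longrightarrow> add_closed (h ` A)"
  by (auto simp: add_closed_def additive.zero additive.diff[symmetric] intro!: image_eqI[of 0 h 0])

lemma add_closed_supported: "add_closed {c :: 'b \<Rightarrow>\<^sub>0 int. \<forall>w. lookup c w \<noteq> 0 \<longrightarrow> P w}"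
  unfolding add_closed_def by (auto simp: lookup_minus) metis

lemma add_closed_UNIV: "add_closed UNIV" by (simp add: add_closed_def)

lemma add_closed_set_plus:
  "add_closed A \<Longrightarrow> add_closed B \<Longrightarrow> add_closed {a + b | a b. a \<in> A \<and> b \<in> B}"
proof -
  assume A: "add_closed A" and B: "add_closed B"
  let ?C = "{a + b | a b. a \<in> A \<and> b \<in> B}"
  have "0 + 0 \<in> ?C" using add_closed_0[OF A] add_closed_0[OF B] by blast
  moreover have "(a + b) - (a' + b') \<in> ?C" if "a \<in> A" "b \<in> B" "a' \<in> A" "b' \<in> B" for a b a' b'
  proof -
    have "(a + b) - (a' + b') = (a - a') + (b - b')" by (simp add: algebra_simps)
    with that add_closed_diff[OF A] add_closed_diff[OF B] show ?thesis by blast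
  qed
  ultimately show ?thesis unfolding add_closed_def by auto
qed

lemma group_closure_subset: "add_closed A \<Longrightarrow> S \<subseteq> A \<Longrightarrow> group_closure S \<subseteq> A"
proof
  fix a assume A: "add_closed A" "S \<subseteq> A" and "a \<in> group_closure S"
  from this(3) show "a \<in> A"
    by induction (use A in \<open>auto intro: add_closed_0 add_closed_diff\<close>)
qed

lemma add_closed_group_closure: "add_closed (group_closure S)"
  by (auto simp: add_closed_def intro: group_closure.diff)

section \<open>The free associative ring\<close>

text \<open>Words form the free monoid under concatenation, written additively, so that the ring of
  formal integer combinations of words is the free associative ring; as an associative ring it is
  a Lie ring under the commutator.\<close>

instantiation list :: (type) monoid_add
begin
definition zero_list :: "'a list" where "zero_list = []"
definition plus_list :: "'a list \<Rightarrow> 'a list \<Rightarrow> 'a list" where "plus_list = (@)"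
instance by standard (simp_all add: zero_list_def plus_list_def)
end

instantiation poly_mapping :: (monoid_add, ring) lie_ring
begin
definition lie_poly_mapping :: "('a \<Rightarrow>\<^sub>0 'b) \<Rightarrow> ('a \<Rightarrow>\<^sub>0 'b) \<Rightarrow> 'a \<Rightarrow>\<^sub>0 'b"
  where "lie_poly_mapping a b = a * b - b * a"
instance by standard (simp_all add: lie_poly_mapping_def algebra_simps)
end

type_synonym 'v assoc = "'v list \<Rightarrow>\<^sub>0 int"

definition letter :: "'v \<Rightarrow> 'v assoc" where "letter b = frag_of [b]"

lemma frag_of_mult: "frag_of u * frag_of v = frag_of (u @ v)"
  by (simp add: mult_single plus_list_def)

lemma additive_mult_left: "additive (\<lambda>c. c * (d :: 'a :: ring))"
  and additive_mult_right: "additive (\<lambda>c. d * (c :: 'a :: ring))"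
  by (simp_all add: additive_def algebra_simps)

lemma lin_mult_letter: "lin h (c * letter b) = lin (\<lambda>w. h (w @ [b])) c"
proof -
  have "c * letter b = lin (\<lambda>w. frag_of (w @ [b])) c"
    using additive_lin_comp[OF additive_mult_left[of "letter b"], of frag_of c]
    by (simp add: lin_expansion letter_def frag_of_mult)
  then show ?thesis by (simp add: additive_lin_comp[OF additive_lin])
qed

lemma lin_letter_mult: "lin h (letter b * c) = lin (\<lambda>w. h (b # w)) c"
proof -
  have "letter b * c = lin (\<lambda>w. frag_of (b # w)) c"
    using additive_lin_comp[OF additive_mult_right[of "letter b"], of frag_of c]
    by (simp add: lin_expansion letter_def frag_of_mult)
  then show ?thesis by (simp add: additive_lin_comp[OF additive_lin])
qed

lemma lookup_mult_letter:
  "lookup (c * letter b) z = (if z \<noteq> [] \<and> last z = b then lookup c (butlast z) else 0)"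
proof -
  have "lookup (frag_of w * letter b) z = (if z \<noteq> [] \<and> last z = b then lookup (frag_of w) (butlast z) else 0)" for w
    by (cases z rule: rev_cases) (auto simp: letter_def frag_of_mult)
  then show ?thesis
    by (induction c rule: frag_induction[OF subset_UNIV])
      (auto simp: left_diff_distrib lookup_minus)
qed

lemma lookup_letter_mult:
  "lookup (letter b * c) z = (if z \<noteq> [] \<and> hd z = b then lookup c (tl z) else 0)"
proof -
  have "lookup (letter b * frag_of w) z = (if z \<noteq> [] \<and> hd z = b then lookup (frag_of w) (tl z) else 0)" for w
    by (cases z) (auto simp: letter_def frag_of_mult)
  then show ?thesis
    by (induction c rule: frag_induction[OF subset_UNIV])
      (auto simp: right_diff_distrib lookup_minus)
qed

section \<open>Left-normed products\<close>

text \<open>The value \<open>0\<close> at the empty word is a convention; the recursion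
  \<open>left_normed_snoc\<close> starts at words of length one.\<close>

definition left_normed :: "('v \<Rightarrow> 'a::lie_ring) \<Rightarrow> 'v list \<Rightarrow> 'a"
  where "left_normed g w = (if w = [] then 0 else lie_products (g (hd w)) (map g (tl w)))"

lemma left_normed_Nil [simp]: "left_normed g [] = 0" by (simp add: left_normed_def)
lemma left_normed_single [simp]: "left_normed g [a] = g a" by (simp add: left_normed_def lie_products_def)
lemma left_normed_snoc: "w \<noteq> [] \<Longrightarrow> left_normed g (w @ [b]) = lie (left_normed g w) (g b)"
  by (cases w) (simp_all add: left_normed_def lie_products_def)
lemma left_normed_Cons: "left_normed g (a # w) = lie_products (g a) (map g w)"
  by (simp add: left_normed_def)

lemma additive_lie_left: "additive (\<lambda>a. lie a (b :: 'a::lie_ring))"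
  and additive_lie_right: "additive (\<lambda>a. lie (b :: 'a::lie_ring) a)"
  by (simp_all add: additive_def lie_add_left lie_add_right)

lemmas lie_zero_left [simp] = additive.zero[OF additive_lie_left]
lemmas lie_zero_right [simp] = additive.zero[OF additive_lie_right]
lemmas lie_minus_left = additive.minus[OF additive_lie_left]
lemmas lie_minus_right = additive.minus[OF additive_lie_right]
lemmas lie_diff_left = additive.diff[OF additive_lie_left]
lemmas lie_diff_right = additive.diff[OF additive_lie_right]

lemma lie_anti: "lie b (a :: 'a::lie_ring) = - lie a b"
proof -
  have "lie (a + b) (a + b) = lie a b + lie b a"
    by (simp add: lie_add_left lie_add_right lie_self[of a] lie_self[of b])
  then show ?thesis by (simp add: lie_self[of "a + b"] eq_neg_iff_add_eq_0 add.commute)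
qed

lemma lie_leibniz: "lie (lie a b) (c :: 'a::lie_ring) = lie (lie a c) b + lie a (lie b c)"
proof -
  have "lie (lie b c) a = - lie a (lie b c)" "lie (lie c a) b = - lie (lie a c) b"
    using lie_anti[of a "lie b c"] lie_anti[of c a] by (simp_all add: lie_minus_left)
  with lie_jacobi[of a b c] show ?thesis by (simp add: algebra_simps)
qed

lemma lie_lie_right: "lie a (lie b c) = lie (lie a b) c - lie (lie a c) (b :: 'a::lie_ring)"
  using lie_leibniz[of a b c] by simp

lemma lie_hom_additive: "lie_hom h \<Longrightarrow> additive h"
  by (simp add: lie_hom_def additive_def)

lemma lie_hom_lie: "lie_hom h \<Longrightarrow> h (lie a b) = lie (h a) (h b)"
  by (simp add: lie_hom_def)

lemma lie_hom_lie_products: "lie_hom h \<Longrightarrow> h (lie_products a bs) = lie_products (h a) (map h bs)"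
  unfolding lie_products_def
  by (induction bs arbitrary: a) (simp_all add: lie_hom_lie)

lemma lie_hom_left_normed: "lie_hom h \<Longrightarrow> h (left_normed g w) = left_normed (\<lambda>v. h (g v)) w"
  by (simp add: left_normed_def lie_hom_lie_products lie_hom_zero comp_def)

lemma lie_hom_comp: "lie_hom h \<Longrightarrow> lie_hom k \<Longrightarrow> lie_hom (\<lambda>a. h (k a))"
  by (simp add: lie_hom_def)

lemma left_normed_cong: "(\<And>v. v \<in> set w \<Longrightarrow> g v = g' v) \<Longrightarrow> left_normed g w = left_normed g' w"
  by (cases w) (simp_all add: left_normed_def cong: map_cong)

lemma left_normed_map: "left_normed g (map f w) = left_normed (\<lambda>v. g (f v)) w"
  by (cases w) (simp_all add: left_normed_def comp_def)

lemma lookup_left_normed_snoc: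
  assumes "w \<noteq> []"
  shows "lookup (left_normed letter (w @ [b])) z =
    (if z \<noteq> [] \<and> last z = b then lookup (left_normed letter w) (butlast z) else 0)
    - (if z \<noteq> [] \<and> hd z = b then lookup (left_normed letter w) (tl z) else 0)"
  using assms by (simp add: left_normed_snoc lie_poly_mapping_def lookup_minus lookup_mult_letter
      lookup_letter_mult)

section \<open>Shuffles\<close>

text \<open>Shuffles that agree as words are counted with their multiplicity, so this pairs
  \<open>f\<close> with the shuffle product of the two words.\<close>

fun shuffle_sum :: "('v list \<Rightarrow> int) \<Rightarrow> 'v list \<Rightarrow> 'v list \<Rightarrow> int" where
  "shuffle_sum f [] v = f v"
| "shuffle_sum f u [] = f u"
| "shuffle_sum f (a # u) (b # v) = shuffle_sum (\<lambda>w. f (a # w)) u (b # v) + shuffle_sum (\<lambda>w. f (b # w)) (a # u) v"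

lemma shuffle_sum_Nil2 [simp]: "shuffle_sum f u [] = f u" by (cases u) simp_all

lemma shuffle_sum_add: "shuffle_sum (\<lambda>w. f w + g w) u v = shuffle_sum f u v + shuffle_sum g u v"
  by (induction f u v arbitrary: g rule: shuffle_sum.induct) simp_all
lemma shuffle_sum_zero [simp]: "shuffle_sum (\<lambda>w. 0) u v = 0"
  by (induction "\<lambda>w::'a list. 0::int" u v rule: shuffle_sum.induct) simp_all
lemma shuffle_sum_mult: "shuffle_sum (\<lambda>w. k * f w) u v = k * shuffle_sum f u v"
  by (induction f u v rule: shuffle_sum.induct) (simp_all add: algebra_simps)
lemma shuffle_sum_diff: "shuffle_sum (\<lambda>w. f w - g w) u v = shuffle_sum f u v - shuffle_sum g u v"
  using shuffle_sum_add[of f "\<lambda>w. - 1 * g w" u v] shuffle_sum_mult[of "-1" g u v] by simp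
lemma shuffle_sum_sum: "shuffle_sum (\<lambda>w. \<Sum>i\<in>I. f i w) u v = (\<Sum>i\<in>I. shuffle_sum (f i) u v)"
  by (induction I rule: infinite_finite_induct) (simp_all add: shuffle_sum_add)

lemma shuffle_sum_cong:
  "(\<And>w. mset w = mset u + mset v \<Longrightarrow> f w = g w) \<Longrightarrow> shuffle_sum f u v = shuffle_sum g u v"
  by (induction f u v arbitrary: g rule: shuffle_sum.induct) simp_all

lemma shuffle_sum_hd:
  "shuffle_sum (\<lambda>z. if z \<noteq> [] \<and> hd z = b then f (tl z) else 0) u v =
    (if u \<noteq> [] \<and> hd u = b then shuffle_sum f (tl u) v else 0) + (if v \<noteq> [] \<and> hd v = b then shuffle_sum f u (tl v) else 0)"
  by (cases u; cases v) (simp_all cong: if_cong)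

lemma shuffle_sum_snoc:
  "shuffle_sum f (u @ [a]) (v @ [b]) = shuffle_sum (\<lambda>w. f (w @ [a])) u (v @ [b]) + shuffle_sum (\<lambda>w. f (w @ [b])) (u @ [a]) v"
proof (induction "length u + length v" arbitrary: f u v rule: less_induct)
  case less
  show ?case
  proof (cases u; cases v)
    fix c u' d v' assume uv: "u = c # u'" "v = d # v'"
    then show ?thesis using less[of u' v] less[of u v'] by simp
  next
    fix d v' assume uv: "u = []" "v = d # v'"
    then show ?thesis using less[of u v'] by simp
  next
    fix c u' assume uv: "u = c # u'" "v = []"
    then show ?thesis using less[of u' v] by simp
  qed simp
qed

text \<open>Together with \<open>shuffle_sum_hd\<close> this reads shuffles from either end, as a
  bracket with a letter adds that letter at either end of a word.\<close>

lemma shuffle_sum_last: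
  "shuffle_sum (\<lambda>z. if z \<noteq> [] \<and> last z = b then f (butlast z) else 0) u v =
    (if u \<noteq> [] \<and> last u = b then shuffle_sum f (butlast u) v else 0)
    + (if v \<noteq> [] \<and> last v = b then shuffle_sum f u (butlast v) else 0)"
  by (cases u rule: rev_cases; cases v rule: rev_cases) (simp_all add: shuffle_sum_snoc cong: if_cong)

lemma shuffle_sum_lookup_zero: "shuffle_sum (lookup (0 :: 'v assoc)) u v = 0"
proof -
  have "lookup (0 :: 'v assoc) = (\<lambda>w. 0)" by (simp add: fun_eq_iff)
  then show ?thesis by (simp only: shuffle_sum_zero)
qed

text \<open>One half of Ree's criterion. Bracketing with \<open>b\<close> adds \<open>b\<close> at the
  end of a word or, with a minus sign, at its beginning. By induction the only terms that
  survive in the sum over the shuffles are those in which \<open>u\<close> or \<open>v\<close>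
  is the one-letter word \<open>b\<close>, and these cancel.\<close>

lemma shuffle_sum_left_normed:
  "u \<noteq> [] \<Longrightarrow> v \<noteq> [] \<Longrightarrow> shuffle_sum (lookup (left_normed letter w)) u v = 0"
proof (induction w arbitrary: u v rule: rev_induct)
  case (snoc b w)
  show ?case
  proof (cases "w = []")
    case True
    have "shuffle_sum (lookup (letter b)) u v = shuffle_sum (\<lambda>w. 0) u v"
    proof (rule shuffle_sum_cong)
      fix w assume w: "mset w = mset u + mset v"
      have "length w = length u + length v" using arg_cong[OF w, of size] by simp
      with snoc.prems have "w \<noteq> [b]" by (cases u; cases v) auto
      then show "lookup (letter b) w = 0" by (simp add: letter_def)
    qed
    with True show ?thesis by simp
  next
    case False
    let ?f = "lookup (left_normed letter w)"
    have u: "shuffle_sum ?f (butlast u) v = (if length u = 1 then ?f v else 0)"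
      "shuffle_sum ?f (tl u) v = (if length u = 1 then ?f v else 0)"
      using snoc.prems snoc.IH[of "butlast u" v] snoc.IH[of "tl u" v]
      by (cases u; cases "tl u"; simp)+
    have v: "shuffle_sum ?f u (butlast v) = (if length v = 1 then ?f u else 0)"
      "shuffle_sum ?f u (tl v) = (if length v = 1 then ?f u else 0)"
      using snoc.prems snoc.IH[of u "butlast v"] snoc.IH[of u "tl v"]
      by (cases v; cases "tl v"; simp)+
    have 1: "hd x = last x" if "length x = 1" for x :: "'a list"
      using that by (cases x) auto
    have "shuffle_sum (lookup (left_normed letter (w @ [b]))) u v =
      shuffle_sum (\<lambda>z. if z \<noteq> [] \<and> last z = b then ?f (butlast z) else 0) u v
      - shuffle_sum (\<lambda>z. if z \<noteq> [] \<and> hd z = b then ?f (tl z) else 0) u v"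
      unfolding shuffle_sum_diff[symmetric] by (rule shuffle_sum_cong) (rule lookup_left_normed_snoc[OF False])
    then show ?thesis unfolding shuffle_sum_hd shuffle_sum_last u v using snoc.prems 1[of u] 1[of v] by auto
  qed
qed (simp add: shuffle_sum_lookup_zero)

lemma shuffle_sum_expand:
  assumes "finite A" "\<And>w. f w \<noteq> 0 \<Longrightarrow> w \<in> A"
  shows "shuffle_sum f u v = (\<Sum>w\<in>A. f w * shuffle_sum (\<lambda>x. of_bool (x = w)) u v)"
proof -
  have "f = (\<lambda>x. \<Sum>w\<in>A. f w * of_bool (x = w))"
  proof
    fix x show "f x = (\<Sum>w\<in>A. f w * of_bool (x = w))"
      using assms by (cases "x \<in> A") (auto simp: of_bool_def if_distrib cong: if_cong)
  qed
  then have "shuffle_sum f u v = shuffle_sum (\<lambda>x. \<Sum>w\<in>A. f w * of_bool (x = w)) u v" by simp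
  then show ?thesis by (simp only: shuffle_sum_sum shuffle_sum_mult)
qed

text \<open>Split the shuffles of the reversed prefix of \<open>z\<close> of length \<open>j\<close>
  with the remaining suffix according to their first letter. The shuffles for \<open>j\<close>
  that start in the suffix are those for \<open>j + 1\<close> that start in the prefix, so the
  alternating sum telescopes. Hence a function that vanishes on proper shuffles is determined
  by its values on the words that begin with any chosen letter of \<open>z\<close>.\<close>

lemma coefficient_from_letter:
  assumes "\<And>u v. u \<noteq> [] \<Longrightarrow> v \<noteq> [] \<Longrightarrow> length u + length v = length z \<Longrightarrow> [shuffle_sum c u v = 0] (mod m)"
    and "i < length z"
  shows "[c z = (-1) ^ i * shuffle_sum (\<lambda>w. c (z ! i # w)) (rev (take i z)) (drop (Suc i) z)] (mod m)"
  using assms(2)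
proof (induction i)
  case 0
  then show ?case by (cases z) simp_all
next
  case (Suc i)
  let ?u = "rev (take i z)" and ?v = "drop (Suc (Suc i)) z"
  have t: "rev (take (Suc i) z) = z ! i # ?u" using Suc.prems by (simp add: take_Suc_conv_app_nth)
  have d: "drop (Suc i) z = z ! Suc i # ?v" using Suc.prems by (simp add: Cons_nth_drop_Suc)
  have "[shuffle_sum c (z ! i # ?u) (z ! Suc i # ?v) = 0] (mod m)"
    by (rule assms(1)) (use Suc.prems in auto)
  then have "[shuffle_sum (\<lambda>w. c (z ! i # w)) ?u (drop (Suc i) z)
      + shuffle_sum (\<lambda>w. c (z ! Suc i # w)) (rev (take (Suc i) z)) ?v = 0] (mod m)"
    by (simp only: t d shuffle_sum.simps)
  from cong_mult[OF Cong.cong_refl[of "(-1) ^ i"] this]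
  have "[(-1) ^ i * shuffle_sum (\<lambda>w. c (z ! i # w)) ?u (drop (Suc i) z)
      = (-1) ^ Suc i * shuffle_sum (\<lambda>w. c (z ! Suc i # w)) (rev (take (Suc i) z)) ?v] (mod m)"
    by (simp add: cong_iff_dvd_diff algebra_simps)
  then show ?case using Suc by (meson Suc_lessD Cong.cong_trans)
qed

text \<open>In the expansion of the bracket each letter of \<open>w\<close> is put to the right of
  \<open>a\<close> or, with a minus sign, to its left. The letters on the left come in reverse
  order, so \<open>w\<close> is a shuffle of the reversed left part with the right part.\<close>

lemma lookup_left_normed:
  "lookup (left_normed letter (a # w)) z = (\<Sum>i<length z. if z ! i = a
     then (-1) ^ i * shuffle_sum (\<lambda>x. of_bool (x = w)) (rev (take i z)) (drop (Suc i) z) else 0)"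
proof (induction w arbitrary: z rule: rev_induct)
  case Nil
  have "shuffle_sum (\<lambda>x. of_bool (x = [])) u v = (of_bool (u = [] \<and> v = []) :: int)" for u v :: "'a list"
    by (cases u; cases v) simp_all
  then have "(\<Sum>i<length z. if z ! i = a
      then (-1) ^ i * shuffle_sum (\<lambda>x. of_bool (x = [])) (rev (take i z)) (drop (Suc i) z) else 0)
    = (\<Sum>i<length z. if z = [a] then 1 else 0)"
    by (intro sum.cong) (auto simp: take_eq_Nil Suc_le_eq nth_eq_iff_index_eq length_Suc_conv le_Suc_eq)
  then show ?case by (auto simp: letter_def)
next
  case (snoc b w)
  let ?S = "\<lambda>w u v. shuffle_sum (\<lambda>x. of_bool (x = w)) u v :: int"
  have S: "?S (w @ [b]) u v = (if u \<noteq> [] \<and> last u = b then ?S w (butlast u) v else 0)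
    + (if v \<noteq> [] \<and> last v = b then ?S w u (butlast v) else 0)" for u v
  proof -
    have "(\<lambda>x. of_bool (x = w @ [b]) :: int)
      = (\<lambda>x. if x \<noteq> [] \<and> last x = b then of_bool (butlast x = w) else 0)"
    proof
      fix x show "of_bool (x = w @ [b]) = (if x \<noteq> [] \<and> last x = b then of_bool (butlast x = w) else (0::int))"
        by (cases x rule: rev_cases) auto
    qed
    then show ?thesis by (simp only: shuffle_sum_last[of b "\<lambda>x. of_bool (x = w)" u v])
  qed
  show ?case
  proof (cases z)
    case (Cons e z')
    define n where "n = length z'"
    have len: "length z = Suc n" using Cons by (simp add: n_def)
    let ?t = "\<lambda>w z i. if z ! i = a then (-1) ^ i * ?S w (rev (take i z)) (drop (Suc i) z) else 0"
    have A: "?t (w @ [b]) z i = (if i < n \<and> last z = b then ?t w (butlast z) i else 0)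
        - (if 0 < i \<and> hd z = b then ?t w (tl z) (i - 1) else 0)" if "i < Suc n" for i
    proof -
      let ?u = "rev (take i z)" and ?v = "drop (Suc i) z"
      have L: "(if ?v \<noteq> [] \<and> last ?v = b then ?S w ?u (butlast ?v) else 0)
        = (if i < n \<and> last z = b then ?S w (rev (take i (butlast z))) (drop (Suc i) (butlast z)) else 0)"
        using len that by (simp add: butlast_drop take_butlast not_le del: rev_take cong: conj_cong)
      have R: "(if ?u \<noteq> [] \<and> last ?u = b then ?S w (butlast ?u) ?v else 0)
        = (if 0 < i \<and> hd z = b then ?S w (rev (take (i - 1) (tl z))) (drop (Suc (i - 1)) (tl z)) else 0)"
        using Cons by (cases i) auto
      have lz: "butlast z ! i = z ! i" if "i < n" using that len by (simp add: nth_butlast)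
      have S': "?S (w @ [b]) ?u ?v =
        (if i < n \<and> last z = b then ?S w (rev (take i (butlast z))) (drop (Suc i) (butlast z)) else 0)
        + (if 0 < i \<and> hd z = b then ?S w (rev (take (i - 1) (tl z))) (drop (Suc (i - 1)) (tl z)) else 0)"
        unfolding S[of ?u ?v] L R by (rule add.commute)
      show ?thesis
      proof (cases i)
        case 0
        with S' lz show ?thesis by simp
      next
        case (Suc j)
        have tz: "tl z ! j = z ! i" using Cons Suc by simp
        show ?thesis unfolding S' using lz tz Suc by (simp add: algebra_simps)
      qed
    qed
    have "(\<Sum>i<length z. ?t (w @ [b]) z i) =
      (\<Sum>i<Suc n. if i < n \<and> last z = b then ?t w (butlast z) i else 0)
      - (\<Sum>i<Suc n. if 0 < i \<and> hd z = b then ?t w (tl z) (i - 1) else 0)"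
      unfolding len sum_subtractf[symmetric] by (rule sum.cong) (use A in auto)
    also have "(\<Sum>i<Suc n. if i < n \<and> last z = b then ?t w (butlast z) i else 0)
      = (if last z = b then lookup (left_normed letter (a # w)) (butlast z) else 0)"
      using len by (simp add: snoc)
    also have "(\<Sum>i<Suc n. if 0 < i \<and> hd z = b then ?t w (tl z) (i - 1) else 0)
      = (if hd z = b then lookup (left_normed letter (a # w)) (tl z) else 0)"
      unfolding sum.lessThan_Suc_shift using len by (simp add: snoc cong: if_cong)
    finally show ?thesis using lookup_left_normed_snoc[of "a # w" b z] Cons by simp
  qed (use lookup_left_normed_snoc[of "a # w" b z] in simp)
qed

text \<open>With the constant predicate \<open>True\<close> this is the usual Dynkin operator.\<close>

definition weighted_dynkin :: "('v \<Rightarrow> bool) \<Rightarrow> 'v assoc \<Rightarrow> 'v assoc"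
  where "weighted_dynkin A c = lin (\<lambda>w. if w \<noteq> [] \<and> A (hd w) then left_normed letter w else 0) c"

text \<open>A generalisation of the Dynkin--Specht--Wever theorem: the coefficient of \<open>z\<close>
  collects, for each letter of \<open>z\<close> that satisfies \<open>A\<close>, the sum that
  \<open>coefficient_from_letter\<close> identifies with the value at \<open>z\<close>.\<close>

lemma lookup_weighted_dynkin:
  assumes "\<And>u v. u \<noteq> [] \<Longrightarrow> v \<noteq> [] \<Longrightarrow> length u + length v = length z \<Longrightarrow> [shuffle_sum (lookup c) u v = 0] (mod m)"
  shows "[lookup (weighted_dynkin A c) z = int (length (filter A z)) * lookup c z] (mod m)"
proof -
  let ?K = "keys c"
  let ?S = "\<lambda>w i. shuffle_sum (\<lambda>x. of_bool (x = w)) (rev (take i z)) (drop (Suc i) z) :: int"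
  have 1: "shuffle_sum (\<lambda>w. lookup c (a # w)) u v =
      (\<Sum>w\<in>{w \<in> ?K. w \<noteq> [] \<and> hd w = a}. lookup c w * shuffle_sum (\<lambda>x. of_bool (x = tl w)) u v)" for a u v
  proof -
    have "shuffle_sum (\<lambda>w. lookup c (a # w)) u v =
        (\<Sum>w\<in>tl ` {w \<in> ?K. w \<noteq> [] \<and> hd w = a}. lookup c (a # w) * shuffle_sum (\<lambda>x. of_bool (x = w)) u v)"
    proof (rule shuffle_sum_expand)
      fix w assume "lookup c (a # w) \<noteq> 0"
      then show "w \<in> tl ` {w \<in> ?K. w \<noteq> [] \<and> hd w = a}"
        by (intro image_eqI[of _ tl "a # w"]) (auto simp: in_keys_iff)
    qed simp
    also have "\<dots> = (\<Sum>w\<in>{w \<in> ?K. w \<noteq> [] \<and> hd w = a}. lookup c w * shuffle_sum (\<lambda>x. of_bool (x = tl w)) u v)"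
    proof (rule sum.reindex_cong[of tl])
      show "inj_on tl {w \<in> ?K. w \<noteq> [] \<and> hd w = a}"
        by (rule inj_onI) (metis (mono_tags, lifting) list.collapse mem_Collect_eq)
    qed auto
    finally show ?thesis .
  qed
  have "lookup (weighted_dynkin A c) z = (\<Sum>w\<in>?K. if w \<noteq> [] \<and> A (hd w) then lookup c w * lookup (left_normed letter w) z else 0)"
    unfolding weighted_dynkin_def lookup_lin by (rule sum.cong) auto
  also have "\<dots> = (\<Sum>w\<in>?K. \<Sum>i<length z. if w \<noteq> [] \<and> A (hd w) \<and> z ! i = hd w
      then (-1) ^ i * (lookup c w * ?S (tl w) i) else 0)"
  proof (rule sum.cong)
    fix w
    show "(if w \<noteq> [] \<and> A (hd w) then lookup c w * lookup (left_normed letter w) z else 0) =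
      (\<Sum>i<length z. if w \<noteq> [] \<and> A (hd w) \<and> z ! i = hd w
        then (-1) ^ i * (lookup c w * ?S (tl w) i) else 0)"
      by (cases w) (auto simp: lookup_left_normed sum_distrib_left intro!: sum.cong)
  qed simp
  also have "\<dots> = (\<Sum>i<length z. \<Sum>w\<in>?K. if w \<noteq> [] \<and> A (hd w) \<and> z ! i = hd w
      then (-1) ^ i * (lookup c w * ?S (tl w) i) else 0)"
    by (rule sum.swap)
  also have "\<dots> = (\<Sum>i<length z. if A (z ! i) then
      (-1) ^ i * shuffle_sum (\<lambda>w. lookup c (z ! i # w)) (rev (take i z)) (drop (Suc i) z) else 0)"
  proof (rule sum.cong)
    fix i
    have "(\<Sum>w\<in>?K. if w \<noteq> [] \<and> A (hd w) \<and> z ! i = hd w then (-1) ^ i * (lookup c w * ?S (tl w) i) else 0)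
      = (\<Sum>w\<in>{w \<in> ?K. w \<noteq> [] \<and> hd w = z ! i}. if A (z ! i) then (-1) ^ i * (lookup c w * ?S (tl w) i) else 0)"
      by (rule sum.mono_neutral_cong_right) auto
    then show "(\<Sum>w\<in>?K. if w \<noteq> [] \<and> A (hd w) \<and> z ! i = hd w then (-1) ^ i * (lookup c w * ?S (tl w) i) else 0)
      = (if A (z ! i) then
      (-1) ^ i * shuffle_sum (\<lambda>w. lookup c (z ! i # w)) (rev (take i z)) (drop (Suc i) z) else 0)"
      by (auto simp: 1 sum_distrib_left)
  qed simp
  also have "[\<dots> = (\<Sum>i<length z. if A (z ! i) then lookup c z else 0)] (mod m)"
    by (rule cong_sum) (use coefficient_from_letter[OF assms] in \<open>auto simp: cong_sym_eq\<close>)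
  also have "(\<Sum>i<length z. if A (z ! i) then lookup c z else 0) = int (length (filter A z)) * lookup c z"
    by (simp add: length_filter_conv_card sum.If_cases Int_def)
  finally show ?thesis .
qed

section \<open>Lie elements of prime degree\<close>

definition homog :: "nat \<Rightarrow> 'v assoc \<Rightarrow> bool"
  where "homog n c \<longleftrightarrow> (\<forall>w. lookup c w \<noteq> 0 \<longrightarrow> length w = n)"

lemma homog_lookup: "homog n c \<Longrightarrow> length w \<noteq> n \<Longrightarrow> lookup c w = 0"
  by (auto simp: homog_def)

lemma homogD: "homog n c \<Longrightarrow> lookup c w \<noteq> 0 \<Longrightarrow> length w = n"
  by (auto simp: homog_def)

lemma add_closed_homog: "add_closed (Collect (homog n))"
  unfolding homog_def[abs_def] by (rule add_closed_supported)

lemma homog_zero [simp]: "homog n 0" by (simp add: homog_def)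
lemma homog_diff: "homog n c \<Longrightarrow> homog n d \<Longrightarrow> homog n (c - d)"
  using add_closed_diff[OF add_closed_homog] by blast
lemma homog_add: "homog n c \<Longrightarrow> homog n d \<Longrightarrow> homog n (c + d)"
  using add_closed_add[OF add_closed_homog] by blast
lemma homog_minus: "homog n c \<Longrightarrow> homog n (- c)"
  using add_closed_minus[OF add_closed_homog] by blast
lemma homog_zmul: "homog n c \<Longrightarrow> homog n (zmul k c)"
  using add_closed_zmul[OF add_closed_homog] by blast
lemma homog_lin: "(\<And>w. w \<in> keys c \<Longrightarrow> homog n (h w)) \<Longrightarrow> homog n (lin h c)"
  using add_closed_lin[OF add_closed_homog, of c h n] by simp
lemma homog_frag_of: "homog n (frag_of w) \<longleftrightarrow> length w = n"
  by (auto simp: homog_def split: if_splits)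

lemma homog_keys: "homog n c \<Longrightarrow> w \<in> keys c \<Longrightarrow> length w = n"
  by (auto simp: homog_def in_keys_iff)

lemma content_left_normed: "lookup (left_normed letter w) z \<noteq> 0 \<Longrightarrow> mset z = mset w"
proof (induction w arbitrary: z rule: rev_induct)
  case (snoc b w)
  show ?case
  proof (cases "w = []")
    case True
    with snoc.prems show ?thesis by (simp add: letter_def split: if_splits)
  next
    case False
    then have "z \<noteq> [] \<and> (last z = b \<and> lookup (left_normed letter w) (butlast z) \<noteq> 0
        \<or> hd z = b \<and> lookup (left_normed letter w) (tl z) \<noteq> 0)"
      using snoc.prems by (auto simp: lookup_left_normed_snoc split: if_splits)
    then have "z \<noteq> []" "last z = b \<and> mset (butlast z) = mset w \<or> hd z = b \<and> mset (tl z) = mset w"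
      using snoc.IH[of "butlast z"] snoc.IH[of "tl z"] by argo+
    moreover have "mset z = mset (butlast z) + {#last z#}" if "z \<noteq> []"
      using arg_cong[OF append_butlast_last_id[OF that], of mset] by simp
    moreover have "mset z = mset (tl z) + {#hd z#}" if "z \<noteq> []"
      using that by (cases z) simp_all
    ultimately show ?thesis by auto
  qed
qed simp

lemma homog_left_normed: "homog (length w) (left_normed letter w)"
  unfolding homog_def using content_left_normed mset_eq_length by blast

lemma lin_left_normed_mult_letter:
  assumes "homog n c" "0 < n"
  shows "lin (left_normed g) (c * letter b) = lie (lin (left_normed g) c) (g b)"
proof -
  have ne: "w \<noteq> []" if "w \<in> keys c" for w using homog_keys[OF assms(1) that] assms(2) by auto
  have "lin (left_normed g) (c * letter b) = lin (\<lambda>w. lie (left_normed g w) (g b)) c"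
    unfolding lin_mult_letter by (rule lin_cong) (rule left_normed_snoc, rule ne)
  then show ?thesis by (simp add: additive_lin_comp[OF additive_lie_left])
qed

definition restr :: "('v list \<Rightarrow> bool) \<Rightarrow> 'v assoc \<Rightarrow> 'v assoc"
  where "restr P c = lin (\<lambda>w. if P w then frag_of w else 0) c"

lemma lookup_restr: "lookup (restr P c) z = (if P z then lookup c z else 0)"
proof (induction c rule: frag_induction[OF subset_UNIV])
  case (3 a b)
  then show ?case by (simp add: restr_def lin_diff lookup_minus)
qed (auto simp: restr_def)

lemma additive_restr: "additive (restr P)"
  unfolding restr_def by (rule additive_lin)

lemma homog_restr: "homog n c \<Longrightarrow> homog n (restr P c)"
  by (auto simp: homog_def lookup_restr)

lemma sum_restr_content: "(\<Sum>\<kappa>\<in>mset ` keys c. restr (\<lambda>w. mset w = \<kappa>) c) = c"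
  by (rule poly_mapping_eqI) (auto simp: lookup_sum lookup_restr in_keys_iff)

lemma lin_restr: "lin h (restr P c) = lin (\<lambda>w. if P w then h w else 0) c"
  by (simp add: restr_def additive_lin_comp[OF additive_lin] if_distrib[of "lin h"] cong: if_cong)

lemma zmul_of_dvd:
  assumes "\<And>w. m dvd lookup c w"
  obtains d where "c = zmul m d" "\<And>w. lookup c w = 0 \<Longrightarrow> lookup d w = 0"
proof
  let ?d = "Poly_Mapping.map (\<lambda>k. k div m) c"
  show "c = zmul m ?d"
  proof (rule poly_mapping_eqI)
    fix w have "m dvd lookup c w" by fact
    then show "lookup c w = lookup (zmul m ?d) w"
      by (simp add: Poly_Mapping.map.rep_eq when_def)
  qed
  show "lookup ?d w = 0" if "lookup c w = 0" for w
    using that by (simp add: Poly_Mapping.map.rep_eq)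
qed

definition lie_elts :: "nat \<Rightarrow> 'v assoc set"
  where "lie_elts n = lin (left_normed letter) ` Collect (homog n)"

lemma add_closed_lie_elts: "add_closed (lie_elts n)"
  unfolding lie_elts_def by (rule add_closed_image[OF additive_lin add_closed_homog])

lemma homog_lie_elts: "c \<in> lie_elts n \<Longrightarrow> homog n c"
proof -
  assume "c \<in> lie_elts n"
  then obtain \<phi> where \<phi>: "homog n \<phi>" "c = lin (left_normed letter) \<phi>" unfolding lie_elts_def by blast
  have "homog n (left_normed letter w)" if "w \<in> keys \<phi>" for w
    using homog_left_normed[of w] homog_keys[OF \<phi>(1) that] by simp
  then show "homog n c" unfolding \<phi>(2) by (rule homog_lin)
qed

lemma left_normed_in_lie_elts: "length w = n \<Longrightarrow> left_normed letter w \<in> lie_elts n"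
  unfolding lie_elts_def by (rule image_eqI[where x = "frag_of w"]) (simp_all add: homog_frag_of)

lemma shuffle_sum_lie_elts:
  assumes "c \<in> lie_elts n" "u \<noteq> []" "v \<noteq> []"
  shows "shuffle_sum (lookup c) u v = 0"
proof -
  obtain \<phi> where c: "c = lin (left_normed letter) \<phi>" using assms(1) by (auto simp: lie_elts_def)
  have "lookup c = (\<lambda>z. \<Sum>w\<in>keys \<phi>. lookup \<phi> w * lookup (left_normed letter w) z)"
    unfolding c by (rule ext) (rule lookup_lin)
  then show ?thesis using assms(2,3) by (simp add: shuffle_sum_sum shuffle_sum_mult shuffle_sum_left_normed)
qed

lemma weighted_dynkin_in_lie_elts: "homog n c \<Longrightarrow> weighted_dynkin A c \<in> lie_elts n"
  unfolding lie_elts_def weighted_dynkin_def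
  by (rule image_eqI[where x = "restr (\<lambda>w. w \<noteq> [] \<and> A (hd w)) c"])
    (simp_all add: lin_restr homog_restr)

text \<open>The sums over shuffles are the coefficients of the coproduct of the tensor algebra, so for
  \<open>m = 0\<close> this describes the primitive elements of degree \<open>n\<close>.\<close>

definition primitive :: "int \<Rightarrow> nat \<Rightarrow> ('v list \<Rightarrow> int) \<Rightarrow> bool"
  where "primitive m n c \<longleftrightarrow>
    (\<forall>u v. u \<noteq> [] \<longrightarrow> v \<noteq> [] \<longrightarrow> length u + length v = n \<longrightarrow> m dvd shuffle_sum c u v)"

lemma primitive_restr_content:
  assumes "primitive m n (lookup c)"
  shows "primitive m n (lookup (restr (\<lambda>w. mset w = \<kappa>) c))"
  unfolding primitive_def
proof (intro allI impI)
  fix u v :: "'a list"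
  assume uv: "u \<noteq> []" "v \<noteq> []" "length u + length v = n"
  have "shuffle_sum (lookup (restr (\<lambda>w. mset w = \<kappa>) c)) u v =
    shuffle_sum (\<lambda>w. of_bool (mset u + mset v = \<kappa>) * lookup c w) u v"
    by (rule shuffle_sum_cong) (simp add: lookup_restr)
  then show "m dvd shuffle_sum (lookup (restr (\<lambda>w. mset w = \<kappa>) c)) u v"
    using assms uv by (simp add: primitive_def shuffle_sum_mult)
qed

lemma shuffle_sum_replicate:
  "shuffle_sum f [a] (replicate k a) = int (Suc k) * f (replicate (Suc k) a)"
proof (induction k arbitrary: f)
  case (Suc k)
  then show ?case by (simp add: algebra_simps)
qed simp

text \<open>The factor by which the operator multiplies a word is the same for all words of
  \<open>c\<close>, so on \<open>c\<close> the operator is a scalar modulo \<open>m\<close>.\<close>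

lemma weighted_dynkin_content:
  assumes "primitive m n (lookup c)" "homog n c" "0 < n"
    and "\<And>w. lookup c w \<noteq> 0 \<Longrightarrow> length (filter A w) = k"
  obtains e where "weighted_dynkin A c = zmul (int k) c + zmul m e" "homog n e"
proof -
  have "m dvd lookup (weighted_dynkin A c - zmul (int k) c) z" for z
  proof (cases "length z = n")
    case True
    have "[lookup (weighted_dynkin A c) z = int (length (filter A z)) * lookup c z] (mod m)"
      by (rule lookup_weighted_dynkin) (use assms(1) True in \<open>auto simp: primitive_def cong_0_iff\<close>)
    also have "int (length (filter A z)) * lookup c z = int k * lookup c z"
      using assms(4) by force
    finally show ?thesis by (simp add: lookup_minus cong_iff_dvd_diff)
  next
    case False
    then show ?thesis
      using homog_lookup[OF homog_lie_elts[OF weighted_dynkin_in_lie_elts[OF assms(2)]] False] homog_lookup[OF assms(2) False]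
      by (simp add: lookup_minus)
  qed
  then obtain e where e: "weighted_dynkin A c - zmul (int k) c = zmul m e"
    "\<And>w. lookup (weighted_dynkin A c - zmul (int k) c) w = 0 \<Longrightarrow> lookup e w = 0"
    using zmul_of_dvd by blast
  have "homog n (weighted_dynkin A c - zmul (int k) c)"
    by (intro homog_diff homog_zmul assms homog_lie_elts[OF weighted_dynkin_in_lie_elts])
  with e(2) have "homog n e" unfolding homog_def by blast
  with that e(1) show ?thesis by (simp add: diff_eq_eq add.commute)
qed

lemma content_cases:
  assumes "size \<kappa> = n" "0 < n"
  obtains a where "\<kappa> = replicate_mset n a" | a where "0 < count \<kappa> a" "count \<kappa> a < n"
proof -
  obtain a where a: "a \<in># \<kappa>" using assms by fastforce
  show ?thesis
  proof (cases "count \<kappa> a = n")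
    case True
    then have sub: "replicate_mset n a \<subseteq># \<kappa>"
      by (simp flip: count_le_replicate_mset_subset_eq)
    have "size (\<kappa> - replicate_mset n a) = 0" using size_Diff_submset[OF sub] assms by simp
    then have "\<kappa> = replicate_mset n a" using subset_mset.diff_add[OF sub] by simp
    then show ?thesis by (rule that)
  next
    case False
    then show ?thesis using a assms count_le_size[of \<kappa> a] that(2)[of a] by simp
  qed
qed

lemma mset_eq_replicate_mset: "mset w = replicate_mset n a \<longleftrightarrow> w = replicate n a"
proof
  assume w: "mset w = replicate_mset n a"
  show "w = replicate n a"
  proof (rule replicate_eqI)
    show "length w = n" using arg_cong[OF w, of size] by simp
    show "b = a" if "b \<in> set w" for b
      using that arg_cong[OF w, of set_mset] by (auto split: if_splits)
  qed
qed simp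

text \<open>The operator weighted by the letter \<open>a\<close> multiplies \<open>c\<close> by the
  number \<open>k\<close> of letters \<open>a\<close> in each word, and the usual one
  multiplies it by \<open>p\<close>. Both values are Lie elements, equal to these multiples of
  \<open>c\<close> up to multiples of \<open>m\<close>, and \<open>k\<close> and
  \<open>p\<close> are coprime, so a combination of the two gives \<open>c\<close> itself up
  to multiples of \<open>m\<close>.\<close>

lemma lie_elts_if_mixed_content:
  assumes "prime p" "primitive m p (lookup c)" "homog p c" "\<And>w. lookup c w \<noteq> 0 \<Longrightarrow> mset w = \<kappa>"
    and "0 < count \<kappa> a" "count \<kappa> a < p"
  obtains l e where "l \<in> lie_elts p" "homog p e" "c = l + zmul m e"
proof -
  have p: "0 < p" using assms(1) prime_gt_0_nat by blast
  have count: "length (filter ((=) a) w) = count \<kappa> a" if "lookup c w \<noteq> 0" for w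
    using assms(4)[OF that, symmetric] by (simp add: count_mset count_list_eq_length_filter)
  obtain e1 where e1: "weighted_dynkin ((=) a) c = zmul (int (count \<kappa> a)) c + zmul m e1" "homog p e1"
    by (rule weighted_dynkin_content[OF assms(2,3) p count])
  have all: "length (filter (\<lambda>b. True) w) = p" if "lookup c w \<noteq> 0" for w
    using homogD[OF assms(3) that] by simp
  obtain e2 where e2: "weighted_dynkin (\<lambda>b. True) c = zmul (int p) c + zmul m e2" "homog p e2"
    by (rule weighted_dynkin_content[OF assms(2,3) p all])
  have "coprime (int (count \<kappa> a)) (int p)"
    using assms(1,5,6) by (simp add: coprime_commute prime_imp_coprime nat_dvd_not_less)
  then obtain x y where xy: "x * int (count \<kappa> a) + y * int p = 1"
    by (metis bezout_int coprime_iff_gcd_eq_1)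
  let ?l = "zmul x (weighted_dynkin ((=) a) c) + zmul y (weighted_dynkin (\<lambda>b. True) c)"
  let ?e = "- (zmul x e1 + zmul y e2)"
  have "zmul x (zmul (int (count \<kappa> a)) c) + zmul y (zmul (int p) c) = c"
    by (simp add: zmul_zmul xy flip: zmul_add_left)
  then have "c = ?l + zmul m ?e"
    unfolding e1 e2 by (simp add: zmul_add_right zmul_minus_right zmul_diff_right zmul_zmul algebra_simps)
  moreover have "?l \<in> lie_elts p"
    by (intro add_closed_add[OF add_closed_lie_elts] add_closed_zmul[OF add_closed_lie_elts]
        weighted_dynkin_in_lie_elts assms(3))
  moreover have "homog p ?e" by (intro homog_minus homog_add homog_zmul e1 e2)
  ultimately show ?thesis by (rule that[of ?l ?e, rotated 2])
qed

text \<open>Friedrichs' criterion over the integers, in prime degree. Each part of fixed content is a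
  Lie element by \<open>lie_elts_if_mixed_content\<close>, except for the content
  \<open>a\<^sup>p\<close>, where the shuffles of \<open>a\<close> with
  \<open>a\<^sup>p\<^sup>-\<^sup>1\<close> show that the coefficient times \<open>p\<close> is
  zero.\<close>

lemma lie_elts_if_primitive:
  assumes "prime p" "primitive 0 p (lookup c)" "homog p c"
  shows "c \<in> lie_elts p"
proof -
  have p: "0 < p" "1 < p" using assms(1) prime_gt_0_nat prime_gt_1_nat by blast+
  have "restr (\<lambda>w. mset w = \<kappa>) c \<in> lie_elts p" if "\<kappa> \<in> mset ` keys c" for \<kappa>
  proof -
    let ?d = "restr (\<lambda>w. mset w = \<kappa>) c"
    have size: "size \<kappa> = p" using that assms(3) by (auto simp: homog_def in_keys_iff)
    show ?thesis
    proof (rule content_cases[OF size p(1)])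
      fix a assume \<kappa>: "\<kappa> = replicate_mset p a"
      have "shuffle_sum (lookup c) [a] (replicate (p - 1) a) = 0"
        using assms(2) p by (auto simp: primitive_def)
      then have "lookup c (replicate p a) = 0"
        using p shuffle_sum_replicate[of "lookup c" a "p - 1"] by simp
      then have "?d = 0"
        by (intro poly_mapping_eqI) (auto simp: \<kappa> lookup_restr mset_eq_replicate_mset)
      then show ?thesis by (simp add: add_closed_0[OF add_closed_lie_elts])
    next
      fix a assume a: "0 < count \<kappa> a" "count \<kappa> a < p"
      obtain l e where "l \<in> lie_elts p" "?d = l + zmul 0 e"
        by (rule lie_elts_if_mixed_content[OF assms(1) primitive_restr_content[OF assms(2)]
          homog_restr[OF assms(3)] _ a]) (auto simp: lookup_restr split: if_splits)
      then show ?thesis by simp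
    qed
  qed
  then have "(\<Sum>\<kappa>\<in>mset ` keys c. restr (\<lambda>w. mset w = \<kappa>) c) \<in> lie_elts p"
    by (rule add_closed_sum[OF add_closed_lie_elts])
  then show ?thesis by (simp add: sum_restr_content)
qed

text \<open>Modulo \<open>p\<close> the powers \<open>a\<^sup>p\<close> are not excluded: the shuffles
  of two powers of \<open>a\<close> occur with a binomial coefficient that is divisible by
  \<open>p\<close>.\<close>

lemma lie_elts_if_primitive_mod:
  assumes "prime p" "primitive (int p) p (lookup c)" "homog p c"
  obtains l \<nu> e where "l \<in> lie_elts p" "homog p e"
    "c = l + lin (\<lambda>a. frag_of (replicate p a)) \<nu> + zmul (int p) e"
proof -
  have p: "0 < p" "1 < p" using assms(1) prime_gt_0_nat prime_gt_1_nat by blast+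
  let ?q = "lin (\<lambda>a. frag_of (replicate p a))"
  let ?Q = "{l + q | l q. l \<in> lie_elts p \<and> q \<in> range ?q}"
  let ?A = "{l + e | l e. l \<in> ?Q \<and> e \<in> zmul (int p) ` Collect (homog p)}"
  have A: "add_closed ?A"
    by (rule add_closed_set_plus[OF add_closed_set_plus[OF add_closed_lie_elts
          add_closed_image[OF additive_lin add_closed_UNIV]]
          add_closed_image[OF additive_zmul_right add_closed_homog]])
  have "restr (\<lambda>w. mset w = \<kappa>) c \<in> ?A" if "\<kappa> \<in> mset ` keys c" for \<kappa>
  proof -
    let ?d = "restr (\<lambda>w. mset w = \<kappa>) c"
    have size: "size \<kappa> = p" using that assms(3) by (auto simp: homog_def in_keys_iff)
    show ?thesis
    proof (rule content_cases[OF size p(1)])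
      fix a assume \<kappa>: "\<kappa> = replicate_mset p a"
      have "?d = ?q (zmul (lookup c (replicate p a)) (frag_of a))"
        by (rule poly_mapping_eqI) (auto simp: \<kappa> lookup_restr mset_eq_replicate_mset lin_zmul)
      then have d: "?d = (0 + ?q (zmul (lookup c (replicate p a)) (frag_of a))) + zmul (int p) 0"
        by simp
      have "0 + ?q (zmul (lookup c (replicate p a)) (frag_of a)) \<in> ?Q"
        using add_closed_0[OF add_closed_lie_elts] by blast
      moreover have "zmul (int p) 0 \<in> zmul (int p) ` Collect (homog p)"
        by (intro imageI) simp
      ultimately show ?thesis unfolding d by blast
    next
      fix a assume a: "0 < count \<kappa> a" "count \<kappa> a < p"
      obtain l e where le: "l \<in> lie_elts p" "homog p e" "?d = l + zmul (int p) e"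
        by (rule lie_elts_if_mixed_content[OF assms(1) primitive_restr_content[OF assms(2)]
          homog_restr[OF assms(3)] _ a]) (auto simp: lookup_restr split: if_splits)
      then have d: "?d = (l + ?q 0) + zmul (int p) e" by simp
      have "l + ?q 0 \<in> ?Q" using le(1) by blast
      moreover have "zmul (int p) e \<in> zmul (int p) ` Collect (homog p)"
        by (intro imageI) (simp add: le(2))
      ultimately show ?thesis unfolding d by blast
    qed
  qed
  then have "(\<Sum>\<kappa>\<in>mset ` keys c. restr (\<lambda>w. mset w = \<kappa>) c) \<in> ?A"
    by (rule add_closed_sum[OF A])
  then have "c \<in> ?A" by (simp only: sum_restr_content)
  then obtain q e where qe: "c = q + e" "q \<in> ?Q" "e \<in> zmul (int p) ` Collect (homog p)"
    by blast
  from qe(2) obtain l q' where l': "q = l + q'" "l \<in> lie_elts p" "q' \<in> range ?q"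
    by blast
  from l'(3) obtain \<nu> where "q' = ?q \<nu>" by (elim imageE)
  with l' have l: "q = l + ?q \<nu>" "l \<in> lie_elts p" by simp_all
  from qe(3) obtain e' where e': "e = zmul (int p) e'" "homog p e'" by (elim imageE) simp
  show ?thesis by (rule that[OF l(2) e'(2)]) (simp add: qe l e')
qed

section \<open>Generation of the free Lie ring by left-normed products\<close>

lemma free_lie_induct [case_names gen zero neg add br]:
  assumes "\<And>v. P (free_gen v)" "P 0" "\<And>a. P a \<Longrightarrow> P (- a)"
    "\<And>a b. P a \<Longrightarrow> P b \<Longrightarrow> P (a + b)" "\<And>a b. P a \<Longrightarrow> P b \<Longrightarrow> P (lie a b)"
  shows "P a"
proof -
  have "P (abs_free_lie t)" for t
  proof (induction t)
    case (Gen v) then show ?case using assms(1)[of v] by (simp add: free_gen.abs_eq)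
  next
    case Zero then show ?case using assms(2) by (simp add: zero_free_lie_def)
  next
    case (Neg t) then show ?case using assms(3) by (simp flip: uminus_free_lie.abs_eq)
  next
    case (Add s t) then show ?case using assms(4) by (simp flip: plus_free_lie.abs_eq)
  next
    case (Br s t) then show ?case using assms(5) by (simp flip: lie_free_lie.abs_eq)
  qed
  then show ?thesis by (induction a rule: free_lie.abs_induct)
qed

abbreviation bracket :: "'v list \<Rightarrow> 'v free_lie" where "bracket \<equiv> left_normed free_gen"

lemma lie_hom_lin_left_normed: "lie_hom h \<Longrightarrow> h (lin (left_normed g) c) = lin (left_normed (\<lambda>v. h (g v))) c"
  by (simp add: additive_lin_comp[OF lie_hom_additive] lie_hom_left_normed)

text \<open>\<open>lower_central_free\<close> identifies this, for positive \<open>n\<close>, with the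
  \<open>n\<close>-th term of the lower central series; the description by words is the one
  that suits linear arguments.\<close>

definition lie_ge :: "nat \<Rightarrow> 'v free_lie set"
  where "lie_ge n = lin bracket ` {c. \<forall>w. lookup c w \<noteq> 0 \<longrightarrow> n \<le> length w}"

lemma add_closed_lie_ge: "add_closed (lie_ge n)"
  unfolding lie_ge_def by (rule add_closed_image[OF additive_lin add_closed_supported])

lemma bracket_in_lie_ge: "n \<le> length w \<Longrightarrow> bracket w \<in> lie_ge n"
  unfolding lie_ge_def by (rule image_eqI[where x = "frag_of w"]) (auto split: if_splits)

lemma lie_ge_mono: "m \<le> n \<Longrightarrow> lie_ge n \<subseteq> lie_ge m"
  unfolding lie_ge_def using le_trans by (intro image_mono) blast

lemma lie_ge_lie_gen: "f \<in> lie_ge n \<Longrightarrow> lie f (free_gen b) \<in> lie_ge (Suc n)"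
proof -
  assume "f \<in> lie_ge n"
  then obtain c where c: "f = lin bracket c" "\<And>w. lookup c w \<noteq> 0 \<Longrightarrow> n \<le> length w"
    unfolding lie_ge_def by blast
  have "lie (bracket w) (free_gen b) \<in> lie_ge (Suc n)" if "w \<in> keys c" for w
  proof (cases "w = []")
    case False
    then have "lie (bracket w) (free_gen b) = bracket (w @ [b])" by (simp add: left_normed_snoc)
    then show ?thesis using that c(2)[of w] by (auto intro: bracket_in_lie_ge simp: in_keys_iff)
  qed (simp add: add_closed_0[OF add_closed_lie_ge])
  then show ?thesis unfolding c(1) additive_lin_comp[OF additive_lie_left]
    by (rule add_closed_lin[OF add_closed_lie_ge])
qed

lemma lie_ge_lie: "f \<in> lie_ge n \<Longrightarrow> lie f g \<in> lie_ge (Suc n)"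
proof (induction g arbitrary: f n rule: free_lie_induct)
  case (br g h)
  have "lie (lie f g) h \<in> lie_ge (Suc (Suc n))" "lie (lie f h) g \<in> lie_ge (Suc (Suc n))"
    using br by blast+
  then have "lie f (lie g h) \<in> lie_ge (Suc (Suc n))"
    unfolding lie_lie_right by (rule add_closed_diff[OF add_closed_lie_ge])
  then show ?case using lie_ge_mono[of "Suc n" "Suc (Suc n)"] by auto
qed (simp_all add: lie_ge_lie_gen add_closed_0[OF add_closed_lie_ge]
    add_closed_minus[OF add_closed_lie_ge] add_closed_add[OF add_closed_lie_ge]
    lie_minus_right lie_add_right)

lemma lie_ge_1: "f \<in> lie_ge 1"
proof (induction f rule: free_lie_induct)
  case (gen v)
  then show ?case using bracket_in_lie_ge[of 1 "[v]"] by simp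
next
  case (br a b)
  then show ?case using lie_ge_lie[of a 1 b] lie_ge_mono[of 1 "Suc 1"] by auto
qed (simp_all add: add_closed_0[OF add_closed_lie_ge]
    add_closed_minus[OF add_closed_lie_ge] add_closed_add[OF add_closed_lie_ge])

lemma free_lie_span: obtains c where "f = lin bracket c"
  using lie_ge_1[of f] unfolding lie_ge_def by blast

section \<open>The Dynkin operator\<close>

lemma lie_products_snoc: "lie_products a (bs @ [b]) = lie (lie_products a bs) b"
  by (simp add: lie_products_def)

lemma lie_products_zero [simp]: "lie_products 0 bs = 0"
  unfolding lie_products_def by (induction bs) simp_all

lemma lie_products_Cons: "lie_products a (b # bs) = lie_products (lie a b) bs"
  by (simp add: lie_products_def)

lemma lie_products_replicate_Suc:
  "lie_products b (replicate (Suc k) a) = lie (lie_products b (replicate k a)) a"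
  by (simp add: lie_products_snoc flip: replicate_append_same)

text \<open>The associative ring acts on the free Lie ring from the right, with a letter acting by the
  bracket with it. By the Jacobi identity a Lie element acts by the bracket with itself.\<close>

lemma act_left_normed:
  "lin (\<lambda>v. lie_products f (map free_gen v)) (left_normed letter w) = lie f (bracket w)"
proof (induction w arbitrary: f rule: rev_induct)
  case (snoc b w)
  let ?act = "\<lambda>f v. lie_products f (map free_gen v)"
  show ?case
  proof (cases "w = []")
    case True
    then show ?thesis by (simp add: letter_def lie_products_def)
  next
    case False
    have "lin (?act f) (left_normed letter w * letter b) = lin (\<lambda>v. lie (?act f v) (free_gen b)) (left_normed letter w)"
      by (simp add: lin_mult_letter lie_products_snoc)
    also have "\<dots> = lie (lie f (bracket w)) (free_gen b)"
      by (simp add: snoc flip: additive_lin_comp[OF additive_lie_left])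
    finally have 1: "lin (?act f) (left_normed letter w * letter b) = lie (lie f (bracket w)) (free_gen b)" .
    have "lin (?act f) (letter b * left_normed letter w) = lin (?act (lie f (free_gen b))) (left_normed letter w)"
      by (simp add: lin_letter_mult lie_products_def)
    then have 2: "lin (?act f) (letter b * left_normed letter w) = lie (lie f (free_gen b)) (bracket w)"
      by (simp add: snoc)
    show ?thesis using False by (simp add: left_normed_snoc lie_poly_mapping_def lin_diff 1 2 lie_lie_right)
  qed
qed simp

text \<open>In \<open>w b - b w\<close> the first term is bracketed recursively and gives the factor
  \<open>length w\<close>; the second is the action of \<open>w\<close> on \<open>b\<close>,
  which gives the remaining summand.\<close>

lemma dynkin_left_normed: "lin bracket (left_normed letter w) = zmul (int (length w)) (bracket w)"
proof (induction w rule: rev_induct)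
  case (snoc b w)
  show ?case
  proof (cases "w = []")
    case True
    then show ?thesis by (simp add: letter_def)
  next
    case False
    have 1: "lin bracket (left_normed letter w * letter b) = zmul (int (length w)) (lie (bracket w) (free_gen b))"
      using False by (simp add: lin_left_normed_mult_letter[OF homog_left_normed] snoc additive_zmul[OF additive_lie_left])
    have 2: "lin bracket (letter b * left_normed letter w) = lie (free_gen b) (bracket w)"
      by (simp add: lin_letter_mult left_normed_Cons act_left_normed)
    have "zmul (1 + int (length w)) a = zmul (int (length w)) a + a" for a :: "'a free_lie"
      using zmul_Suc[of "int (length w)" a] by (simp add: add.commute)
    then show ?thesis using False
      by (simp add: left_normed_snoc lie_poly_mapping_def lin_diff 1 2 lie_anti[of "free_gen b" "bracket w"])
  qed
qed simp

definition iota :: "'v free_lie \<Rightarrow> 'v assoc" where "iota = free_lie_lift letter"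

lemma lie_hom_iota: "lie_hom iota" unfolding iota_def by (rule free_lie_lift_hom)
lemma iota_gen [simp]: "iota (free_gen v) = letter v" by (simp add: iota_def free_lie_lift_gen)
lemma iota_lin: "iota (lin bracket c) = lin (left_normed letter) c"
  by (simp add: lie_hom_lin_left_normed[OF lie_hom_iota])
lemma additive_iota: "additive iota" by (rule lie_hom_additive[OF lie_hom_iota])

text \<open>This holds in the free Lie ring itself, so an element of degree \<open>n\<close> that
  vanishes in the associative ring is annihilated by \<open>n\<close>.\<close>

lemma dynkin: "homog n c \<Longrightarrow> lin bracket (iota (lin bracket c)) = zmul (int n) (lin bracket c)"
proof -
  assume c: "homog n c"
  have "lin bracket (iota (lin bracket c)) = lin (\<lambda>w. lin bracket (left_normed letter w)) c"
    by (simp add: iota_lin additive_lin_comp[OF additive_lin])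
  also have "\<dots> = lin (\<lambda>w. zmul (int n) (bracket w)) c"
    by (rule lin_cong) (simp add: dynkin_left_normed homog_keys[OF c])
  also have "\<dots> = zmul (int n) (lin bracket c)"
    by (simp add: additive_lin_comp[OF additive_zmul_right])
  finally show ?thesis .
qed

section \<open>Derivations and the holomorph\<close>

definition derivation :: "('a::lie_ring \<Rightarrow> 'a) \<Rightarrow> bool"
  where "derivation d \<longleftrightarrow> additive d \<and> (\<forall>a b. d (lie a b) = lie (d a) b + lie a (d b))"

lemma derivation_additive: "derivation d \<Longrightarrow> additive d" by (simp add: derivation_def)
lemma derivation_lie: "derivation d \<Longrightarrow> d (lie a b) = lie (d a) b + lie a (d b)"
  by (simp add: derivation_def)

text \<open>Both sides are derivations along \<open>h\<close>, so it suffices to compare them on the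
  generators.\<close>

lemma hom_derivation:
  assumes h: "lie_hom h" and d: "derivation d"
    and gen: "\<And>v. lie (h (free_gen v)) b = h (d (free_gen v))"
  shows "lie (h f) b = h (d f)"
proof (induction f rule: free_lie_induct)
  case (br f g)
  then show ?case using lie_leibniz[of "h f" "h g" b]
    by (simp add: derivation_lie[OF d] lie_hom_lie[OF h] additive.add[OF lie_hom_additive[OF h]])
qed (simp_all add: gen additive.zero[OF derivation_additive[OF d]] additive.minus[OF derivation_additive[OF d]]
    additive.add[OF derivation_additive[OF d]] lie_add_left lie_minus_left
    additive.add[OF lie_hom_additive[OF h]] additive.zero[OF lie_hom_additive[OF h]]
    additive.minus[OF lie_hom_additive[OF h]])

text \<open>Dual numbers over a Lie ring. A homomorphism into them that is the identity in the first
  component is a derivation in the second, which turns the universal property of free Lie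
  rings into one for derivations.\<close>

datatype 'a tangent = Tangent (tbase: 'a) (tvec: 'a)

instantiation tangent :: (lie_ring) lie_ring
begin
definition "0 = Tangent 0 0"
definition "a + b = Tangent (tbase a + tbase b) (tvec a + tvec b)"
definition "a - b = Tangent (tbase a - tbase b) (tvec a - tvec b)"
definition "- a = Tangent (- tbase a) (- tvec a)"
definition "lie a b = Tangent (lie (tbase a) (tbase b)) (lie (tvec a) (tbase b) + lie (tbase a) (tvec b))"

instance
proof
  fix a b c :: "'a tangent"
  show "lie a a = 0"
    by (simp add: lie_tangent_def zero_tangent_def lie_self lie_anti[of "tvec a" "tbase a"])
  have J: "lie (lie a b) c = - lie (lie b c) a - lie (lie c a) b" for a b c :: 'a
    using lie_jacobi[of a b c] by (simp add: algebra_simps eq_neg_iff_add_eq_0)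
  show "lie (lie a b) c + lie (lie b c) a + lie (lie c a) b = 0"
    by (simp add: lie_tangent_def zero_tangent_def plus_tangent_def lie_add_left
        J[of "tbase a" "tbase b" "tbase c"] J[of "tvec a" "tbase b" "tbase c"]
        J[of "tbase a" "tvec b" "tbase c"] J[of "tbase a" "tbase b" "tvec c"])
qed (simp_all add: lie_tangent_def zero_tangent_def plus_tangent_def minus_tangent_def
    uminus_tangent_def lie_add_left lie_add_right algebra_simps)
end

lemma derivation_extends:
  obtains d :: "'v free_lie \<Rightarrow> 'v free_lie" where "derivation d" "\<And>v. d (free_gen v) = g v"
proof -
  let ?h = "free_lie_lift (\<lambda>v. Tangent (free_gen v) (g v))"
  have h: "lie_hom ?h" by (rule free_lie_lift_hom)
  have "lie_hom (\<lambda>a. tbase (?h a))"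
    using h by (auto simp: lie_hom_def plus_tangent_def lie_tangent_def)
  then have "(\<lambda>a. tbase (?h a)) = free_lie_lift free_gen"
    by (rule lie_hom_free_unique) (simp add: free_lie_lift_gen)
  moreover have "(\<lambda>a. a) = free_lie_lift free_gen"
    by (rule lie_hom_free_unique) (simp_all add: lie_hom_def)
  ultimately have base: "tbase (?h a) = a" for a by metis
  show ?thesis
  proof (rule that)
    show "derivation (\<lambda>a. tvec (?h a))"
      using h by (auto simp: derivation_def additive_def lie_hom_def plus_tangent_def lie_tangent_def base)
  qed (simp add: free_lie_lift_gen)
qed

text \<open>The semidirect product of a Lie ring with the ring of its derivations, which act from the
  right.\<close>

typedef (overloaded) 'a holo = "{df :: ('a::lie_ring \<Rightarrow> 'a) \<times> 'a. derivation (fst df)}"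
  by (rule exI[of _ "(\<lambda>a. 0, 0)"]) (simp add: derivation_def additive_def)

setup_lifting type_definition_holo

instantiation holo :: (lie_ring) lie_ring
begin

lift_definition zero_holo :: "'a holo" is "(\<lambda>a. 0, 0)"
  by (simp add: derivation_def additive_def)

lift_definition plus_holo :: "'a holo \<Rightarrow> 'a holo \<Rightarrow> 'a holo"
  is "\<lambda>(d, f) (e, g). (\<lambda>a. d a + e a, f + g)"
  by (auto simp: derivation_def additive_def lie_add_left lie_add_right algebra_simps)

lift_definition minus_holo :: "'a holo \<Rightarrow> 'a holo \<Rightarrow> 'a holo"
  is "\<lambda>(d, f) (e, g). (\<lambda>a. d a - e a, f - g)"
  by (auto simp: derivation_def additive_def lie_diff_left lie_diff_right algebra_simps)

lift_definition uminus_holo :: "'a holo \<Rightarrow> 'a holo"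
  is "\<lambda>(d, f). (\<lambda>a. - d a, - f)"
  by (auto simp: derivation_def additive_def lie_minus_left lie_minus_right algebra_simps)

lift_definition lie_holo :: "'a holo \<Rightarrow> 'a holo \<Rightarrow> 'a holo"
  is "\<lambda>(d, f) (e, g). (\<lambda>a. e (d a) - d (e a), lie f g + e f - d g)"
  by (auto simp: derivation_def additive_def lie_diff_left lie_diff_right algebra_simps)

instance
proof
  fix a b c :: "'a holo"
  show "a + b + c = a + (b + c)" by transfer (auto simp: algebra_simps)
  show "a + b = b + a" by transfer (auto simp: algebra_simps)
  show "0 + a = a" by transfer auto
  show "- a + a = 0" by transfer auto
  show "a - b = a + - b" by transfer auto
  show "lie (a + b) c = lie a c + lie b c"
    by transfer (auto simp: derivation_def additive_def lie_add_left algebra_simps)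
  show "lie a (b + c) = lie a b + lie a c"
    by transfer (auto simp: derivation_def additive_def lie_add_right algebra_simps)
  show "lie a a = 0" by transfer (auto simp: lie_self)
  show "lie (lie a b) c + lie (lie b c) a + lie (lie c a) b = 0"
  proof (transfer, goal_cases)
    case (1 a b c)
    obtain d f e g k h where eq: "a = (d, f)" "b = (e, g)" "c = (k, h)" by (metis surj_pair)
    have der: "derivation d" "derivation e" "derivation k" using 1 eq by simp_all
    note ad = der[THEN derivation_additive]
    note [simp] = ad[THEN additive.diff] ad[THEN additive.add] der[THEN derivation_lie]
    have "lie (lie f g) h = - lie (lie g h) f - lie (lie h f) g"
      using lie_jacobi[of f g h] by (simp add: algebra_simps eq_neg_iff_add_eq_0)
    then show ?case unfolding eq
      by (simp add: lie_add_left lie_diff_left lie_anti[of "e f" h] lie_anti[of f "k g"]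
          lie_anti[of g "d h"])
  qed
qed
end


lift_definition hder :: "('a::lie_ring \<Rightarrow> 'a) \<Rightarrow> 'a holo"
  is "\<lambda>d. if derivation d then (d, 0) else (\<lambda>a. 0, 0)"
  by (simp add: derivation_def additive_def)

lift_definition hemb :: "'a::lie_ring \<Rightarrow> 'a holo" is "\<lambda>f. (\<lambda>a. 0, f)"
  by (simp add: derivation_def additive_def)

lemma inj_hemb: "hemb f = hemb g \<Longrightarrow> f = g" by transfer simp

lemma lie_hom_hemb: "lie_hom hemb"
  unfolding lie_hom_def by (intro conjI allI; transfer) simp_all

lemma lie_hemb_hder: "derivation d \<Longrightarrow> lie (hemb f) (hder d) = hemb (d f)"
  by transfer (auto dest!: derivation_additive[THEN additive.zero])

section \<open>Elimination of a generator\<close>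

text \<open>Lazard elimination: the ideal generated by all generators other than \<open>a\<close> is
  free on the elements \<open>[b, a, \<dots>, a]\<close>. The letter \<open>(b, k)\<close>
  stands for the one with \<open>k\<close> factors \<open>a\<close>. For \<open>b = a\<close>
  these elements are redundant, and \<open>elim_span\<close> excludes them.\<close>

definition elim_map :: "'v \<Rightarrow> ('v \<times> nat) free_lie \<Rightarrow> 'v free_lie"
  where "elim_map a = free_lie_lift
    (\<lambda>(b, k). lie_products (free_gen b) (replicate k (free_gen a)))"

lemma lie_hom_elim_map: "lie_hom (elim_map a)"
  unfolding elim_map_def by (rule free_lie_lift_hom)

definition elim_span :: "'v \<Rightarrow> nat \<Rightarrow> ('v \<times> nat) free_lie set"
  where "elim_span a n = lin bracket `
    {c. \<forall>w. lookup c w \<noteq> 0 \<longrightarrow> length w = n \<and> a \<notin> fst ` set w}"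

lemma add_closed_elim_span: "add_closed (elim_span a n)"
  unfolding elim_span_def by (rule add_closed_image[OF additive_lin add_closed_supported])

lemma bracket_in_elim_span: "length w = n \<Longrightarrow> a \<notin> fst ` set w \<Longrightarrow> bracket w \<in> elim_span a n"
  unfolding elim_span_def by (rule image_eqI[where x = "frag_of w"]) (auto split: if_splits)

lemma elim_span_additive:
  assumes "additive h" "add_closed A" "f \<in> elim_span a n"
    and "\<And>w. length w = n \<Longrightarrow> a \<notin> fst ` set w \<Longrightarrow> h (bracket w) \<in> A"
  shows "h f \<in> A"
proof -
  obtain c where c: "f = lin bracket c" "\<And>w. lookup c w \<noteq> 0 \<Longrightarrow> length w = n \<and> a \<notin> fst ` set w"
    using assms(3) unfolding elim_span_def by blast
  have "h (bracket w) \<in> A" if "w \<in> keys c" for w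
    using that c(2)[of w] assms(4)[of w] by (simp add: in_keys_iff)
  then show ?thesis unfolding c(1) additive_lin_comp[OF assms(1)]
    by (rule add_closed_lin[OF assms(2)])
qed

lemma elim_span_lie_gen:
  assumes "f \<in> elim_span a n" "fst x \<noteq> a"
  shows "lie f (free_gen x) \<in> elim_span a (Suc n)"
proof (rule elim_span_additive[OF additive_lie_left add_closed_elim_span assms(1)])
  fix w :: "('a \<times> nat) list" assume w: "length w = n" "a \<notin> fst ` set w"
  show "lie (bracket w) (free_gen x) \<in> elim_span a (Suc n)"
  proof (cases "w = []")
    case False
    then have "lie (bracket w) (free_gen x) = bracket (w @ [x])" by (simp add: left_normed_snoc)
    then show ?thesis using w assms(2) bracket_in_elim_span[of "w @ [x]" "Suc n" a] by simp
  qed (simp add: add_closed_0[OF add_closed_elim_span])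
qed

context
  fixes a :: 'v and d :: "('v \<times> nat) free_lie \<Rightarrow> ('v \<times> nat) free_lie"
  assumes d: "derivation d" and d_gen: "\<And>b k. d (free_gen (b, k)) = free_gen (b, Suc k)"
begin

lemma elim_map_derivation: "elim_map a (d f) = lie (elim_map a f) (free_gen a)"
  by (rule hom_derivation[OF lie_hom_elim_map d, symmetric])
    (simp add: d_gen elim_map_def free_lie_lift_gen lie_products_replicate_Suc
      split: prod.split del: replicate_Suc)

lemma elim_span_derivation_bracket: "a \<notin> fst ` set w \<Longrightarrow> d (bracket w) \<in> elim_span a (length w)"
proof (induction w rule: rev_induct)
  case (snoc x w)
  have x: "d (free_gen x) = free_gen (fst x, Suc (snd x))" "fst x \<noteq> a"
    using snoc.prems d_gen[of "fst x" "snd x"] by auto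
  show ?case
  proof (cases "w = []")
    case True
    then show ?thesis using bracket_in_elim_span[of "[(fst x, Suc (snd x))]" 1 a] x by simp
  next
    case False
    have "lie (d (bracket w)) (free_gen x) \<in> elim_span a (Suc (length w))"
      using snoc x(2) by (intro elim_span_lie_gen) auto
    moreover have "lie (bracket w) (d (free_gen x)) \<in> elim_span a (Suc (length w))"
      unfolding x(1) using snoc.prems x(2) by (intro elim_span_lie_gen bracket_in_elim_span) auto
    ultimately have "lie (d (bracket w)) (free_gen x) + lie (bracket w) (d (free_gen x)) \<in> elim_span a (Suc (length w))"
      by (rule add_closed_add[OF add_closed_elim_span])
    then show ?thesis using False by (simp add: left_normed_snoc derivation_lie[OF d])
  qed
qed (simp add: add_closed_0[OF add_closed_elim_span] additive.zero[OF derivation_additive[OF d]])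

lemma elim_span_derivation: "f \<in> elim_span a n \<Longrightarrow> d f \<in> elim_span a n"
  by (rule elim_span_additive[OF derivation_additive[OF d] add_closed_elim_span])
    (use elim_span_derivation_bracket in auto)

text \<open>The free Lie ring maps to the holomorph of the free Lie ring on pairs, with \<open>a\<close>
  going to the derivation \<open>d\<close> and \<open>b\<close> to the letter \<open>(b,
  0)\<close>. This map undoes \<open>elim_map a\<close> on all words without letters
  \<open>(a, k)\<close>.\<close>

lemma elim_map_inj_aux:
  assumes "f \<in> elim_span a n" "elim_map a f = 0"
  shows "f = 0"
proof -
  define H where "H = free_lie_lift (\<lambda>b. if b = a then hder d else hemb (free_gen (b, 0::nat)))"
  have H: "lie_hom H" unfolding H_def by (rule free_lie_lift_hom)
  have Ha: "H (free_gen a) = hder d" by (simp add: H_def free_lie_lift_gen)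
  have gen: "H (elim_map a (free_gen (b, k))) = hemb (free_gen (b, k))" if "b \<noteq> a" for b k
  proof (induction k)
    case 0
    then show ?case using that
      by (simp add: elim_map_def H_def free_lie_lift_gen lie_products_def)
  next
    case (Suc k)
    have "elim_map a (free_gen (b, Suc k)) = lie (elim_map a (free_gen (b, k))) (free_gen a)"
      by (simp add: elim_map_derivation flip: d_gen)
    then show ?case by (simp add: lie_hom_lie[OF H] Ha Suc lie_hemb_hder[OF d] d_gen)
  qed
  have "H (elim_map a f) - hemb f \<in> {0}"
  proof (rule elim_span_additive[OF _ _ assms(1), where h = "\<lambda>f. H (elim_map a f) - hemb f"])
    show "additive (\<lambda>f. H (elim_map a f) - hemb f)"
      by (intro additive_diff_fun lie_hom_additive[OF lie_hom_comp[OF H lie_hom_elim_map]]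
          lie_hom_additive[OF lie_hom_hemb])
    show "add_closed {0::('v \<times> nat) free_lie holo}" by (simp add: add_closed_def)
    fix w :: "('v \<times> nat) list" assume "a \<notin> fst ` set w"
    then have "left_normed (\<lambda>v. H (elim_map a (free_gen v))) w = left_normed (\<lambda>v. hemb (free_gen v)) w"
      by (intro left_normed_cong) (metis gen image_eqI prod.collapse)
    then show "H (elim_map a (bracket w)) - hemb (bracket w) \<in> {0}"
      by (simp add: lie_hom_left_normed[OF lie_hom_comp[OF H lie_hom_elim_map]] lie_hom_left_normed[OF lie_hom_hemb])
  qed
  then have "hemb f = hemb 0"
    by (simp add: assms(2) lie_hom_zero[OF H] lie_hom_zero[OF lie_hom_hemb])
  then show ?thesis by (rule inj_hemb)
qed

text \<open>Once a letter other than \<open>a\<close> has occurred, a bracket with \<open>a\<close> is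
  the derivation \<open>d\<close> on the side of pairs and a bracket with \<open>b\<close> is
  one with \<open>(b, 0)\<close>. A word may begin with letters \<open>a\<close>; if there are
  two of them its product is zero, and if there is one the sign of its first bracket changes.\<close>

lemma elim_map_surj_aux:
  assumes "\<not> set w \<subseteq> {a}"
  shows "bracket w \<in> elim_map a ` elim_span a (length (filter (\<lambda>b. b \<noteq> a) w))"
  using assms
proof (induction w rule: rev_induct)
  case (snoc b w)
  have gen: "elim_map a (free_gen (b, 0)) = free_gen b"
    by (simp add: elim_map_def free_lie_lift_gen lie_products_def)
  show ?case
  proof (cases "set w \<subseteq> {a}")
    case False
    then have "w \<noteq> []" by auto
    obtain f where f: "bracket w = elim_map a f" "f \<in> elim_span a (length (filter (\<lambda>b. b \<noteq> a) w))"
      using snoc.IH[OF False] by blast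
    show ?thesis
    proof (cases "b = a")
      case True
      have "bracket (w @ [b]) = elim_map a (d f)"
        using \<open>w \<noteq> []\<close> f True by (simp add: left_normed_snoc elim_map_derivation)
      then show ?thesis using elim_span_derivation[OF f(2)] True by simp
    next
      case b: False
      have "bracket (w @ [b]) = elim_map a (lie f (free_gen (b, 0)))"
        using \<open>w \<noteq> []\<close> f gen by (simp add: left_normed_snoc lie_hom_lie[OF lie_hom_elim_map])
      then show ?thesis using elim_span_lie_gen[OF f(2), of "(b, 0)"] b by simp
    qed
  next
    case True
    then have b: "b \<noteq> a" using snoc.prems by auto
    have w: "w = replicate (length w) a" using True by (intro replicate_eqI) auto
    have filter: "filter (\<lambda>b. b \<noteq> a) w = []" using True by (auto simp: filter_empty_conv)
    have "bracket (w @ [b]) \<in> elim_map a ` elim_span a 1"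
    proof (cases "length w")
      case 0
      then show ?thesis using gen b bracket_in_elim_span[of "[(b, 0)]" 1 a]
        by (intro image_eqI[where x = "free_gen (b, 0)"]) simp_all
    next
      case (Suc n)
      show ?thesis
      proof (cases n)
        case 0
        have "elim_map a (free_gen (b, Suc 0)) = lie (free_gen b) (free_gen a)"
          by (simp add: elim_map_derivation gen flip: d_gen)
        moreover have "w = [a]" using w Suc 0 by simp
        ultimately have "bracket (w @ [b]) = elim_map a (- free_gen (b, 1))"
          using left_normed_snoc[of "[a]" free_gen b] lie_anti[of "free_gen a" "free_gen b"]
          by (simp add: lie_hom_minus[OF lie_hom_elim_map])
        then show ?thesis using b bracket_in_elim_span[of "[(b, 1)]" 1 a]
          by (intro image_eqI[where x = "- free_gen (b, 1)"])
            (auto intro: add_closed_minus[OF add_closed_elim_span])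
      next
        case (Suc m)
        have "w = [a] @ [a] @ replicate m a" using w \<open>length w = Suc n\<close> Suc by simp
        then have "bracket (w @ [b]) = 0"
          by (simp add: left_normed_Cons lie_products_Cons lie_self)
        then show ?thesis
          using lie_hom_zero[OF lie_hom_elim_map] add_closed_0[OF add_closed_elim_span] by force
      qed
    qed
    then show ?thesis using b filter by simp
  qed
qed simp

end

lemma elim_map_inj: "f \<in> elim_span a n \<Longrightarrow> elim_map a f = 0 \<Longrightarrow> f = 0"
  by (rule derivation_extends[of "\<lambda>(b, k). free_gen (b, Suc k)"]) (auto intro: elim_map_inj_aux)

lemma elim_map_surj:
  "\<not> set w \<subseteq> {a} \<Longrightarrow> bracket w \<in> elim_map a ` elim_span a (length (filter (\<lambda>b. b \<noteq> a) w))"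
  by (rule derivation_extends[of "\<lambda>(b, k). free_gen (b, Suc k)"]) (auto intro: elim_map_surj_aux)

section \<open>Torsion-freeness of free Lie rings\<close>

lemma left_normed_letter_restr_content:
  "restr (\<lambda>z. mset z = \<kappa>) (left_normed letter w) = (if mset w = \<kappa> then left_normed letter w else 0)"
proof (rule poly_mapping_eqI)
  fix z
  show "lookup (restr (\<lambda>z. mset z = \<kappa>) (left_normed letter w)) z = lookup (if mset w = \<kappa> then left_normed letter w else 0) z"
    by (cases "lookup (left_normed letter w) z = 0") (auto simp: lookup_restr dest: content_left_normed)
qed

lemma iota_content:
  assumes "iota (lin bracket c) = 0"
  shows "iota (lin bracket (restr (\<lambda>w. mset w = \<kappa>) c)) = 0"
proof -
  have "restr (\<lambda>w. mset w = \<kappa>) (lin (left_normed letter) c) = lin (\<lambda>w. if mset w = \<kappa> then left_normed letter w else 0) c"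
    by (simp add: additive_lin_comp[OF additive_restr] left_normed_letter_restr_content)
  then have "lin (left_normed letter) (restr (\<lambda>w. mset w = \<kappa>) c) = restr (\<lambda>w. mset w = \<kappa>) (iota (lin bracket c))"
    by (simp only: lin_restr iota_lin)
  also have "\<dots> = 0" by (simp only: assms additive.zero[OF additive_restr])
  finally show ?thesis by (simp only: iota_lin)
qed

lemma zero_if_content_zero:
  assumes "iota (lin bracket c) = 0"
    and "\<And>\<kappa> c'. \<kappa> \<in> mset ` keys c \<Longrightarrow> (\<And>w. lookup c' w \<noteq> 0 \<Longrightarrow> mset w = \<kappa>) \<Longrightarrow>
      iota (lin bracket c') = 0 \<Longrightarrow> lin bracket c' = 0"
  shows "lin bracket c = 0"
proof -
  have "lin bracket (restr (\<lambda>w. mset w = \<kappa>) c) = 0" if "\<kappa> \<in> mset ` keys c" for \<kappa>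
    by (rule assms(2)[OF that]) (auto simp: lookup_restr iota_content[OF assms(1)] split: if_splits)
  then have "lin bracket (\<Sum>\<kappa>\<in>mset ` keys c. restr (\<lambda>w. mset w = \<kappa>) c) = 0"
    by (simp add: additive.sum[OF additive_lin])
  then show ?thesis by (simp add: sum_restr_content)
qed

definition relabel :: "('v \<Rightarrow> 'w) \<Rightarrow> 'v free_lie \<Rightarrow> 'w free_lie"
  where "relabel e = free_lie_lift (\<lambda>v. free_gen (e v))"

lemma lie_hom_relabel: "lie_hom (relabel e)" unfolding relabel_def by (rule free_lie_lift_hom)

lemma relabel_gen [simp]: "relabel e (free_gen v) = free_gen (e v)"
  by (simp add: relabel_def free_lie_lift_gen)

lemma relabel_inj:
  assumes "inj e" "relabel e f = 0"
  shows "f = 0"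
proof -
  let ?i = "relabel (the_inv e)"
  have "lie_hom (\<lambda>f. ?i (relabel e f))" by (rule lie_hom_comp[OF lie_hom_relabel lie_hom_relabel])
  then have "(\<lambda>f. ?i (relabel e f)) = free_lie_lift free_gen"
    by (rule lie_hom_free_unique) (simp add: the_inv_f_f[OF assms(1)])
  moreover have "(\<lambda>f. f) = free_lie_lift free_gen"
    by (rule lie_hom_free_unique) (simp_all add: lie_hom_def)
  ultimately have "?i (relabel e f) = f" by metis
  then show ?thesis using assms(2) lie_hom_zero[OF lie_hom_relabel[of "the_inv e"]] by simp
qed

lemma relabel_bracket: "relabel e (bracket w) = bracket (map e w)"
  by (simp add: lie_hom_left_normed[OF lie_hom_relabel] left_normed_map)

lemma iota_zero_if_zmul: "iota (zmul k f) = 0 \<Longrightarrow> k \<noteq> 0 \<Longrightarrow> iota f = 0"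
  by (simp add: additive_zmul[OF additive_iota] zmul_frag_eq_0)

text \<open>Induction on the number of letters. By the Dynkin operator an element that vanishes in the
  associative ring is a torsion element. If its content is not a power of a single letter,
  eliminating one of its letters writes it as the image of an element \<open>g\<close> in
  fewer letters; \<open>g\<close> is a torsion element too, so it vanishes in the associative
  ring, which is torsion-free, and the induction hypothesis applies to it.

  The letters are natural numbers so that the pairs produced by the elimination can be
  numbered again and the induction stays within one type.\<close>

lemma iota_inj_content:
  fixes c :: "nat assoc"
  assumes "\<And>w. lookup c w \<noteq> 0 \<Longrightarrow> mset w = \<kappa>" "iota (lin bracket c) = 0"
  shows "lin bracket c = 0"
  using assms
proof (induction "size \<kappa>" arbitrary: \<kappa> c rule: less_induct)
  case less
  let ?n = "size \<kappa>"
  have supp: "mset w = \<kappa>" if "w \<in> keys c" for w using less.prems(1)[of w] that by (simp add: in_keys_iff)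
  show ?case
  proof (cases "\<kappa> = {#}")
    case True
    then have "w = []" if "w \<in> keys c" for w using supp[OF that] by simp
    then have "lin bracket c = lin (\<lambda>w. 0) c" by (metis lin_cong left_normed_Nil)
    then show ?thesis by (simp add: lin_def)
  next
    case False
    then have n: "0 < ?n" by (simp add: nonempty_has_size)
    show ?thesis
    proof (rule content_cases[OF refl n])
      fix a assume "\<kappa> = replicate_mset ?n a"
      then have w: "w = replicate ?n a" if "w \<in> keys c" for w
        using supp[OF that] by (simp add: mset_eq_replicate_mset[symmetric])
      show ?thesis
      proof (cases "?n = 1")
        case True
        have "c = zmul (lookup c [a]) (frag_of [a])"
          by (rule poly_mapping_eqI) (use w True in \<open>force simp: in_keys_iff\<close>)
        moreover from this have "lookup (iota (lin bracket c)) [a] = lookup c [a]"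
          by (metis iota_lin lin_frag_of lin_zmul left_normed_single letter_def)
        ultimately show ?thesis using less.prems(2) by (metis lin_zero lookup_zero zmul_0)
      next
        case ne: False
        have "bracket w = 0" if "w \<in> keys c" for w
        proof -
          obtain k where "?n = Suc (Suc k)" using n ne by (metis One_nat_def Suc_pred neq0_conv)
          with w[OF that] have "w = a # a # replicate k a" by simp
          then show ?thesis by (simp add: left_normed_Cons lie_products_Cons lie_self)
        qed
        then show ?thesis by (simp add: lin_def)
      qed
    next
      fix a assume a: "0 < count \<kappa> a" "count \<kappa> a < ?n"
      define j where "j = ?n - count \<kappa> a"
      have "bracket w \<in> elim_map a ` elim_span a j" if "w \<in> keys c" for w
      proof -
        have w: "mset w = \<kappa>" by (rule supp[OF that])
        have "\<not> set w \<subseteq> {a}"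
        proof
          assume "set w \<subseteq> {a}"
          then have "w = replicate ?n a" using w by (intro replicate_eqI) auto
          then show False using w a by (metis count_replicate_mset less_irrefl mset_replicate)
        qed
        moreover have filter_eq: "filter ((=) a) w = filter (\<lambda>b. b = a) w"
          by (rule filter_cong) auto
        then have "length (filter (\<lambda>b. b \<noteq> a) w) = j"
          using sum_length_filter_compl[of "\<lambda>b. b = a" w] w
          by (auto simp: j_def count_mset count_list_eq_length_filter filter_eq)
        ultimately show ?thesis using elim_map_surj[of w a] by simp
      qed
      then have "lin bracket c \<in> elim_map a ` elim_span a j"
        by (intro add_closed_lin add_closed_image[OF lie_hom_additive[OF lie_hom_elim_map] add_closed_elim_span])
      then obtain g where g: "lin bracket c = elim_map a g" "g \<in> elim_span a j" by blast
      have "homog ?n c" unfolding homog_def using less.prems(1) by (metis size_mset)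
      from dynkin[OF this] less.prems(2) have "zmul (int ?n) (lin bracket c) = 0" by simp
      then have "elim_map a (zmul (int ?n) g) = 0"
        by (simp add: g additive_zmul[OF lie_hom_additive[OF lie_hom_elim_map]])
      then have 0: "zmul (int ?n) g = 0"
        by (rule elim_map_inj[OF add_closed_zmul[OF add_closed_elim_span g(2)]])
      obtain e where e: "g = lin bracket e" "\<And>w. lookup e w \<noteq> 0 \<Longrightarrow> length w = j"
        using g(2) unfolding elim_span_def by blast
      define e' where "e' = lin (\<lambda>w. frag_of (map prod_encode w)) e"
      have e': "relabel prod_encode g = lin bracket e'"
        by (simp add: e e'_def additive_lin_comp[OF additive_lin] relabel_bracket
            additive_lin_comp[OF lie_hom_additive[OF lie_hom_relabel]])
      have "homog j e'" unfolding e'_def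
        by (rule homog_lin) (use e(2) in \<open>auto simp: in_keys_iff homog_frag_of\<close>)
      have "iota (zmul (int ?n) (lin bracket e')) = 0"
        by (simp flip: e' add: 0 lie_hom_zero[OF lie_hom_relabel] lie_hom_zero[OF lie_hom_iota]
            additive_zmul[OF lie_hom_additive[OF lie_hom_relabel], symmetric])
      then have "iota (lin bracket e') = 0" by (rule iota_zero_if_zmul) (use False in simp)
      then have "lin bracket e' = 0"
      proof (rule zero_if_content_zero)
        fix \<kappa>' c' assume "\<kappa>' \<in> mset ` keys e'" and c': "\<And>w. lookup c' w \<noteq> 0 \<Longrightarrow> mset w = \<kappa>'" "iota (lin bracket c') = 0"
        then have "size \<kappa>' = j" using homog_keys[OF \<open>homog j e'\<close>] by auto
        then have "size \<kappa>' < ?n" using a by (simp add: j_def)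
        then show "lin bracket c' = 0" using less.hyps c' by blast
      qed
      then have "g = 0" using relabel_inj[OF inj_prod_encode] e' by metis
      then show ?thesis by (simp add: g lie_hom_zero[OF lie_hom_elim_map])
    qed
  qed
qed

lemma free_lie_torsion_free:
  fixes f :: "'v::countable free_lie"
  assumes "zmul k f = 0" "k \<noteq> 0"
  shows "f = 0"
proof -
  let ?f = "relabel to_nat f"
  obtain c where c: "?f = lin bracket c" by (rule free_lie_span)
  have "zmul k ?f = relabel to_nat (zmul k f)"
    by (rule additive_zmul[OF lie_hom_additive[OF lie_hom_relabel], symmetric])
  then have "iota (zmul k ?f) = 0"
    by (simp add: assms lie_hom_zero[OF lie_hom_relabel] lie_hom_zero[OF lie_hom_iota])
  then have "iota ?f = 0" by (rule iota_zero_if_zmul[OF _ assms(2)])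
  then have "lin bracket c = 0" unfolding c
    by (rule zero_if_content_zero) (rule iota_inj_content)
  then show ?thesis using c relabel_inj[OF inj_to_nat] by metis
qed

lemma iota_inj_homog:
  fixes c :: "'v::countable assoc"
  assumes "homog n c" "0 < n" "iota (lin bracket c) = 0"
  shows "lin bracket c = 0"
proof (rule free_lie_torsion_free)
  show "zmul (int n) (lin bracket c) = 0" using dynkin[OF assms(1)] by (simp only: assms(3) lin_zero)
  show "int n \<noteq> 0" using assms(2) by simp
qed

section \<open>The derived ideal of the free Lie ring of rank two\<close>

text \<open>The homomorphism from the free Lie ring on pairs to \<open>L\<close> that will turn out to
  be an isomorphism onto the derived ideal.\<close>

definition u_map :: "'a::lie_ring \<Rightarrow> 'a \<Rightarrow> (nat \<times> nat) free_lie \<Rightarrow> 'a"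
  where "u_map x y = free_lie_lift (\<lambda>(s, t). u_elem x y s t)"

lemma lie_hom_u_map: "lie_hom (u_map x y)" unfolding u_map_def by (rule free_lie_lift_hom)
lemma u_map_gen: "u_map x y (free_gen (s, t)) = u_elem x y s t"
  by (simp add: u_map_def free_lie_lift_gen)
lemma additive_u_map: "additive (u_map x y)" by (rule lie_hom_additive[OF lie_hom_u_map])

lemma u_elem_0_0: "u_elem x y 0 0 = lie y x" by (simp add: u_elem_def lie_products_def)

lemma u_elem_Suc_right: "u_elem x y s (Suc t) = lie (u_elem x y s t) y"
  unfolding u_elem_def
  by (simp only: replicate_append_same[symmetric] replicate_Suc append_assoc[symmetric] lie_products_snoc)

lemma u_elem_Suc_left: "u_elem x y (Suc s) 0 = lie (u_elem x y s 0) x"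
  unfolding u_elem_def
  by (simp only: replicate_0 append_Nil2 replicate_Suc replicate_append_same[symmetric]
      append_assoc[symmetric] lie_products_snoc)

text \<open>Two eliminations: \<open>H1\<close> undoes the elimination of \<open>x\<close>, after which
  the letter \<open>k\<close> stands for \<open>[y, x, \<dots>, x]\<close> with
  \<open>k\<close> factors \<open>x\<close>, and \<open>H2\<close> undoes the elimination of
  the letter \<open>0\<close>, that is of \<open>y\<close>.\<close>

lemma u_map_free_inj:
  assumes "u_map (free_gen True) (free_gen False) f = 0"
  shows "f = 0"
proof -
  let ?x = "free_gen True :: bool free_lie" and ?y = "free_gen False :: bool free_lie"
  obtain d1 :: "nat free_lie \<Rightarrow> nat free_lie" where
    d1: "derivation d1" "\<And>k. d1 (free_gen k) = free_gen (Suc k)"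
    by (rule derivation_extends[of "\<lambda>k. free_gen (Suc k)"]) (rule that)
  obtain d2 :: "(nat \<times> nat) free_lie \<Rightarrow> (nat \<times> nat) free_lie" where
    d2: "derivation d2" "\<And>v. d2 (free_gen v) = (case v of (s, t) \<Rightarrow> free_gen (s, Suc t))"
    by (rule derivation_extends[of "\<lambda>v. case v of (s, t) \<Rightarrow> free_gen (s, Suc t)"]) (rule that)
  define H1 where "H1 = free_lie_lift (\<lambda>b. if b then hder d1 else hemb (free_gen 0))"
  define H2 where "H2 = free_lie_lift (\<lambda>k. case k of 0 \<Rightarrow> hder d2 | Suc s \<Rightarrow> hemb (free_gen (s, 0)))"
  define v :: "nat \<Rightarrow> nat \<Rightarrow> nat free_lie"
    where "v s t = lie_products (free_gen (Suc s)) (replicate t (free_gen 0))" for s t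
  have H1: "lie_hom H1" and H2: "lie_hom H2" unfolding H1_def H2_def by (rule free_lie_lift_hom)+
  have gens: "H1 ?x = hder d1" "H1 ?y = hemb (free_gen 0)" "H2 (free_gen 0) = hder d2"
    "H2 (free_gen (Suc s)) = hemb (free_gen (s, 0))" for s
    by (simp_all add: H1_def H2_def free_lie_lift_gen)
  have vS: "v s (Suc t) = lie (v s t) (free_gen 0)" for s t
    unfolding v_def by (rule lie_products_replicate_Suc)
  have hemb: "lie (hemb a) (hemb b) = hemb (lie a b)" for a b :: "'c::lie_ring"
    by (rule lie_hom_lie[OF lie_hom_hemb, symmetric])
  have "H1 (u_elem ?x ?y s 0) = hemb (v s 0)" for s
    by (induction s) (simp_all add: u_elem_0_0 u_elem_Suc_left lie_hom_lie[OF H1] gens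
        lie_hemb_hder[OF d1(1)] d1(2) v_def lie_products_def)
  then have 1: "H1 (u_elem ?x ?y s t) = hemb (v s t)" for s t
    by (induction t) (simp_all add: u_elem_Suc_right lie_hom_lie[OF H1] gens vS hemb)
  have 2: "H2 (v s t) = hemb (free_gen (s, t))" for s t
  proof (induction t)
    case 0
    then show ?case by (simp add: v_def lie_products_def gens)
  qed (simp add: vS lie_hom_lie[OF H2] gens lie_hemb_hder[OF d2(1)] d2(2))
  define V where "V = free_lie_lift (\<lambda>(s, t). v s t)"
  have V: "lie_hom V" unfolding V_def by (rule free_lie_lift_hom)
  have "(\<lambda>f. H1 (u_map ?x ?y f)) = free_lie_lift (\<lambda>(s, t). hemb (v s t))"
    by (rule lie_hom_free_unique[OF lie_hom_comp[OF H1 lie_hom_u_map]]) (auto simp: u_map_gen 1)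
  moreover have "(\<lambda>f. hemb (V f)) = free_lie_lift (\<lambda>(s, t). hemb (v s t))"
    by (rule lie_hom_free_unique[OF lie_hom_comp[OF lie_hom_hemb V]])
      (auto simp: V_def free_lie_lift_gen)
  ultimately have "hemb (V f) = H1 (u_map ?x ?y f)" by metis
  then have "hemb (V f) = hemb 0"
    by (simp add: assms lie_hom_zero[OF H1] lie_hom_zero[OF lie_hom_hemb])
  then have Vf: "V f = 0" by (rule inj_hemb)
  have "(\<lambda>f. H2 (V f)) = free_lie_lift (\<lambda>v. hemb (free_gen v))"
    by (rule lie_hom_free_unique[OF lie_hom_comp[OF H2 V]]) (auto simp: V_def free_lie_lift_gen 2)
  moreover have "hemb = free_lie_lift (\<lambda>v. hemb (free_gen v))"
    by (rule lie_hom_free_unique[OF lie_hom_hemb]) simp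
  ultimately have "hemb f = hemb 0"
    using Vf by (metis lie_hom_zero[OF H2] lie_hom_zero[OF lie_hom_hemb])
  then show ?thesis by (rule inj_hemb)
qed

section \<open>The lower central series and leading parts\<close>

lemma group_closure_image: "additive h \<Longrightarrow> group_closure (h ` S) = h ` group_closure S"
proof
  assume h: "additive h"
  show "group_closure (h ` S) \<subseteq> h ` group_closure S"
    by (rule group_closure_subset[OF add_closed_image[OF h add_closed_group_closure]])
      (auto intro: group_closure.base)
  have "group_closure S \<subseteq> {a. h a \<in> group_closure (h ` S)}"
    by (rule group_closure_subset[OF add_closed_vimage[OF h add_closed_group_closure]])
      (auto intro: group_closure.base)
  then show "h ` group_closure S \<subseteq> group_closure (h ` S)" by blast
qed

lemma lie_prod_image: "lie_hom h \<Longrightarrow> lie_prod (h ` A) (h ` B) = h ` lie_prod A B"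
proof -
  assume h: "lie_hom h"
  have "{lie a b |a b. a \<in> h ` A \<and> b \<in> h ` B} = h ` {lie a b |a b. a \<in> A \<and> b \<in> B}"
    by (force simp: lie_hom_lie[OF h])
  then show ?thesis unfolding lie_prod_def by (simp add: group_closure_image[OF lie_hom_additive[OF h]])
qed

lemma lie_in_lie_prod: "a \<in> A \<Longrightarrow> b \<in> B \<Longrightarrow> lie a b \<in> lie_prod A B"
  unfolding lie_prod_def by (rule group_closure.base) blast

lemma add_closed_lie_prod: "add_closed (lie_prod A B)"
  unfolding lie_prod_def by (rule add_closed_group_closure)

lemma lie_prod_subset: "add_closed C \<Longrightarrow> (\<And>a b. a \<in> A \<Longrightarrow> b \<in> B \<Longrightarrow> lie a b \<in> C) \<Longrightarrow> lie_prod A B \<subseteq> C"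
  unfolding lie_prod_def by (rule group_closure_subset) auto

lemma lower_central_1: "lower_central M (Suc 0) = M"
  by (simp add: lower_central_def)

lemma lower_central_Suc: "0 < n \<Longrightarrow> lower_central M (Suc n) = lie_prod (lower_central M n) M"
  by (cases n) (simp_all add: lower_central_def)

lemma lower_central_image:
  assumes "lie_hom h" "0 < n"
  shows "lower_central (h ` M) n = h ` lower_central M n"
  using assms(2)
proof (induction n rule: nat_induct_non_zero)
  case 1
  then show ?case by (simp add: lower_central_1)
next
  case (Suc n)
  then show ?case by (simp add: lower_central_Suc lie_prod_image[OF assms(1)])
qed

lemma lower_central_free: "0 < n \<Longrightarrow> lower_central UNIV n = lie_ge n"
proof (induction n rule: nat_induct_non_zero)
  case 1
  have "(lie_ge 1 :: 'a free_lie set) = UNIV" using lie_ge_1 by blast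
  then show ?case by (simp add: lower_central_1)
next
  case (Suc n)
  have "lie_prod (lie_ge n) UNIV = (lie_ge (Suc n) :: 'a free_lie set)"
  proof
    show "lie_prod (lie_ge n) UNIV \<subseteq> (lie_ge (Suc n) :: 'a free_lie set)"
      by (rule lie_prod_subset[OF add_closed_lie_ge]) (rule lie_ge_lie)
    show "(lie_ge (Suc n) :: 'a free_lie set) \<subseteq> lie_prod (lie_ge n) UNIV"
    proof
      fix f :: "'a free_lie" assume "f \<in> lie_ge (Suc n)"
      then obtain c where c: "f = lin bracket c" "\<And>w. lookup c w \<noteq> 0 \<Longrightarrow> Suc n \<le> length w"
        unfolding lie_ge_def by blast
      have "bracket w \<in> lie_prod (lie_ge n) UNIV" if "w \<in> keys c" for w
      proof -
        have len: "Suc n \<le> length w" using that c(2) by (simp add: in_keys_iff)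
        then have "w \<noteq> []" by auto
        then obtain v b where w: "w = v @ [b]" by (metis append_butlast_last_id)
        have "v \<noteq> []" "n \<le> length v" using len \<open>0 < n\<close> w by auto
        then show ?thesis unfolding w by (simp add: left_normed_snoc lie_in_lie_prod bracket_in_lie_ge)
      qed
      then show "f \<in> lie_prod (lie_ge n) UNIV"
        unfolding c(1) by (rule add_closed_lin[OF add_closed_lie_prod])
    qed
  qed
  then show ?case using Suc by (simp add: lower_central_Suc)
qed

lemma lie_ge_additive:
  assumes "additive h" "add_closed A" "f \<in> lie_ge n" "\<And>w. n \<le> length w \<Longrightarrow> h (bracket w) \<in> A"
  shows "h f \<in> A"
proof -
  obtain c where c: "f = lin bracket c" "\<And>w. lookup c w \<noteq> 0 \<Longrightarrow> n \<le> length w"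
    using assms(3) unfolding lie_ge_def by blast
  have "h (bracket w) \<in> A" if "w \<in> keys c" for w
    using that c(2)[of w] assms(4)[of w] by (simp add: in_keys_iff)
  then show ?thesis unfolding c(1) additive_lin_comp[OF assms(1)]
    by (rule add_closed_lin[OF assms(2)])
qed

lemma lie_ge_lie_bracket: "f \<in> lie_ge m \<Longrightarrow> lie f (bracket w) \<in> lie_ge (m + length w)"
proof (induction w arbitrary: f m rule: rev_induct)
  case (snoc b w)
  show ?case
  proof (cases "w = []")
    case True
    then show ?thesis using lie_ge_lie_gen[OF snoc.prems] by simp
  next
    case False
    have "lie (lie f (bracket w)) (free_gen b) \<in> lie_ge (m + length (w @ [b]))"
      using lie_ge_lie_gen[OF snoc.IH[OF snoc.prems]] by simp
    moreover have "lie (lie f (free_gen b)) (bracket w) \<in> lie_ge (m + length (w @ [b]))"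
      using snoc.IH[OF lie_ge_lie_gen[OF snoc.prems]] by simp
    ultimately show ?thesis using False
      by (simp add: left_normed_snoc lie_lie_right add_closed_diff[OF add_closed_lie_ge])
  qed
qed (simp add: add_closed_0[OF add_closed_lie_ge])

lemma lie_ge_lie_ge: "f \<in> lie_ge m \<Longrightarrow> g \<in> lie_ge n \<Longrightarrow> lie f g \<in> lie_ge (m + n)"
proof -
  assume f: "f \<in> lie_ge m" and g: "g \<in> lie_ge n"
  show "lie f g \<in> lie_ge (m + n)"
  proof (rule lie_ge_additive[OF additive_lie_right add_closed_lie_ge g])
    fix w :: "'a list" assume "n \<le> length w"
    then have "m + n \<le> m + length w" by simp
    from subsetD[OF lie_ge_mono[OF this] lie_ge_lie_bracket[OF f]]
    show "lie f (bracket w) \<in> lie_ge (m + n)" .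
  qed
qed

lemma lie_ge_derivation_bracket: "derivation d \<Longrightarrow> d (bracket w) \<in> lie_ge (length w)"
proof (induction w rule: rev_induct)
  case (snoc b w)
  show ?case
  proof (cases "w = []")
    case True
    then show ?thesis using lie_ge_1 by simp
  next
    case False
    have "lie (d (bracket w)) (free_gen b) \<in> lie_ge (length (w @ [b]))"
      using lie_ge_lie_gen[OF snoc.IH[OF snoc.prems]] by simp
    moreover have "lie (bracket w) (d (free_gen b)) \<in> lie_ge (length (w @ [b]))"
      using lie_ge_lie[OF bracket_in_lie_ge[OF order_refl]] by simp
    ultimately show ?thesis using False
      by (simp add: left_normed_snoc derivation_lie[OF snoc.prems] add_closed_add[OF add_closed_lie_ge])
  qed
qed (simp add: add_closed_0[OF add_closed_lie_ge] additive.zero[OF derivation_additive])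

lemma lie_ge_derivation: "derivation d \<Longrightarrow> f \<in> lie_ge n \<Longrightarrow> d f \<in> lie_ge n"
proof -
  assume d: "derivation d" and f: "f \<in> lie_ge n"
  show "d f \<in> lie_ge n"
  proof (rule lie_ge_additive[OF derivation_additive[OF d] add_closed_lie_ge f])
    fix w :: "'a list" assume "n \<le> length w"
    from subsetD[OF lie_ge_mono[OF this] lie_ge_derivation_bracket[OF d]]
    show "d (bracket w) \<in> lie_ge n" .
  qed
qed

text \<open>On \<open>lie_ge n\<close> this is the leading part, as the components of lower degree
  vanish there.\<close>

definition top_part :: "nat \<Rightarrow> 'v free_lie \<Rightarrow> 'v assoc"
  where "top_part n f = restr (\<lambda>w. length w = n) (iota f)"

lemma additive_top_part: "additive (top_part n)"
  unfolding top_part_def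
  by (rule additive.intro) (simp add: additive.add[OF additive_iota] additive.add[OF additive_restr])

lemma top_part_lin: "top_part n (lin bracket c) = lin (left_normed letter) (restr (\<lambda>w. length w = n) c)"
proof -
  have "restr (\<lambda>w. length w = n) (left_normed letter w) = (if length w = n then left_normed letter w else 0)" for w :: "'a list"
    by (rule poly_mapping_eqI) (auto simp: lookup_restr homog_lookup[OF homog_left_normed])
  then show ?thesis
    by (simp add: top_part_def iota_lin additive_lin_comp[OF additive_restr] lin_restr)
qed

lemma top_part_bracket: "top_part n (bracket w) = (if length w = n then left_normed letter w else 0)"
  using top_part_lin[of n "frag_of w"] by (simp add: restr_def)

lemma top_part_Suc: "f \<in> lie_ge (Suc n) \<Longrightarrow> top_part n f = 0"
  using lie_ge_additive[OF additive_top_part, of "{0}" f "Suc n" n]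
  by (simp add: top_part_bracket add_closed_def)

lemma top_part_in_lie_elts: "top_part n f \<in> lie_elts n"
proof -
  obtain c where "f = lin bracket c" by (rule free_lie_span)
  then show ?thesis unfolding lie_elts_def
    by (auto simp: top_part_lin homog_def lookup_restr intro!: image_eqI[OF refl])
qed

lemma top_part_surj:
  assumes "l \<in> lie_elts n"
  obtains f where "f \<in> lie_ge n" "top_part n f = l"
proof -
  obtain c where c: "homog n c" "l = lin (left_normed letter) c" using assms unfolding lie_elts_def by blast
  have "restr (\<lambda>w. length w = n) c = c"
    by (rule poly_mapping_eqI) (use homog_lookup[OF c(1)] in \<open>auto simp: lookup_restr\<close>)
  then have "top_part n (lin bracket c) = l" by (simp add: top_part_lin c(2))
  moreover have "lin bracket c \<in> lie_ge n"
    unfolding lie_ge_def using c(1) by (auto simp: homog_def)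
  ultimately show ?thesis using that by blast
qed

text \<open>The component of degree \<open>n\<close> vanishes in the associative ring and hence in the
  free Lie ring, since \<open>n\<close> annihilates it and there is no torsion.\<close>

lemma top_part_kernel:
  fixes f :: "'v::countable free_lie"
  assumes "f \<in> lie_ge n" "0 < n" "top_part n f = 0"
  shows "f \<in> lie_ge (Suc n)"
proof -
  obtain c where c: "f = lin bracket c" "\<And>w. lookup c w \<noteq> 0 \<Longrightarrow> n \<le> length w"
    using assms(1) unfolding lie_ge_def by blast
  let ?c = "restr (\<lambda>w. length w = n) c" and ?d = "restr (\<lambda>w. length w \<noteq> n) c"
  have "iota (lin bracket ?c) = 0" using assms(3) by (simp add: c top_part_lin iota_lin)
  moreover have "homog n ?c" by (auto simp: homog_def lookup_restr split: if_splits)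
  ultimately have "lin bracket ?c = 0" using iota_inj_homog assms(2) by blast
  moreover have split: "c = ?c + ?d" by (rule poly_mapping_eqI) (simp add: lookup_add lookup_restr)
  have "f = lin bracket ?c + lin bracket ?d" unfolding c(1) lin_add[symmetric] split[symmetric] ..
  ultimately have "f = lin bracket ?d" by simp
  moreover have "Suc n \<le> length w" if "lookup ?d w \<noteq> 0" for w
    using that c(2)[of w] by (auto simp: lookup_restr split: if_splits)
  ultimately show ?thesis unfolding lie_ge_def by blast
qed

section \<open>Derivations that shift letters\<close>

text \<open>The value on a word of the derivation \<open>D i\<close> of the associative ring that
  replaces each letter \<open>a\<close> by \<open>i a\<close>.\<close>

primrec Dword :: "('v \<Rightarrow> 'v) \<Rightarrow> 'v list \<Rightarrow> 'v assoc" where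
  "Dword i [] = 0"
| "Dword i (a # w) = frag_of (i a # w) + letter a * Dword i w"

definition D :: "('v \<Rightarrow> 'v) \<Rightarrow> 'v assoc \<Rightarrow> 'v assoc" where "D i = lin (Dword i)"

lemma additive_D: "additive (D i)" unfolding D_def by (rule additive_lin)
lemma D_frag_of [simp]: "D i (frag_of w) = Dword i w" by (simp add: D_def)

lemmas D_add = additive.add[OF additive_D]
  and D_diff = additive.diff[OF additive_D]
  and D_minus = additive.minus[OF additive_D]
  and D_zero [simp] = additive.zero[OF additive_D]
  and D_zmul = additive_zmul[OF additive_D]

lemma Dword_snoc: "Dword i (w @ [b]) = Dword i w * letter b + frag_of (w @ [i b])"
  by (induction w) (simp_all add: letter_def frag_of_mult algebra_simps)

lemma D_letter_mult: "D i (letter b * c) = letter (i b) * c + letter b * D i c"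
proof (induction c rule: frag_induction[OF subset_UNIV])
  case (2 w)
  then show ?case by (simp add: letter_def frag_of_mult)
qed (simp_all add: right_diff_distrib D_diff)

lemma D_mult_letter: "D i (c * letter b) = D i c * letter b + c * letter (i b)"
proof (induction c rule: frag_induction[OF subset_UNIV])
  case (2 w)
  have "frag_of w * letter b = frag_of (w @ [b])" "frag_of w * letter (i b) = frag_of (w @ [i b])"
    by (simp_all add: letter_def frag_of_mult)
  then show ?case by (simp add: Dword_snoc)
qed (simp_all add: left_diff_distrib D_diff)

lemma homog_Dword: "homog (length w) (Dword i w)"
proof (induction w)
  case (Cons a w)
  have "length z = length (a # w)" if "lookup (letter a * Dword i w) z \<noteq> 0" for z
  proof (cases z)
    case (Cons b z')
    with that homogD[OF \<open>homog (length w) (Dword i w)\<close>, of z'] show ?thesis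
      by (simp add: lookup_letter_mult split: if_splits)
  qed (use that in \<open>simp add: lookup_letter_mult\<close>)
  then have "homog (length (a # w)) (letter a * Dword i w)" unfolding homog_def by blast
  then show ?case by (simp add: homog_add homog_frag_of)
qed simp

lemma homog_D: "homog n c \<Longrightarrow> homog n (D i c)"
proof -
  assume c: "homog n c"
  have "homog n (Dword i w)" if "w \<in> keys c" for w
    using homog_Dword[of w i] homog_keys[OF c that] by simp
  then show "homog n (D i c)" unfolding D_def by (rule homog_lin)
qed

lemma D_left_normed: "D i (left_normed letter w) = lin (left_normed letter) (Dword i w)"
proof (induction w rule: rev_induct)
  case (snoc b w)
  show ?case
  proof (cases "w = []")
    case True
    then show ?thesis by (simp add: letter_def)
  next
    case False
    then have "lin (left_normed letter) (Dword i w * letter b) = lie (D i (left_normed letter w)) (letter b)"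
      by (subst lin_left_normed_mult_letter[OF homog_Dword]) (simp_all add: snoc)
    then show ?thesis using False
      by (simp add: Dword_snoc lin_add left_normed_snoc lie_poly_mapping_def D_diff D_letter_mult
          D_mult_letter algebra_simps)
  qed
qed simp

lemma D_lin_left_normed: "D i (lin (left_normed letter) c) = lin (left_normed letter) (D i c)"
proof -
  have "D i (lin (left_normed letter) c) = lin (\<lambda>w. lin (left_normed letter) (Dword i w)) c"
    by (simp add: additive_lin_comp[OF additive_D] D_left_normed)
  also have "\<dots> = lin (left_normed letter) (lin (Dword i) c)" by (simp add: additive_lin_comp[OF additive_lin])
  finally show ?thesis by (simp only: D_def)
qed

lemma D_lie_elts: "l \<in> lie_elts n \<Longrightarrow> D i l \<in> lie_elts n"
  unfolding lie_elts_def by (auto simp: D_lin_left_normed intro!: imageI homog_D)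

lemma derivation_bracket_approx:
  assumes d: "derivation d" and gen: "\<And>v. d (free_gen v) - free_gen (i v) \<in> lie_ge 2"
  shows "d (bracket w) - lin bracket (Dword i w) \<in> lie_ge (Suc (length w))"
proof (induction w rule: rev_induct)
  case (snoc b w)
  show ?case
  proof (cases "w = []")
    case True
    then show ?thesis using gen[of b] by (simp add: letter_def numeral_2_eq_2)
  next
    case False
    have "lin bracket (Dword i w * letter b) = lie (lin bracket (Dword i w)) (free_gen b)"
      using False by (intro lin_left_normed_mult_letter[OF homog_Dword]) simp
    then have eq: "d (bracket (w @ [b])) - lin bracket (Dword i (w @ [b])) =
        lie (d (bracket w) - lin bracket (Dword i w)) (free_gen b)
        + lie (bracket w) (d (free_gen b) - free_gen (i b))"
      using False by (simp add: left_normed_snoc derivation_lie[OF d] Dword_snoc lin_add lie_diff_left lie_diff_right)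
    have "lie (bracket w) (d (free_gen b) - free_gen (i b)) \<in> lie_ge (length w + 2)"
      by (rule lie_ge_lie_ge[OF bracket_in_lie_ge[OF order_refl] gen])
    then show ?thesis unfolding eq
      using lie_ge_lie_gen[OF snoc] by (intro add_closed_add[OF add_closed_lie_ge]) simp_all
  qed
qed (simp add: add_closed_0[OF add_closed_lie_ge] additive.zero[OF derivation_additive[OF d]])

text \<open>By the product rule one factor of a bracket is replaced at a time; the terms by which
  \<open>d (free_gen v)\<close> differs from \<open>free_gen (i v)\<close> only contribute in
  degree above \<open>n\<close>.\<close>

lemma top_part_derivation:
  assumes d: "derivation d" and gen: "\<And>v. d (free_gen v) - free_gen (i v) \<in> lie_ge 2"
    and f: "f \<in> lie_ge n"
  shows "top_part n (d f) = D i (top_part n f)"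
proof -
  have "top_part n (d f) - D i (top_part n f) \<in> {0}"
  proof (rule lie_ge_additive[OF _ _ f, where h = "\<lambda>f. top_part n (d f) - D i (top_part n f)"])
    show "additive (\<lambda>f. top_part n (d f) - D i (top_part n f))"
      by (intro additive_diff_fun additive_comp[OF additive_top_part derivation_additive[OF d]]
          additive_comp[OF additive_D additive_top_part])
    fix w :: "'a list" assume w: "n \<le> length w"
    show "top_part n (d (bracket w)) - D i (top_part n (bracket w)) \<in> {0}"
    proof (cases "length w = n")
      case True
      have "top_part n (d (bracket w) - lin bracket (Dword i w)) = 0"
        using derivation_bracket_approx[OF d gen, of w] True by (intro top_part_Suc) simp
      moreover have "restr (\<lambda>v. length v = n) (Dword i w) = Dword i w"
        by (rule poly_mapping_eqI) (use homog_lookup[OF homog_Dword] True in \<open>auto simp: lookup_restr\<close>)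
      ultimately show ?thesis
        using True by (simp add: additive.diff[OF additive_top_part] top_part_lin top_part_bracket D_left_normed)
    next
      case False
      have "d (bracket w) \<in> lie_ge (Suc n)"
        using lie_ge_derivation_bracket[OF d, of w] lie_ge_mono[of "Suc n" "length w"] False w by auto
      then show ?thesis using False by (simp add: top_part_Suc top_part_bracket)
    qed
  qed (simp add: add_closed_def)
  then show ?thesis by simp
qed

section \<open>Shifts as a regular sequence\<close>

text \<open>If \<open>e\<close> undoes the letter map \<open>i\<close> where possible, this is the
  coefficient of \<open>D i c\<close> at a word in terms of those of \<open>c\<close>
  (\<open>lookup_D\<close>). It makes sense for every function on words, in particular for
  sums over shuffles, which need not have finite support.\<close>

primrec shift_coeff :: "('v \<Rightarrow> 'v option) \<Rightarrow> 'v list \<Rightarrow> ('v list \<Rightarrow> int) \<Rightarrow> int" where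
  "shift_coeff e [] f = 0"
| "shift_coeff e (b # z) f = (case e b of None \<Rightarrow> 0 | Some a \<Rightarrow> f (a # z)) + shift_coeff e z (\<lambda>w. f (b # w))"

lemma shift_coeff_zero [simp]: "shift_coeff e z (\<lambda>w. 0) = 0"
  by (induction z) (simp_all split: option.split)
lemma shift_coeff_add: "shift_coeff e z (\<lambda>w. f w + g w) = shift_coeff e z f + shift_coeff e z g"
  by (induction z arbitrary: f g) (simp_all split: option.split)
lemma shift_coeff_diff: "shift_coeff e z (\<lambda>w. f w - g w) = shift_coeff e z f - shift_coeff e z g"
  by (induction z arbitrary: f g) (simp_all split: option.split)

lemma shift_coeff_cong:
  "(\<And>w. length w = length z \<Longrightarrow> f w = g w) \<Longrightarrow> shift_coeff e z f = shift_coeff e z g"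
proof (induction z arbitrary: f g)
  case (Cons b z)
  have "shift_coeff e z (\<lambda>w. f (b # w)) = shift_coeff e z (\<lambda>w. g (b # w))"
    by (rule Cons.IH) (rule Cons.prems, simp)
  moreover have "f (a # z) = g (a # z)" for a by (rule Cons.prems) simp
  ultimately show ?case by (simp split: option.split)
qed simp

lemma shift_coeff_append:
  "shift_coeff e (u @ v) f = shift_coeff e u (\<lambda>u'. f (u' @ v)) + shift_coeff e v (\<lambda>v'. f (u @ v'))"
  by (induction u arbitrary: f) (simp_all split: option.split)

lemma shift_coeff_dvd:
  assumes "\<And>w. length w = length z \<Longrightarrow> m dvd f w"
  shows "m dvd shift_coeff e z f"
  using assms
proof (induction z arbitrary: f)
  case (Cons b z)
  have "m dvd shift_coeff e z (\<lambda>w. f (b # w))" by (rule Cons.IH) (rule Cons.prems, simp)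
  moreover have "m dvd f (a # z)" for a by (rule Cons.prems) simp
  ultimately show ?case by (auto split: option.split)
qed simp

text \<open>A derivation applied to a shuffle product shifts a letter of one of the two factors:
  \<open>D i\<close> commutes with the coproduct.\<close>

lemma shuffle_sum_shift_coeff:
  "shuffle_sum (\<lambda>w. shift_coeff e w f) u v = shift_coeff e u (\<lambda>u'. shuffle_sum f u' v) + shift_coeff e v (\<lambda>v'. shuffle_sum f u v')"
proof (induction f u v rule: shuffle_sum.induct)
  case (3 f a u b v)
  have "shuffle_sum (\<lambda>w. shift_coeff e (c # w) f) u' v' =
      (case e c of None \<Rightarrow> 0 | Some c' \<Rightarrow> shuffle_sum (\<lambda>w. f (c' # w)) u' v')
      + shuffle_sum (\<lambda>w. shift_coeff e w (\<lambda>w. f (c # w))) u' v'" for c u' v'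
    by (simp add: shuffle_sum_add split: option.split)
  then show ?case using 3 by (simp add: shift_coeff_add split: option.split)
qed simp_all

text \<open>The letters form chains under \<open>i\<close>; \<open>e\<close> is the partial inverse of
  \<open>i\<close> and the weight, which grows along a chain, serves for inductions.\<close>

locale letter_shift =
  fixes i :: "'v \<Rightarrow> 'v" and e :: "'v \<Rightarrow> 'v option" and \<mu> :: "'v \<Rightarrow> nat"
  assumes dec: "e b = Some a \<longleftrightarrow> i a = b" and weight: "\<mu> (i a) = Suc (\<mu> a)"
begin

lemma dec_i [simp]: "e (i a) = Some a" by (simp add: dec)

lemma i_eq_iff: "i a = i b \<longleftrightarrow> a = b" by (metis dec_i option.inject)

lemma lookup_Dword: "lookup (Dword i w) z = shift_coeff e z (\<lambda>v. of_bool (v = w))"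
proof (induction w arbitrary: z)
  case Nil
  have "shift_coeff e z (\<lambda>v. of_bool (v = [])) = 0" by (induction z) (simp_all split: option.split)
  then show ?case by simp
next
  case (Cons a w)
  show ?case
  proof (cases z)
    case (Cons b z')
    have "(case e b of None \<Rightarrow> 0 | Some a' \<Rightarrow> of_bool (a' # z' = a # w)) = (of_bool (i a # w = b # z') :: int)"
      by (auto simp: dec i_eq_iff split: option.split)
    moreover have "shift_coeff e z' (\<lambda>v. of_bool (b # v = a # w)) = (if b = a then shift_coeff e z' (\<lambda>v. of_bool (v = w)) else 0)"
      by simp
    ultimately show ?thesis using Cons by (auto simp: lookup_add lookup_letter_mult Cons.IH)
  qed (simp add: lookup_add lookup_letter_mult)
qed

lemma lookup_D: "lookup (D i c) z = shift_coeff e z (lookup c)"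
proof (induction c rule: frag_induction[OF subset_UNIV])
  case 1
  have "lookup (0 :: 'v assoc) = (\<lambda>w. 0)" by (simp add: fun_eq_iff)
  then show ?case by (simp only: D_zero shift_coeff_zero lookup_zero)
next
  case (2 w)
  have "lookup (frag_of w) = (\<lambda>v. of_bool (v = w))" by (auto simp: fun_eq_iff)
  then show ?case by (simp only: D_frag_of lookup_Dword)
next
  case (3 a b)
  have "lookup (a - b) = (\<lambda>w. lookup a w - lookup b w)" by (simp add: fun_eq_iff lookup_minus)
  with 3 show ?case by (simp only: D_diff lookup_minus shift_coeff_diff)
qed

abbreviation "wt w \<equiv> sum_list (map \<mu> w)"

lemma shift_coeff_dvd_lower:
  assumes "\<And>w. length w = length z \<Longrightarrow> wt w < wt z \<Longrightarrow> m dvd f w"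
  shows "m dvd shift_coeff e z f"
  using assms
proof (induction z arbitrary: f)
  case (Cons b z)
  have "m dvd shift_coeff e z (\<lambda>w. f (b # w))" by (rule Cons.IH) (use Cons.prems in auto)
  moreover have "m dvd f (a # z)" if "e b = Some a" for a
    using that by (intro Cons.prems) (auto simp: dec weight)
  ultimately show ?case by (auto split: option.split)
qed simp

text \<open>The value at \<open>a # w\<close> occurs in the coefficient at \<open>i a # w\<close>, along
  with values at words whose tails have smaller weight. The hypothesis is confined to words
  that begin with a shifted letter, since \<open>koszul_exact\<close> controls only these.\<close>

lemma shift_coeff_inj:
  assumes "\<And>a w. length w = n \<Longrightarrow> m dvd shift_coeff e (i a # w) f" "length w = n"
  shows "m dvd f (a # w)"
  using assms(2)
proof (induction "wt w" arbitrary: a w rule: less_induct)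
  case less
  have "m dvd shift_coeff e w (\<lambda>v. f (i a # v))"
    by (rule shift_coeff_dvd_lower) (use less in auto)
  moreover have "m dvd f (a # w) + shift_coeff e w (\<lambda>v. f (i a # v))"
    using assms(1)[OF less.prems, of a] by simp
  ultimately show ?case by (simp add: dvd_add_left_iff)
qed

lemma shift_coeff_inj_all:
  assumes "\<And>z. length z = n \<Longrightarrow> m dvd shift_coeff e z f" "length z = n" "0 < n"
  shows "m dvd f z"
proof -
  obtain a w where z: "z = a # w" using assms(2,3) by (cases z) auto
  show ?thesis unfolding z
  proof (rule shift_coeff_inj[of "length w"])
    fix a' w' assume "length (w' :: 'v list) = length w"
    then show "m dvd shift_coeff e (i a' # w') f" using assms(2) z by (intro assms(1)) simp
  qed simp
qed

text \<open>For a fixed length of \<open>u\<close> the sum over the shuffles of \<open>u\<close> and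
  \<open>v\<close> is a function of the word \<open>u @ v\<close>. Passing to it commutes with
  the shift, which is injective modulo \<open>m\<close>.\<close>

lemma primitive_D:
  assumes "primitive m n (lookup (D i c))" "0 < n"
  shows "primitive m n (lookup c)"
  unfolding primitive_def
proof (intro allI impI)
  fix u v :: "'v list" assume uv: "u \<noteq> []" "v \<noteq> []" "length u + length v = n"
  define k where "k = length u"
  have "m dvd shuffle_sum (lookup c) (take k (u @ v)) (drop k (u @ v))"
  proof (rule shift_coeff_inj_all[where f = "\<lambda>z. shuffle_sum (lookup c) (take k z) (drop k z)"])
    fix z :: "'v list" assume z: "length z = n"
    let ?u = "take k z" and ?v = "drop k z"
    have len: "length ?u = k" using uv z by (simp add: k_def)
    have "shift_coeff e z (\<lambda>z. shuffle_sum (lookup c) (take k z) (drop k z))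
      = shift_coeff e (?u @ ?v) (\<lambda>z. shuffle_sum (lookup c) (take k z) (drop k z))" by simp
    also have "\<dots> = shift_coeff e ?u (\<lambda>u'. shuffle_sum (lookup c) (take k (u' @ ?v)) (drop k (u' @ ?v)))
        + shift_coeff e ?v (\<lambda>v'. shuffle_sum (lookup c) (take k (?u @ v')) (drop k (?u @ v')))"
      by (rule shift_coeff_append)
    also have "\<dots> = shift_coeff e ?u (\<lambda>u'. shuffle_sum (lookup c) u' ?v) + shift_coeff e ?v (\<lambda>v'. shuffle_sum (lookup c) ?u v')"
      using len by (intro arg_cong2[of _ _ _ _ "(+)"] shift_coeff_cong) simp_all
    also have "\<dots> = shuffle_sum (lookup (D i c)) ?u ?v"
      unfolding shuffle_sum_shift_coeff[symmetric] lookup_D ..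
    finally have eq: "shift_coeff e z (\<lambda>z. shuffle_sum (lookup c) (take k z) (drop k z)) = shuffle_sum (lookup (D i c)) ?u ?v" .
    have "length ?v = length v" using uv z by (simp add: k_def)
    with len uv have "?u \<noteq> []" "?v \<noteq> []" "length ?u + length ?v = n" by (auto simp: k_def)
    then show "m dvd shift_coeff e z (\<lambda>z. shuffle_sum (lookup c) (take k z) (drop k z))"
      unfolding eq using assms(1) unfolding primitive_def by blast
  qed (use uv assms in auto)
  then show "m dvd shuffle_sum (lookup c) u v" by (simp add: k_def)
qed

text \<open>In degree \<open>n + 1\<close> the shift acts as multiplication by the sum of \<open>n +
  1\<close> variables, one for each place. This sum is monic in the variable of the first
  place, so division with remainder is possible, and remainders are free of that variable. The
  predicate \<open>A\<close> lets a second division keep the shape of the remainder of a first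
  one.\<close>

lemma division:
  assumes A: "\<And>a. A (i a) \<longleftrightarrow> A a"
    and c: "homog (Suc n) c" "\<And>z. lookup c z \<noteq> 0 \<Longrightarrow> A (hd z)"
  obtains q r where "c = D i q + r" "homog (Suc n) q" "homog (Suc n) r"
    "\<And>z. lookup r z \<noteq> 0 \<Longrightarrow> A (hd z) \<and> hd z \<notin> range i"
proof -
  define R where "R = {r :: 'v assoc. homog (Suc n) r \<and> (\<forall>z. lookup r z \<noteq> 0 \<longrightarrow> A (hd z) \<and> hd z \<notin> range i)}"
  define C where "C = {d + r |d r. d \<in> D i ` Collect (homog (Suc n)) \<and> r \<in> R}"
  have "R = {r. \<forall>z. lookup r z \<noteq> 0 \<longrightarrow> length z = Suc n \<and> A (hd z) \<and> hd z \<notin> range i}"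
    by (auto simp: R_def homog_def)
  then have "add_closed R" using add_closed_supported[of "\<lambda>z. length z = Suc n \<and> A (hd z) \<and> hd z \<notin> range i"] by simp
  then have C: "add_closed C" unfolding C_def
    by (rule add_closed_set_plus[OF add_closed_image[OF additive_D add_closed_homog]])
  have word: "frag_of (h # w) \<in> C" if "A h" "length w = n" for h w
    using that
  proof (induction "\<mu> h" arbitrary: h w rule: less_induct)
    case less
    show ?case
    proof (cases "h \<in> range i")
      case False
      have "frag_of (h # w) \<in> R"
        using False less.prems by (auto simp: R_def homog_frag_of split: if_splits)
      moreover have "0 \<in> D i ` Collect (homog (Suc n))" by (rule image_eqI[where x = 0]) simp_all
      ultimately show ?thesis unfolding C_def by (metis (mono_tags, lifting) add_0 mem_Collect_eq)
    next
      case True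
      then obtain a where h: "h = i a" by blast
      have "A a" "\<mu> a < \<mu> h" using less.prems A h weight by auto
      have "letter a * Dword i w = lin (\<lambda>v. frag_of (a # v)) (Dword i w)"
        using lin_letter_mult[of frag_of a "Dword i w"] by (simp add: lin_expansion)
      also have "\<dots> \<in> C"
      proof (rule add_closed_lin[OF C])
        fix v assume "v \<in> keys (Dword i w)"
        then have "length v = n" using homog_keys[OF homog_Dword] less.prems(2) by blast
        then show "frag_of (a # v) \<in> C" using less.hyps[OF \<open>\<mu> a < \<mu> h\<close> \<open>A a\<close>] by blast
      qed
      finally have 1: "letter a * Dword i w \<in> C" .
      have "D i (frag_of (a # w)) \<in> D i ` Collect (homog (Suc n))"
        using less.prems by (intro imageI) (simp add: homog_frag_of)
      moreover have "0 \<in> R" by (simp add: R_def)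
      ultimately have "D i (frag_of (a # w)) + 0 \<in> C" unfolding C_def by blast
      from add_closed_diff[OF C this 1] show ?thesis by (simp add: h)
    qed
  qed
  have "lin frag_of c \<in> C"
  proof (rule add_closed_lin[OF C])
    fix w assume "w \<in> keys c"
    then have "lookup c w \<noteq> 0" by (simp add: in_keys_iff)
    then have "length w = Suc n" "A (hd w)" using homogD[OF c(1)] c(2) by blast+
    then show "frag_of w \<in> C" using word[of "hd w" "tl w"] by (cases w) auto
  qed
  then have "c \<in> C" by (simp add: lin_expansion)
  then obtain q r where "c = D i q + r" "homog (Suc n) q" "r \<in> R" unfolding C_def by blast
  then show ?thesis using that unfolding R_def by blast
qed

lemma D_commute:
  assumes "\<And>a. i (j a) = j (i a)"
  shows "D i (D j c) = D j (D i c)"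
proof -
  have "D i (Dword j w) = D j (Dword i w)" for w
    by (induction w) (simp_all add: D_add D_letter_mult assms algebra_simps)
  then show ?thesis
    by (induction c rule: frag_induction[OF subset_UNIV]) (simp_all add: D_diff)
qed

end

definition incx :: "nat \<times> nat \<Rightarrow> nat \<times> nat" where "incx = (\<lambda>(s, t). (Suc s, t))"
definition incy :: "nat \<times> nat \<Rightarrow> nat \<times> nat" where "incy = (\<lambda>(s, t). (s, Suc t))"
definition decx :: "nat \<times> nat \<Rightarrow> (nat \<times> nat) option"
  where "decx = (\<lambda>(s, t). case s of 0 \<Rightarrow> None | Suc s' \<Rightarrow> Some (s', t))"
definition decy :: "nat \<times> nat \<Rightarrow> (nat \<times> nat) option"
  where "decy = (\<lambda>(s, t). case t of 0 \<Rightarrow> None | Suc t' \<Rightarrow> Some (s, t'))"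

interpretation X: letter_shift incx decx fst
  by standard (auto simp: incx_def decx_def split: nat.split prod.splits)
interpretation Y: letter_shift incy decy snd
  by standard (auto simp: incy_def decy_def split: nat.split prod.splits)

abbreviation "DX \<equiv> D incx"
abbreviation "DY \<equiv> D incy"

lemma incx_incy: "incx (incy a) = incy (incx a)" by (simp add: incx_def incy_def split: prod.split)

lemma DX_DY: "DX (DY c) = DY (DX c)" by (rule X.D_commute) (rule incx_incy)

lemma incx_range_incy: "incx a \<in> range incy \<longleftrightarrow> a \<in> range incy"
  by (cases a; cases "snd a") (auto simp: incx_def incy_def image_iff split: prod.splits)

text \<open>Shifting in one coordinate does not change whether the other coordinate of a letter is zero.\<close>

lemma lookup_DX_incy:
  assumes "\<And>z. lookup r z \<noteq> 0 \<Longrightarrow> hd z \<notin> range incy"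
  shows "lookup (DX r) (incy a # w) = 0"
proof -
  have "lookup r (b # v) = 0" if "b \<in> range incy" for b v using assms[of "b # v"] that by auto
  moreover have "b \<in> range incy" if "decx (incy a) = Some b" for b
    using that by (metis X.dec incx_range_incy rangeI)
  ultimately show ?thesis by (auto simp: X.lookup_D split: option.split)
qed

text \<open>The shifts \<open>DX\<close> and \<open>DY\<close> form a regular sequence, over the
  integers for \<open>m = 0\<close> and modulo \<open>m\<close> otherwise. After division of
  \<open>a\<close> by \<open>DY\<close> the relation says that \<open>DY\<close> of something
  equals \<open>- DX r\<close>, where \<open>r\<close> does not involve the second coordinate
  of the first letter. Comparing coefficients at words whose first letter has positive second
  coordinate shows that this something vanishes, and then \<open>r\<close> does.\<close>

lemma koszul_exact:
  assumes ab: "homog (Suc n) a" "homog (Suc n) b"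
    and dvd: "\<And>z. m dvd lookup (DX a + DY b) z"
  obtains c a' b' where "homog (Suc n) c" "homog (Suc n) a'" "homog (Suc n) b'"
    "a = DY c + zmul m a'" "b = - DX c + zmul m b'"
proof -
  obtain q r where qr: "a = DY q + r" "homog (Suc n) q" "homog (Suc n) r"
    "\<And>z. lookup r z \<noteq> 0 \<Longrightarrow> hd z \<notin> range incy"
    using Y.division[of "\<lambda>_. True", OF _ ab(1)] by metis
  have DXr: "lookup (DX r) (incy y # v) = 0" for y v by (rule lookup_DX_incy) (rule qr(4))
  have eq: "DX a + DY b = DY (DX q + b) + DX r" by (simp add: qr(1) D_add DX_DY)
  let ?b = "DX q + b"
  have b: "homog (Suc n) ?b" by (intro homog_add homog_D qr(2) ab(2))
  have "m dvd lookup ?b (x # w)" if "length w = n" for x w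
  proof (rule Y.shift_coeff_inj[OF _ that])
    fix y v
    have "m dvd lookup (DY ?b) (incy y # v)"
      using dvd[of "incy y # v"] by (simp only: eq lookup_add DXr add_0_right)
    then show "m dvd shift_coeff decy (incy y # v) (lookup ?b)" by (simp only: Y.lookup_D)
  qed
  then have db: "m dvd lookup ?b z" for z
    using homog_lookup[OF b, of z] by (cases z; cases "length z = Suc n") auto
  have dDX: "m dvd lookup (DX r) z" for z
  proof -
    have "m dvd lookup (DY ?b) z" unfolding Y.lookup_D by (rule shift_coeff_dvd) (rule db)
    then show ?thesis using dvd[of z] unfolding eq lookup_add by (simp add: dvd_add_right_iff)
  qed
  have dr': "m dvd lookup r z" if "length z = Suc n" for z
  proof (rule X.shift_coeff_inj_all[where f = "lookup r", OF _ that])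
    show "m dvd shift_coeff decx z (lookup r)" for z using dDX[of z] unfolding X.lookup_D .
  qed simp
  have dr: "m dvd lookup r z" for z
    using homog_lookup[OF qr(3), of z] dr'[of z] by (cases "length z = Suc n") simp_all
  obtain a' where a': "r = zmul m a'" "\<And>w. lookup r w = 0 \<Longrightarrow> lookup a' w = 0"
    using zmul_of_dvd[of m r] dr by blast
  obtain b' where b': "?b = zmul m b'" "\<And>w. lookup ?b w = 0 \<Longrightarrow> lookup b' w = 0"
    using zmul_of_dvd[of m ?b] db by blast
  have "homog (Suc n) a'" "homog (Suc n) b'"
    using a'(2) b'(2) homogD[OF qr(3)] homogD[OF b] unfolding homog_def by blast+
  moreover have "b = - DX q + zmul m b'" using b'(1) by (simp add: algebra_simps)
  ultimately show ?thesis using that qr(1,2) a'(1) by blast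
qed

definition shift_image :: "nat \<Rightarrow> (nat \<times> nat) assoc set"
  where "shift_image n = {a + b | a b. a \<in> DX ` Collect (homog n) \<and> b \<in> DY ` Collect (homog n)}"

lemma add_closed_shift_image: "add_closed (shift_image n)"
  unfolding shift_image_def
  by (rule add_closed_set_plus[OF add_closed_image[OF additive_D add_closed_homog]
        add_closed_image[OF additive_D add_closed_homog]])

lemma shift_imageI: "homog n a \<Longrightarrow> homog n b \<Longrightarrow> DX a + DY b \<in> shift_image n"
  unfolding shift_image_def by blast

lemma shift_imageE:
  assumes "c \<in> shift_image n"
  obtains a b where "homog n a" "homog n b" "c = DX a + DY b"
  using assms unfolding shift_image_def by blast

text \<open>A normal form modulo the images of both shifts: all letters at the first place can be
  reduced to \<open>(0, 0)\<close>. It shows that the quotient by these images is free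
  abelian.\<close>

definition is_rem :: "nat \<Rightarrow> (nat \<times> nat) assoc \<Rightarrow> (nat \<times> nat) assoc \<Rightarrow> bool"
  where "is_rem n c r \<longleftrightarrow> c - r \<in> shift_image n \<and> homog n r \<and> (\<forall>z. lookup r z \<noteq> 0 \<longrightarrow> hd z = (0, 0))"

lemma is_rem_exists:
  assumes "homog (Suc n) c"
  obtains r where "is_rem (Suc n) c r"
proof -
  obtain q r where qr: "c = DY q + r" "homog (Suc n) q" "homog (Suc n) r"
    "\<And>z. lookup r z \<noteq> 0 \<Longrightarrow> hd z \<notin> range incy"
    using Y.division[of "\<lambda>_. True", OF _ assms] by metis
  obtain q' r' where qr': "r = DX q' + r'" "homog (Suc n) q'" "homog (Suc n) r'"
    "\<And>z. lookup r' z \<noteq> 0 \<Longrightarrow> hd z \<notin> range incy \<and> hd z \<notin> range incx"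
    using X.division[of "\<lambda>h. h \<notin> range incy", OF _ qr(3)] qr(4) incx_range_incy by metis
  have "hd z = (0, 0)" if "lookup r' z \<noteq> 0" for z
  proof -
    obtain s t where st: "hd z = (s, t)" by (cases "hd z")
    have "s = 0" using qr'(4)[OF that] st by (cases s) (auto simp: incx_def image_iff)
    moreover have "t = 0" using qr'(4)[OF that] st by (cases t) (auto simp: incy_def image_iff)
    ultimately show ?thesis using st by simp
  qed
  moreover have "c - r' \<in> shift_image (Suc n)"
    using shift_imageI[OF qr'(2) qr(2)] by (simp add: qr(1) qr'(1) add.commute)
  ultimately show ?thesis using that qr'(3) unfolding is_rem_def by blast
qed

lemma rem_zero:
  assumes "r \<in> shift_image (Suc n)" "homog (Suc n) r" "\<And>z. lookup r z \<noteq> 0 \<Longrightarrow> hd z = (0, 0)"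
  shows "r = 0"
proof -
  have no: "(0, 0) \<notin> range incx" "(0, 0) \<notin> range incy"
    by (auto simp: incx_def incy_def split: prod.splits)
  obtain a b where ab: "homog (Suc n) a" "homog (Suc n) b" "r = DX a + DY b"
    using assms(1) by (rule shift_imageE)
  obtain q s where qs: "a = DY q + s" "homog (Suc n) q" "homog (Suc n) s"
    "\<And>z. lookup s z \<noteq> 0 \<Longrightarrow> hd z \<notin> range incy"
    using Y.division[of "\<lambda>_. True", OF _ ab(1)] by metis
  have DXs: "lookup (DX s) (incy y # v) = 0" for y v by (rule lookup_DX_incy) (rule qs(4))
  have eq: "r = DY (DX q + b) + DX s" by (simp add: ab(3) qs(1) D_add DX_DY)
  let ?b = "DX q + b"
  have b: "homog (Suc n) ?b" by (intro homog_add homog_D qs(2) ab(2))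
  have r0: "lookup r (h # w) = 0" if "h \<noteq> (0, 0)" for h w using assms(3)[of "h # w"] that by auto
  have "0 dvd lookup ?b (x # w)" if "length w = n" for x w
  proof (rule Y.shift_coeff_inj[OF _ that])
    fix y v
    have "lookup r (incy y # v) = 0" using no by (intro r0) (metis rangeI)
    then have "lookup (DY ?b) (incy y # v) = 0"
      by (simp only: eq lookup_add DXs add_0_right)
    then show "0 dvd shift_coeff decy (incy y # v) (lookup ?b)" by (simp only: Y.lookup_D dvd_0_right)
  qed
  then have "lookup ?b z = 0" for z
    using homog_lookup[OF b, of z] by (cases z) auto
  then have "?b = 0" by (intro poly_mapping_eqI) simp
  then have r: "r = DX s" using eq by simp
  have "0 dvd lookup s (x # w)" if "length w = n" for x w
  proof (rule X.shift_coeff_inj[OF _ that])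
    fix y v
    have "lookup r (incx y # v) = 0" using no by (intro r0) (metis rangeI)
    then show "0 dvd shift_coeff decx (incx y # v) (lookup s)" by (simp only: r X.lookup_D dvd_0_right)
  qed
  then have "lookup s z = 0" for z
    using homog_lookup[OF qs(3), of z] by (cases z) auto
  then have "s = 0" by (intro poly_mapping_eqI) simp
  then show ?thesis using r by simp
qed

lemma is_rem_unique: "is_rem (Suc n) c r \<Longrightarrow> is_rem (Suc n) c r' \<Longrightarrow> r = r'"
proof -
  assume r: "is_rem (Suc n) c r" and r': "is_rem (Suc n) c r'"
  have "(c - r') - (c - r) \<in> shift_image (Suc n)"
    by (rule add_closed_diff[OF add_closed_shift_image]) (use r r' in \<open>simp_all add: is_rem_def\<close>)
  then have "r - r' \<in> shift_image (Suc n)" by simp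
  then have "r - r' = 0"
  proof (rule rem_zero)
    show "homog (Suc n) (r - r')" using r r' by (auto simp: is_rem_def intro: homog_diff)
    show "hd z = (0, 0)" if "lookup (r - r') z \<noteq> 0" for z
      using that r r' by (cases "lookup r z = 0") (auto simp: is_rem_def lookup_minus)
  qed
  then show ?thesis by simp
qed

definition remainder :: "nat \<Rightarrow> (nat \<times> nat) assoc \<Rightarrow> (nat \<times> nat) assoc"
  where "remainder n c = (THE r. is_rem n c r)"

lemma is_rem_remainder: "homog (Suc n) c \<Longrightarrow> is_rem (Suc n) c (remainder (Suc n) c)"
  unfolding remainder_def by (metis is_rem_exists is_rem_unique theI)

lemma remainder_add:
  assumes "homog (Suc n) c" "homog (Suc n) d"
  shows "remainder (Suc n) (c + d) = remainder (Suc n) c + remainder (Suc n) d"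
proof (rule is_rem_unique[OF is_rem_remainder])
  note c = is_rem_remainder[OF assms(1), unfolded is_rem_def]
    and d = is_rem_remainder[OF assms(2), unfolded is_rem_def]
  have "(c - remainder (Suc n) c) + (d - remainder (Suc n) d) \<in> shift_image (Suc n)"
    using c d by (intro add_closed_add[OF add_closed_shift_image]) simp_all
  then have "c + d - (remainder (Suc n) c + remainder (Suc n) d) \<in> shift_image (Suc n)"
    by (simp add: algebra_simps)
  moreover have "hd z = (0, 0)" if "lookup (remainder (Suc n) c + remainder (Suc n) d) z \<noteq> 0" for z
    using that c d by (cases "lookup (remainder (Suc n) c) z = 0") (auto simp: lookup_add)
  ultimately show "is_rem (Suc n) (c + d) (remainder (Suc n) c + remainder (Suc n) d)"
    unfolding is_rem_def using c d homog_add by blast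
qed (use assms homog_add in blast)

lemma remainder_eq_0_iff:
  assumes "homog (Suc n) c"
  shows "remainder (Suc n) c = 0 \<longleftrightarrow> c \<in> shift_image (Suc n)"
proof
  assume "remainder (Suc n) c = 0"
  then show "c \<in> shift_image (Suc n)" using is_rem_remainder[OF assms] by (simp add: is_rem_def)
next
  assume "c \<in> shift_image (Suc n)"
  then have "is_rem (Suc n) c 0" by (simp add: is_rem_def)
  then show "remainder (Suc n) c = 0" using is_rem_unique[OF is_rem_remainder[OF assms]] by blast
qed

section \<open>Torsion elements in prime degree\<close>

lemma shuffle_sum_replicate_replicate:
  "shuffle_sum f (replicate k a) (replicate l a) = int ((k + l) choose k) * f (replicate (k + l) a)"
proof (induction "k + l" arbitrary: k l f)
  case (Suc n)
  show ?case
  proof (cases k; cases l)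
    fix k' l' assume k: "k = Suc k'" "l = Suc l'"
    have "shuffle_sum f (replicate k a) (replicate l a)
      = shuffle_sum (\<lambda>w. f (a # w)) (replicate k' a) (replicate l a) + shuffle_sum (\<lambda>w. f (a # w)) (replicate k a) (replicate l' a)"
      using k by simp
    also have "\<dots> = int ((k' + l) choose k') * f (a # replicate (k' + l) a)
        + int ((k + l') choose k) * f (a # replicate (k + l') a)"
      using Suc.hyps(1)[of k' l "\<lambda>w. f (a # w)"] Suc.hyps(1)[of k l' "\<lambda>w. f (a # w)"] Suc.hyps(2) k
      by (simp only: add_Suc add_Suc_right)
    finally show ?thesis using k by (simp add: algebra_simps)
  qed simp_all
qed simp

text \<open>Proper shuffles of two powers of \<open>a\<close> give \<open>a\<^sup>p\<close> with a
  binomial coefficient that is divisible by \<open>p\<close>.\<close>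

lemma primitive_power:
  assumes "prime p"
  shows "primitive (int p) p (\<lambda>w. of_bool (w = replicate p a))"
  unfolding primitive_def
proof (intro allI impI)
  fix u v :: "'a list" assume uv: "u \<noteq> []" "v \<noteq> []" "length u + length v = p"
  let ?f = "\<lambda>w. of_bool (w = replicate p a) :: int"
  show "int p dvd shuffle_sum ?f u v"
  proof (cases "u = replicate (length u) a \<and> v = replicate (length v) a")
    case True
    have "0 < length u" "0 < length v" using uv by auto
    then have "p dvd (p choose length u)"
      using uv assms prime_gt_0_nat[OF assms] by (intro dvd_choose_prime) auto
    then have "int p dvd int (p choose length u)" by simp
    moreover have "shuffle_sum ?f u v = int (p choose length u) * ?f (replicate p a)"
      using True shuffle_sum_replicate_replicate[of ?f "length u" a "length v"] uv by metis
    ultimately show ?thesis by simp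
  next
    case False
    have "shuffle_sum ?f u v = shuffle_sum (\<lambda>w. 0) u v"
    proof (rule shuffle_sum_cong)
      fix w assume w: "mset w = mset u + mset v"
      have "w \<noteq> replicate p a"
      proof
        assume "w = replicate p a"
        then have "set u \<subseteq> {a} \<and> set v \<subseteq> {a}"
          using arg_cong[OF w, of set_mset] uv by (auto split: if_splits)
        then have "u = replicate (length u) a \<and> v = replicate (length v) a"
          by (auto intro!: replicate_eqI)
        with False show False by blast
      qed
      then show "?f w = 0" by simp
    qed
    then show ?thesis by simp
  qed
qed

lemma Dword_replicate:
  "Dword i (replicate n a) = (\<Sum>k<n. frag_of (replicate k a @ [i a] @ replicate (n - 1 - k) a))"
proof (induction n)
  case (Suc n)
  have "letter a * Dword i (replicate n a)
    = (\<Sum>k<n. frag_of (replicate (Suc k) a @ [i a] @ replicate (n - 1 - k) a))"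
    unfolding Suc sum_distrib_left by (simp add: letter_def frag_of_mult)
  then show ?case unfolding sum.lessThan_Suc_shift by simp
qed simp

context letter_shift
begin

lemma i_neq: "i a \<noteq> a"
  using weight[of a] by (metis n_not_Suc_n)

text \<open>Modulo \<open>p\<close> the power \<open>a\<^sup>p\<close> and hence its image under the
  derivation vanish on proper shuffles. Every word of this image contains the letter \<open>i
  a\<close> exactly once, so the Dynkin operator weighted by \<open>i a\<close> fixes it; but
  only one of its words begins with \<open>i a\<close>.\<close>

lemma left_normed_power:
  assumes "prime p"
  obtains c where "homog p c"
    "left_normed letter (i a # replicate (p - 1) a) = D i (frag_of (replicate p a)) + zmul (int p) c"
proof -
  have p: "0 < p" using assms prime_gt_0_nat by blast
  let ?c = "Dword i (replicate p a)"
  have hom: "homog p ?c" using homog_Dword[of "replicate p a" i] by simp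
  have prim: "primitive (int p) p (lookup ?c)"
    unfolding primitive_def
  proof (intro allI impI)
    fix u v :: "'v list" assume uv: "u \<noteq> []" "v \<noteq> []" "length u + length v = p"
    let ?f = "\<lambda>w. of_bool (w = replicate p a) :: int"
    have "int p dvd shuffle_sum ?f u' v'" if "length u' = length u" "length v' = length v" for u' v'
      using primitive_power[OF assms, of a] uv that unfolding primitive_def
      by (metis length_0_conv)
    then have "int p dvd shift_coeff e u (\<lambda>u'. shuffle_sum ?f u' v) + shift_coeff e v (\<lambda>v'. shuffle_sum ?f u v')"
      by (intro dvd_add shift_coeff_dvd) simp_all
    then show "int p dvd shuffle_sum (lookup ?c) u v"
      unfolding shuffle_sum_shift_coeff[symmetric] lookup_Dword[symmetric] .
  qed
  have count: "length (filter ((=) (i a)) w) = 1" if nz: "lookup ?c w \<noteq> 0" for w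
  proof -
    obtain k where "w = replicate k a @ [i a] @ replicate (p - 1 - k) a"
      using nz unfolding Dword_replicate lookup_sum
      by (metis (mono_tags, lifting) lookup_frag_of sum.neutral)
    then show ?thesis using i_neq[of a] by simp
  qed
  obtain c where c: "weighted_dynkin ((=) (i a)) ?c = zmul (int 1) ?c + zmul (int p) c" "homog p c"
    by (rule weighted_dynkin_content[OF prim hom p count])
  obtain q where q: "p = Suc q" using p by (cases p) auto
  have "weighted_dynkin ((=) (i a)) ?c = left_normed letter (i a # replicate q a)"
    unfolding weighted_dynkin_def q replicate_Suc Dword.simps lin_add lin_letter_mult
    using i_neq[of a] by (simp add: lin_def)
  with c q that show ?thesis by (simp add: D_frag_of)
qed

end

locale prime_degree =
  fixes p :: nat
  assumes p: "prime p"
begin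

abbreviation "L \<equiv> lie_elts p :: (nat \<times> nat) assoc set"

lemma p_gt: "0 < p" "1 < p" "2 \<le> p"
  using p prime_gt_0_nat prime_gt_1_nat prime_ge_2_nat by blast+

lemma p_Suc: "p = Suc (p - 1)" using p_gt by simp

definition powers :: "(nat \<times> nat \<Rightarrow>\<^sub>0 int) \<Rightarrow> (nat \<times> nat) assoc"
  where "powers = lin (\<lambda>v. frag_of (replicate p v))"

definition adx :: "nat \<times> nat \<Rightarrow> (nat \<times> nat) assoc"
  where "adx v = left_normed letter (incx v # replicate (p - 1) v)"
definition ady :: "nat \<times> nat \<Rightarrow> (nat \<times> nat) assoc"
  where "ady v = left_normed letter (incy v # replicate (p - 1) v)"

text \<open>By \<open>left_normed_power\<close> the Lie elements \<open>adx v\<close> and \<open>ady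
  v\<close> are the shifts of the power \<open>v\<^sup>p\<close> up to \<open>p\<close> times
  the following elements, which need not be Lie elements.\<close>

definition ex :: "nat \<times> nat \<Rightarrow> (nat \<times> nat) assoc"
  where "ex v = (SOME c. homog p c \<and> adx v = DX (frag_of (replicate p v)) + zmul (int p) c)"
definition ey :: "nat \<times> nat \<Rightarrow> (nat \<times> nat) assoc"
  where "ey v = (SOME c. homog p c \<and> ady v = DY (frag_of (replicate p v)) + zmul (int p) c)"

lemma ex: "homog p (ex v)" "adx v = DX (frag_of (replicate p v)) + zmul (int p) (ex v)"
proof -
  have "\<exists>c. homog p c \<and> adx v = DX (frag_of (replicate p v)) + zmul (int p) c"
    using X.left_normed_power[OF p, of v] unfolding adx_def by metis
  from someI_ex[OF this] show "homog p (ex v)" "adx v = DX (frag_of (replicate p v)) + zmul (int p) (ex v)"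
    by (simp_all add: ex_def)
qed

lemma ey: "homog p (ey v)" "ady v = DY (frag_of (replicate p v)) + zmul (int p) (ey v)"
proof -
  have "\<exists>c. homog p c \<and> ady v = DY (frag_of (replicate p v)) + zmul (int p) c"
    using Y.left_normed_power[OF p, of v] unfolding ady_def by metis
  from someI_ex[OF this] show "homog p (ey v)" "ady v = DY (frag_of (replicate p v)) + zmul (int p) (ey v)"
    by (simp_all add: ey_def)
qed

text \<open>Since \<open>DX\<close> and \<open>DY\<close> commute, the contributions of
  \<open>v\<^sup>p\<close> to \<open>DX (ady v) - DY (adx v)\<close> cancel and what is left
  is \<open>p\<close> times this element (\<open>p_tau\<close>).\<close>

definition tau :: "nat \<times> nat \<Rightarrow> (nat \<times> nat) assoc" where "tau v = DX (ey v) - DY (ex v)"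

lemma p_tau: "zmul (int p) (tau v) = DX (ady v) - DY (adx v)"
  unfolding tau_def ex(2) ey(2)
  by (simp add: D_add D_zmul zmul_diff_right DX_DY[of "frag_of (replicate p v)"] del: D_frag_of)

lemma ad_in_L: "adx v \<in> L" "ady v \<in> L"
  unfolding adx_def ady_def by (rule left_normed_in_lie_elts, use p_gt in simp)+

lemma homog_tau: "homog p (tau v)"
  unfolding tau_def by (intro homog_diff homog_D ex ey)

text \<open>Vanishing on shuffles is not affected by integer factors.\<close>

lemma L_saturated:
  assumes "zmul k c \<in> L" "k \<noteq> 0" "homog p c"
  shows "c \<in> L"
proof (rule lie_elts_if_primitive[OF p _ assms(3)])
  show "primitive 0 p (lookup c)" unfolding primitive_def
  proof (intro allI impI)
    fix u v :: "(nat \<times> nat) list" assume "u \<noteq> []" "v \<noteq> []"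
    then have "shuffle_sum (lookup (zmul k c)) u v = 0" by (rule shuffle_sum_lie_elts[OF assms(1)])
    moreover have "lookup (zmul k c) = (\<lambda>w. k * lookup c w)" by (simp add: fun_eq_iff)
    ultimately show "0 dvd shuffle_sum (lookup c) u v" using assms(2) by (simp add: shuffle_sum_mult)
  qed
qed

lemma primitive_L: "c \<in> L \<Longrightarrow> primitive m p (lookup c)"
  by (simp add: primitive_def shuffle_sum_lie_elts)

lemma L_if_DY: "DY c \<in> L \<Longrightarrow> homog p c \<Longrightarrow> c \<in> L"
  using lie_elts_if_primitive[OF p] Y.primitive_D[OF primitive_L p_gt(1)] by blast

lemma tau_in_L: "tau v \<in> L"
proof (rule L_saturated[of "int p"])
  show "zmul (int p) (tau v) \<in> L" unfolding p_tau
    by (intro add_closed_diff[OF add_closed_lie_elts] D_lie_elts ad_in_L)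
qed (use p_gt homog_tau in auto)

definition L_image :: "(nat \<times> nat) assoc set"
  where "L_image = {a + b | a b. a \<in> DX ` L \<and> b \<in> DY ` L}"

lemma add_closed_L_image: "add_closed L_image"
  unfolding L_image_def
  by (rule add_closed_set_plus[OF add_closed_image[OF additive_D add_closed_lie_elts]
        add_closed_image[OF additive_D add_closed_lie_elts]])

lemma L_imageI: "a \<in> L \<Longrightarrow> b \<in> L \<Longrightarrow> DX a + DY b \<in> L_image"
  unfolding L_image_def by blast

lemma L_imageE:
  assumes "c \<in> L_image" obtains a b where "a \<in> L" "b \<in> L" "c = DX a + DY b"
  using assms unfolding L_image_def by blast

lemma L_image_subset: "c \<in> L_image \<Longrightarrow> c \<in> L" "c \<in> L_image \<Longrightarrow> c \<in> shift_image p"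
  by (auto elim!: L_imageE intro!: add_closed_add[OF add_closed_lie_elts] D_lie_elts
      shift_imageI homog_lie_elts)

lemma p_tau_in_L_image: "zmul (int p) (tau v) \<in> L_image"
  using L_imageI[OF ad_in_L(2) add_closed_minus[OF add_closed_lie_elts ad_in_L(1)], of v v]
  by (simp add: p_tau D_minus)

lemma tau_in_shift_image: "tau v \<in> shift_image p"
  using shift_imageI[OF ey(1) homog_minus[OF ex(1)], of v v] by (simp add: tau_def D_minus)

lemma dynkin_L: "w \<in> L \<Longrightarrow> lin (left_normed letter) w = zmul (int p) w"
proof -
  assume "w \<in> L"
  then obtain c where c: "homog p c" "w = lin (left_normed letter) c" unfolding lie_elts_def by blast
  have "lin (left_normed letter) w = iota (lin bracket (iota (lin bracket c)))" by (simp add: iota_lin c)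
  also have "\<dots> = iota (zmul (int p) (lin bracket c))" by (simp only: dynkin[OF c(1)])
  also have "\<dots> = zmul (int p) (iota (lin bracket c))" by (rule additive_zmul[OF additive_iota])
  also have "\<dots> = zmul (int p) w" by (simp only: iota_lin c(2))
  finally show ?thesis .
qed

lemma DX_powers: "DX (powers \<nu>) = lin adx \<nu> - zmul (int p) (lin ex \<nu>)"
proof -
  have "DX (powers \<nu>) = lin (\<lambda>v. adx v - zmul (int p) (ex v)) \<nu>"
    unfolding powers_def additive_lin_comp[OF additive_D] by (simp add: ex(2) del: D_frag_of)
  also have "\<dots> = lin adx \<nu> - lin (\<lambda>v. zmul (int p) (ex v)) \<nu>"
    by (simp add: lin_def zmul_diff_right sum_subtractf)
  finally show ?thesis by (simp add: additive_lin_comp[OF additive_zmul_right])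
qed

lemma DY_powers: "DY (powers \<nu>) = lin ady \<nu> - zmul (int p) (lin ey \<nu>)"
proof -
  have "DY (powers \<nu>) = lin (\<lambda>v. ady v - zmul (int p) (ey v)) \<nu>"
    unfolding powers_def additive_lin_comp[OF additive_D] by (simp add: ey(2) del: D_frag_of)
  also have "\<dots> = lin ady \<nu> - lin (\<lambda>v. zmul (int p) (ey v)) \<nu>"
    by (simp add: lin_def zmul_diff_right sum_subtractf)
  finally show ?thesis by (simp add: additive_lin_comp[OF additive_zmul_right])
qed

lemma lin_tau: "lin tau \<nu> = DX (lin ey \<nu>) - DY (lin ex \<nu>)"
  unfolding additive_lin_comp[OF additive_D]
  by (simp add: tau_def[abs_def] lin_def zmul_diff_right sum_subtractf)

lemma homog_lin_e: "homog p (lin ex \<nu>)" "homog p (lin ey \<nu>)"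
  by (rule homog_lin, rule ex, rule homog_lin, rule ey)

lemma lin_ad_in_L: "lin adx \<nu> \<in> L" "lin ady \<nu> \<in> L"
  by (rule add_closed_lin[OF add_closed_lie_elts], rule ad_in_L)+

text \<open>The idea is to make the coefficients \<open>a\<close> and \<open>b\<close> in \<open>w = DX
  a + DY b\<close> Lie elements. The Dynkin operator \<open>\<delta>\<close> does so at the
  price of a factor \<open>p\<close>. Modulo \<open>p\<close> the resulting relation is
  trivial, \<open>\<delta> a = DY c\<close> and \<open>\<delta> b = - DX c\<close>, with
  \<open>c\<close> primitive modulo \<open>p\<close>; the shifts of the Lie part of
  \<open>c\<close> are Lie elements again, and its part in the powers of letters is what the
  elements \<open>tau v\<close> account for.\<close>

lemma tau_spans:
  assumes w: "w \<in> L" "w \<in> shift_image p"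
  obtains \<nu> where "w - lin tau \<nu> \<in> L_image"
proof -
  let ?P = "zmul (int p)" and ?\<delta> = "lin (left_normed letter)"
  obtain a b where ab: "homog p a" "homog p b" "w = DX a + DY b" using w(2) by (rule shift_imageE)
  have \<delta>: "?\<delta> a \<in> L" "?\<delta> b \<in> L" using ab unfolding lie_elts_def by blast+
  have pw: "?P w = DX (?\<delta> a) + DY (?\<delta> b)"
    by (simp only: dynkin_L[OF w(1), symmetric] D_lin_left_normed flip: lin_add ab(3))
  have "int p dvd lookup (DX (?\<delta> a) + DY (?\<delta> b)) z" for z by (simp flip: pw)
  then obtain c a' b' where c: "homog p c" "homog p a'" "homog p b'"
    "?\<delta> a = DY c + ?P a'" "?\<delta> b = - DX c + ?P b'"
    using koszul_exact[of "p - 1" "?\<delta> a" "?\<delta> b" "int p"] homog_lie_elts[OF \<delta>(1)] homog_lie_elts[OF \<delta>(2)]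
    unfolding p_Suc[symmetric] by blast
  have "?P w = ?P (DX a' + DY b')"
    unfolding pw c(4,5) by (simp add: D_add D_diff D_zmul DX_DY zmul_add_right)
  then have "?P (w - (DX a' + DY b')) = 0" by (simp add: zmul_diff_right)
  then have w': "w = DX a' + DY b'" using p_gt by (simp add: zmul_frag_eq_0)
  have "primitive (int p) p (lookup (DY c))"
    unfolding primitive_def
  proof (intro allI impI)
    fix u v :: "(nat \<times> nat) list" assume uv: "u \<noteq> []" "v \<noteq> []"
    have "lookup (DY c) = (\<lambda>z. lookup (?\<delta> a) z - int p * lookup a' z)"
      by (simp add: fun_eq_iff c(4) lookup_add)
    then show "int p dvd shuffle_sum (lookup (DY c)) u v"
      by (simp add: shuffle_sum_diff shuffle_sum_mult shuffle_sum_lie_elts[OF \<delta>(1) uv])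
  qed
  then have "primitive (int p) p (lookup c)" by (rule Y.primitive_D) (rule p_gt)
  then obtain l \<nu> e where l: "l \<in> L" "homog p e" "c = l + powers \<nu> + ?P e"
    using lie_elts_if_primitive_mod[OF p _ c(1)] unfolding powers_def by blast
  \<comment> \<open>The multiple of \<open>p\<close> in \<open>c\<close> and the defects \<open>ex\<close>, \<open>ey\<close> of its powers are moved into the coefficients
    of \<open>w\<close>, which makes these Lie elements.\<close>
  let ?A = "a' + DY e - lin ey \<nu>" and ?B = "b' - DX e + lin ex \<nu>"
  have "?P ?A = ?\<delta> a - DY l - lin ady \<nu>"
    unfolding c(4) l(3) by (simp add: D_add D_zmul DY_powers zmul_add_right zmul_diff_right algebra_simps)
  moreover have "?\<delta> a - DY l - lin ady \<nu> \<in> L"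
    by (intro add_closed_diff[OF add_closed_lie_elts] D_lie_elts l lin_ad_in_L \<delta>)
  ultimately have PA: "?P ?A \<in> L" by (simp only:)
  have "homog p ?A" by (intro homog_diff homog_add homog_D homog_lin_e c l)
  then have A: "?A \<in> L" by (rule L_saturated[OF PA, rotated]) (use p_gt in simp)
  have "?P ?B = ?\<delta> b + DX l + lin adx \<nu>"
    unfolding c(5) l(3) by (simp add: D_add D_zmul DX_powers zmul_add_right zmul_diff_right algebra_simps)
  moreover have "?\<delta> b + DX l + lin adx \<nu> \<in> L"
    by (intro add_closed_add[OF add_closed_lie_elts] D_lie_elts l lin_ad_in_L \<delta>)
  ultimately have PB: "?P ?B \<in> L" by (simp only:)
  have "homog p ?B" by (intro homog_diff homog_add homog_D homog_lin_e c l)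
  then have B: "?B \<in> L" by (rule L_saturated[OF PB, rotated]) (use p_gt in simp)
  have "w - lin tau \<nu> = DX ?A + DY ?B"
    unfolding w' lin_tau by (simp add: D_add D_diff DX_DY algebra_simps)
  then have "w - lin tau \<nu> \<in> L_image" using L_imageI[OF A B] by (simp only:)
  then show ?thesis by (rule that)
qed

text \<open>The shuffles of \<open>v\<close> with \<open>v\<^sup>p\<^sup>-\<^sup>1\<close> are
  \<open>p\<close> copies of \<open>v\<^sup>p\<close>.\<close>

lemma L_power_coefficient: "c \<in> L \<Longrightarrow> lookup c (replicate p v) = 0"
proof -
  assume c: "c \<in> L"
  have "replicate (p - 1) v \<noteq> []" using p_gt by simp
  from shuffle_sum_lie_elts[OF c _ this, of "[v]"] show ?thesis
    using p_gt by (simp add: shuffle_sum_replicate flip: p_Suc)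
qed

lemma lookup_powers: "lookup (powers \<nu>) (replicate p v) = lookup \<nu> v"
proof -
  have "replicate p a = replicate p v \<longleftrightarrow> a = v" for a using p_gt by simp
  then have "lookup (powers \<nu>) (replicate p v) = lookup (lin frag_of \<nu>) v"
    unfolding powers_def lookup_lin using p_gt by (simp add: eq_commute[of v])
  then show ?thesis by (simp add: lin_expansion)
qed

text \<open>A relation is an equation between images under the two shifts, so it comes from an element
  \<open>c\<close> by exactness. Then \<open>DY\<close> of \<open>p c\<close> plus the powers
  with coefficients \<open>\<nu>\<close> is a Lie element, and so is this sum itself; but Lie
  elements have no powers of letters.\<close>

lemma tau_independent:
  assumes "lin tau \<nu> \<in> L_image"
  shows "int p dvd lookup \<nu> v"
proof -
  let ?P = "zmul (int p)"
  obtain A B where AB: "A \<in> L" "B \<in> L" "lin tau \<nu> = DX A + DY B" using assms by (rule L_imageE)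
  let ?a = "lin ey \<nu> - A" and ?b = "- lin ex \<nu> - B"
  have hom: "homog p ?a" "homog p ?b"
    by (intro homog_diff homog_minus homog_lin_e homog_lie_elts AB)+
  have "DX ?a + DY ?b = 0" using AB(3) unfolding lin_tau by (simp add: D_diff D_minus algebra_simps)
  then have "0 dvd lookup (DX ?a + DY ?b) z" for z by simp
  then obtain c where c: "homog p c" "?a = DY c"
    using koszul_exact[of "p - 1" ?a ?b 0] hom unfolding p_Suc[symmetric] by (metis add_0_right zmul_0)
  have "DY (?P c + powers \<nu>) = lin ady \<nu> - ?P A"
    by (simp add: D_add D_zmul DY_powers zmul_diff_right flip: c(2))
  also have "\<dots> \<in> L"
    by (intro add_closed_diff[OF add_closed_lie_elts] lin_ad_in_L add_closed_zmul[OF add_closed_lie_elts] AB)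
  finally have "?P c + powers \<nu> \<in> L"
    by (rule L_if_DY) (auto simp: powers_def homog_frag_of intro!: homog_add homog_zmul c homog_lin)
  from L_power_coefficient[OF this, of v] have "int p * lookup c (replicate p v) + lookup \<nu> v = 0"
    by (simp add: lookup_add lookup_powers)
  then have "lookup \<nu> v = int p * - lookup c (replicate p v)" by simp
  then show ?thesis by (rule dvdI)
qed

lemma lin_left_normed_Dword:
  "lin (left_normed g) (Dword i (b # replicate n v)) = left_normed g (i b # replicate n v)
    + (\<Sum>k<n. left_normed g (b # replicate k v @ [i v] @ replicate (n - 1 - k) v))"
  by (simp add: lin_add lin_letter_mult Dword_replicate additive.sum[OF additive_lin])

text \<open>By the product rule; the terms in which the first letter is shifted twice occur on both
  sides and cancel.\<close>

lemma tau_formula: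
  "zmul (int p) (tau v) =
    (\<Sum>i = 0..p - 2. left_normed letter (incy v # replicate i v @ [incx v] @ replicate (p - 2 - i) v)
      - left_normed letter (incx v # replicate i v @ [incy v] @ replicate (p - 2 - i) v))"
proof -
  have range: "{0..p - 2} = {..<p - 1}" using p_gt by auto
  have "p - 1 - 1 - k = p - 2 - k" for k by simp
  then show ?thesis unfolding p_tau adx_def ady_def D_left_normed lin_left_normed_Dword incx_incy range
    by (simp add: sum_subtractf)
qed

end

section \<open>The factor as Lie elements modulo shifts\<close>

lemma left_normed_in_lie_ge: "left_normed g w \<in> lie_ge (length w)"
proof (induction w rule: rev_induct)
  case (snoc b w)
  show ?case
  proof (cases "w = []")
    case True
    then show ?thesis using lie_ge_1 by simp
  next
    case False
    then show ?thesis using lie_ge_lie[OF snoc] by (simp add: left_normed_snoc)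
  qed
qed (simp add: add_closed_0[OF add_closed_lie_ge])

text \<open>Replacing the factors by their leading terms changes a product only in higher degree.\<close>

lemma left_normed_approx:
  assumes "\<And>v. v \<in> set w \<Longrightarrow> g v - free_gen (k v) \<in> lie_ge 2"
  shows "left_normed g w - bracket (map k w) \<in> lie_ge (Suc (length w))"
  using assms
proof (induction w rule: rev_induct)
  case (snoc b w)
  have gb: "g b - free_gen (k b) \<in> lie_ge 2" using snoc.prems by simp
  show ?case
  proof (cases "w = []")
    case True
    then show ?thesis using gb by (simp add: numeral_2_eq_2)
  next
    case False
    have IH: "left_normed g w - bracket (map k w) \<in> lie_ge (Suc (length w))" by (rule snoc.IH) (use snoc.prems in simp)
    have eq: "left_normed g (w @ [b]) - bracket (map k (w @ [b])) =
      lie (left_normed g w - bracket (map k w)) (g b) + lie (bracket (map k w)) (g b - free_gen (k b))"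
      using False by (simp add: left_normed_snoc lie_diff_left lie_diff_right)
    have "lie (bracket (map k w)) (g b - free_gen (k b)) \<in> lie_ge (length w + 2)"
      using lie_ge_lie_ge[OF bracket_in_lie_ge[of "length w" "map k w"] gb] by simp
    then show ?thesis unfolding eq
      using lie_ge_lie[OF IH] by (intro add_closed_add[OF add_closed_lie_ge]) simp_all
  qed
qed (simp add: add_closed_0[OF add_closed_lie_ge])

lemma top_part_left_normed:
  assumes "\<And>v. v \<in> set w \<Longrightarrow> g v - free_gen (k v) \<in> lie_ge 2" "length w = n"
  shows "top_part n (left_normed g w) = left_normed letter (map k w)"
proof -
  have "left_normed g w - bracket (map k w) \<in> lie_ge (Suc n)" using left_normed_approx[of w g k, OF assms(1)] assms(2) by simp
  from top_part_Suc[OF this] show ?thesis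
    using assms(2) by (simp add: additive.diff[OF additive_top_part] top_part_bracket)
qed

locale free_rank_two = prime_degree p for p +
  fixes x y :: "'a::lie_ring"
  assumes free: "free_generators (case_bool x y)"
begin

definition rank_two_map :: "bool free_lie \<Rightarrow> 'a" where "rank_two_map = free_lie_lift (case_bool x y)"

lemma lie_hom_rank_two_map: "lie_hom rank_two_map" unfolding rank_two_map_def by (rule free_lie_lift_hom)
lemma rank_two_map_gen: "rank_two_map (free_gen True) = x" "rank_two_map (free_gen False) = y"
  by (simp_all add: rank_two_map_def free_lie_lift_gen)
lemma bij_rank_two_map: "bij rank_two_map" using free by (simp add: rank_two_map_def free_generators_def)

lemma lamE: obtains f where "a = rank_two_map f"
  using bij_is_surj[OF bij_rank_two_map] by (metis surjD)

lemma rank_two_induct [case_names x y zero neg add br]: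
  assumes "P x" "P y" "P 0" "\<And>a. P a \<Longrightarrow> P (- a)"
    "\<And>a b. P a \<Longrightarrow> P b \<Longrightarrow> P (a + b)" "\<And>a b. P a \<Longrightarrow> P b \<Longrightarrow> P (lie a b)"
  shows "P a"
proof -
  have "P (rank_two_map f)" for f
  proof (induction f rule: free_lie_induct)
    case (gen v)
    then show ?case using assms(1,2) by (cases v) (simp_all add: rank_two_map_gen)
  qed (simp_all add: assms lie_hom_zero[OF lie_hom_rank_two_map] lie_hom_minus[OF lie_hom_rank_two_map]
      additive.add[OF lie_hom_additive[OF lie_hom_rank_two_map]] lie_hom_lie[OF lie_hom_rank_two_map])
  then show ?thesis by (metis lamE)
qed

lemma torsion_free: "zmul k (a :: 'a) = 0 \<Longrightarrow> k \<noteq> 0 \<Longrightarrow> a = 0"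
proof -
  assume k: "zmul k a = 0" "k \<noteq> 0"
  obtain f where a: "a = rank_two_map f" by (rule lamE)
  have "rank_two_map (zmul k f) = rank_two_map 0"
    using k(1) by (simp add: a additive_zmul[OF lie_hom_additive[OF lie_hom_rank_two_map]] lie_hom_zero[OF lie_hom_rank_two_map])
  then have "zmul k f = 0" using bij_is_inj[OF bij_rank_two_map] by (simp add: inj_eq)
  then have "f = 0" using k(2) by (rule free_lie_torsion_free)
  then show "a = 0" by (simp add: a lie_hom_zero[OF lie_hom_rank_two_map])
qed

abbreviation "U \<equiv> u_map x y"

lemma U_kernel: "U f = 0 \<Longrightarrow> f = 0"
proof -
  assume f: "U f = 0"
  let ?V = "u_map (free_gen True) (free_gen False :: bool free_lie)"
  have "rank_two_map (u_elem (free_gen True) (free_gen False) s t) = u_elem x y s t" for s t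
    by (simp add: u_elem_def lie_hom_lie_products[OF lie_hom_rank_two_map] rank_two_map_gen)
  then have "(\<lambda>f. rank_two_map (?V f)) = free_lie_lift (\<lambda>(s, t). u_elem x y s t)"
    by (intro lie_hom_free_unique[OF lie_hom_comp[OF lie_hom_rank_two_map lie_hom_u_map]]) (auto simp: u_map_gen)
  then have "rank_two_map (?V f) = rank_two_map 0"
    using f unfolding u_map_def[of x y] by (metis lie_hom_zero[OF lie_hom_rank_two_map])
  then have "?V f = 0" using bij_is_inj[OF bij_rank_two_map] by (simp add: inj_eq)
  then show "f = 0" by (rule u_map_free_inj)
qed

lemma inj_U: "inj U"
proof (rule injI)
  fix f g assume "U f = U g"
  then have "U (f - g) = 0" by (simp add: additive.diff[OF additive_u_map])
  from U_kernel[OF this] show "f = g" by simp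
qed

lemma dy_exists:
  "\<exists>d. derivation d \<and> (\<forall>f. lie (U f) y = U (d f)) \<and> (\<forall>v. d (free_gen v) = free_gen (incy v))"
proof -
  obtain d :: "(nat \<times> nat) free_lie \<Rightarrow> (nat \<times> nat) free_lie" where
    d: "derivation d" "\<And>v. d (free_gen v) = free_gen (incy v)"
    by (rule derivation_extends[of "\<lambda>v. free_gen (incy v)"]) (rule that)
  have "lie (U f) y = U (d f)" for f
    by (rule hom_derivation[OF lie_hom_u_map d(1)])
      (auto simp: d(2) incy_def u_map_gen u_elem_Suc_right split: prod.split)
  with d show ?thesis by blast
qed

definition dy where "dy = (SOME d. derivation d \<and> (\<forall>f. lie (U f) y = U (d f))
  \<and> (\<forall>v. d (free_gen v) = free_gen (incy v)))"

lemma dy: "derivation dy" "lie (U f) y = U (dy f)" "dy (free_gen v) = free_gen (incy v)"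
  using someI_ex[OF dy_exists] unfolding dy_def[symmetric] by blast+

text \<open>The bracket of \<open>u_elem x y s t\<close> with \<open>x\<close> in terms of the free
  generators, from \<open>[u, y, x] = [u, x, y] + [u, [y, x]]\<close>.\<close>

primrec dx_gen :: "nat \<Rightarrow> nat \<Rightarrow> (nat \<times> nat) free_lie" where
  "dx_gen s 0 = free_gen (Suc s, 0)"
| "dx_gen s (Suc t) = dy (dx_gen s t) + lie (free_gen (s, t)) (free_gen (0, 0))"

lemma dx_gen_approx: "dx_gen s t - free_gen (Suc s, t) \<in> lie_ge 2"
proof (induction t)
  case (Suc t)
  have eq: "dx_gen s (Suc t) - free_gen (Suc s, Suc t) =
      dy (dx_gen s t - free_gen (Suc s, t)) + lie (free_gen (s, t)) (free_gen (0, 0))"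
    by (simp add: additive.diff[OF derivation_additive[OF dy(1)]] dy(3) incy_def)
  have "lie (free_gen (s, t)) (free_gen (0, 0)) \<in> lie_ge 2"
    using lie_ge_lie[OF lie_ge_1] by (simp add: numeral_2_eq_2)
  with lie_ge_derivation[OF dy(1) Suc] show ?case
    unfolding eq by (rule add_closed_add[OF add_closed_lie_ge])
qed (simp add: add_closed_0[OF add_closed_lie_ge])

lemma U_dx_gen: "lie (u_elem x y s t) x = U (dx_gen s t)"
proof (induction t)
  case 0
  then show ?case by (simp add: u_map_gen flip: u_elem_Suc_left)
next
  case (Suc t)
  have "lie (u_elem x y s (Suc t)) x = lie (lie (u_elem x y s t) x) y + lie (u_elem x y s t) (lie y x)"
    by (simp add: u_elem_Suc_right lie_leibniz[of _ y x])
  also have "\<dots> = U (dy (dx_gen s t)) + lie (U (free_gen (s, t))) (U (free_gen (0, 0)))"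
    by (simp add: Suc dy(2) u_map_gen u_elem_0_0)
  also have "\<dots> = U (dx_gen s (Suc t))"
    by (simp add: additive.add[OF additive_u_map] lie_hom_lie[OF lie_hom_u_map])
  finally show ?case .
qed

lemma dx_exists:
  "\<exists>d. derivation d \<and> (\<forall>f. lie (U f) x = U (d f)) \<and> (\<forall>v. d (free_gen v) - free_gen (incx v) \<in> lie_ge 2)"
proof -
  obtain d :: "(nat \<times> nat) free_lie \<Rightarrow> (nat \<times> nat) free_lie" where
    d: "derivation d" "\<And>v. d (free_gen v) = dx_gen (fst v) (snd v)"
    by (rule derivation_extends[of "\<lambda>v. dx_gen (fst v) (snd v)"]) (rule that)
  have "lie (U f) x = U (d f)" for f
  proof (rule hom_derivation[OF lie_hom_u_map d(1)])
    fix v :: "nat \<times> nat"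
    show "lie (U (free_gen v)) x = U (d (free_gen v))"
      using U_dx_gen[of "fst v" "snd v"] by (cases v) (simp add: d(2) u_map_gen)
  qed
  moreover have "d (free_gen v) - free_gen (incx v) \<in> lie_ge 2" for v
    using dx_gen_approx by (cases v) (simp add: d(2) incx_def)
  ultimately show ?thesis using d(1) by blast
qed

definition dx where "dx = (SOME d. derivation d \<and> (\<forall>f. lie (U f) x = U (d f))
  \<and> (\<forall>v. d (free_gen v) - free_gen (incx v) \<in> lie_ge 2))"

lemma dx: "derivation dx" "lie (U f) x = U (dx f)" "dx (free_gen v) - free_gen (incx v) \<in> lie_ge 2"
  using someI_ex[OF dx_exists] unfolding dx_def[symmetric] by blast+

lemma dy_approx: "dy (free_gen v) - free_gen (incy v) \<in> lie_ge 2"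
  by (simp add: dy(3) add_closed_0[OF add_closed_lie_ge])

lemma range_U_closed: "add_closed (range U)"
  by (rule add_closed_image[OF additive_u_map add_closed_UNIV])

text \<open>It suffices to bracket with \<open>x\<close> and \<open>y\<close>, where the bracket is a
  derivation of the free Lie ring on pairs.\<close>

lemma range_U_ideal: "a \<in> range U \<Longrightarrow> lie a b \<in> range U"
proof (induction b arbitrary: a rule: rank_two_induct)
  case x
  then show ?case using dx(2) by blast
next
  case y
  then show ?case using dy(2) by blast
next
  case (br b c)
  then have "lie (lie a b) c - lie (lie a c) b \<in> range U"
    by (intro add_closed_diff[OF range_U_closed]) blast+
  then show ?case by (simp only: lie_lie_right)
qed (simp_all add: lie_minus_right lie_add_right add_closed_0[OF range_U_closed]
    add_closed_minus[OF range_U_closed] add_closed_add[OF range_U_closed])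

lemma lie_yx: "lie y x \<in> range U" "lie x y \<in> range U"
proof -
  have "lie y x = U (free_gen (0, 0))" by (simp add: u_map_gen u_elem_0_0)
  then show "lie y x \<in> range U" by blast
  then have "- lie y x \<in> range U" by (rule add_closed_minus[OF range_U_closed])
  then show "lie x y \<in> range U" using lie_anti[of x y] by simp
qed

lemma lie_gen_range_U: "lie x b \<in> range U" "lie y b \<in> range U"
proof -
  have "lie g b \<in> range U" if g: "lie g x \<in> range U" "lie g y \<in> range U" for g
  proof (induction b rule: rank_two_induct)
    case (br b c)
    have "lie (lie g b) c - lie (lie g c) b \<in> range U"
      by (rule add_closed_diff[OF range_U_closed range_U_ideal[OF br(1)] range_U_ideal[OF br(2)]])
    then show ?case by (simp only: lie_lie_right)
  qed (simp_all add: g lie_minus_right lie_add_right add_closed_0[OF range_U_closed]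
      add_closed_minus[OF range_U_closed] add_closed_add[OF range_U_closed])
  then show "lie x b \<in> range U" "lie y b \<in> range U"
    using lie_yx by (simp_all add: lie_self add_closed_0[OF range_U_closed])
qed

lemma lie_range_U: "lie a b \<in> range U"
proof (induction a arbitrary: b rule: rank_two_induct)
  case (br a c)
  show ?case by (rule range_U_ideal) (rule br(1))
qed (simp_all add: lie_gen_range_U lie_minus_left lie_add_left add_closed_0[OF range_U_closed]
    add_closed_minus[OF range_U_closed] add_closed_add[OF range_U_closed])

lemma derived_ideal_eq: "(derived_ideal :: 'a set) = range U"
proof
  show "(derived_ideal :: 'a set) \<subseteq> range U"
    unfolding derived_ideal_def by (rule lie_prod_subset[OF range_U_closed]) (rule lie_range_U)
  have lie_in: "lie a b \<in> (derived_ideal :: 'a set)" for a b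
    unfolding derived_ideal_def by (rule lie_in_lie_prod) simp_all
  have closed: "add_closed (derived_ideal :: 'a set)"
    unfolding derived_ideal_def by (rule add_closed_lie_prod)
  have "U f \<in> derived_ideal" for f
  proof (induction f rule: free_lie_induct)
    case (gen v)
    obtain s t where v: "v = (s, t)" by (cases v)
    show ?case
    proof (cases t)
      case 0
      then show ?thesis
        by (cases s) (simp_all add: v u_map_gen u_elem_0_0 u_elem_Suc_left lie_in)
    qed (simp add: v u_map_gen u_elem_Suc_right lie_in)
  qed (simp_all add: lie_hom_lie[OF lie_hom_u_map] lie_in lie_hom_zero[OF lie_hom_u_map]
      lie_hom_minus[OF lie_hom_u_map] additive.add[OF additive_u_map]
      add_closed_0[OF closed] add_closed_minus[OF closed] add_closed_add[OF closed])
  then show "range U \<subseteq> derived_ideal" by blast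
qed

lemma lower_central_eq: "0 < n \<Longrightarrow> lower_central (derived_ideal :: 'a set) n = U ` lie_ge n"
  unfolding derived_ideal_eq by (simp add: lower_central_image[OF lie_hom_u_map] lower_central_free)

abbreviation "G \<equiv> lower_central (derived_ideal :: 'a set) p"
abbreviation "N \<equiv> lie_prod G UNIV"

lemma G_eq: "G = U ` lie_ge p" by (rule lower_central_eq[OF p_gt(1)])

definition leading :: "'a \<Rightarrow> (nat \<times> nat) assoc"
  where "leading a = top_part p (the_inv U a)"

lemma leading_U: "leading (U f) = top_part p f"
  by (simp add: leading_def the_inv_f_f[OF inj_U])

lemma add_closed_G: "add_closed G"
  unfolding G_eq by (rule add_closed_image[OF additive_u_map add_closed_lie_ge])

lemma leading_add: "a \<in> G \<Longrightarrow> b \<in> G \<Longrightarrow> leading (a + b) = leading a + leading b"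
  unfolding G_eq
  by (auto simp: leading_U additive.add[OF additive_top_part] simp flip: additive.add[OF additive_u_map])

lemma leading_in_L: "a \<in> G \<Longrightarrow> leading a \<in> L"
  unfolding G_eq by (auto simp: leading_U top_part_in_lie_elts)

lemma leading_surj: assumes "l \<in> L" obtains a where "a \<in> G" "leading a = l"
  by (rule top_part_surj[OF assms]) (metis G_eq imageI leading_U that)

lemma leading_lie:
  assumes "a \<in> G"
  shows "lie a x \<in> G" "leading (lie a x) = DX (leading a)"
    "lie a y \<in> G" "leading (lie a y) = DY (leading a)"
proof -
  obtain f where f: "a = U f" "f \<in> lie_ge p" using assms unfolding G_eq by blast
  show "lie a x \<in> G" "lie a y \<in> G"
    unfolding G_eq f(1) dx(2) dy(2)
    using lie_ge_derivation[OF dx(1) f(2)] lie_ge_derivation[OF dy(1) f(2)] by blast+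
  show "leading (lie a x) = DX (leading a)" "leading (lie a y) = DY (leading a)"
    unfolding f(1) dx(2) dy(2) leading_U
    by (rule top_part_derivation[OF dx(1,3) f(2)], rule top_part_derivation[OF dy(1) dy_approx f(2)])
qed

lemma N_subset: "N \<subseteq> {a \<in> G. leading a \<in> L_image}"
proof -
  let ?C = "{a \<in> G. leading a \<in> L_image}"
  have "?C = U ` {f \<in> lie_ge p. top_part p f \<in> L_image}"
    unfolding G_eq by (auto simp: leading_U)
  moreover have "add_closed {f \<in> lie_ge p. top_part p f \<in> L_image}"
    using add_closed_lie_ge[of p] add_closed_vimage[OF additive_top_part add_closed_L_image, of p]
    by (auto simp: add_closed_def)
  ultimately have C: "add_closed ?C" by (simp only: add_closed_image[OF additive_u_map])
  have "lie a b \<in> ?C" if "a \<in> G" for a b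
    using that
  proof (induction b arbitrary: a rule: rank_two_induct)
    case x
    then show ?case
      using leading_lie(1,2)[OF x] L_imageI[OF leading_in_L[OF x] add_closed_0[OF add_closed_lie_elts]]
      by simp
  next
    case y
    then show ?case
      using leading_lie(3,4)[OF y] L_imageI[OF add_closed_0[OF add_closed_lie_elts] leading_in_L[OF y]]
      by simp
  next
    case (br b c)
    obtain f where f: "a = U f" "f \<in> lie_ge p" using br.prems unfolding G_eq by blast
    obtain g where g: "lie b c = U g" using lie_range_U by blast
    have "lie f g \<in> lie_ge (Suc p)" by (rule lie_ge_lie[OF f(2)])
    then have "lie f g \<in> lie_ge p" "top_part p (lie f g) = 0"
      using lie_ge_mono[of p "Suc p"] top_part_Suc by auto
    then show ?case
      unfolding f(1) g lie_hom_lie[OF lie_hom_u_map, symmetric]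
      by (simp add: G_eq leading_U add_closed_0[OF add_closed_L_image])
  next
    case zero
    then show ?case using add_closed_0[OF C] by simp
  next
    case (neg b)
    then show ?case using add_closed_minus[OF C] by (simp only: lie_minus_right)
  next
    case (add b c)
    then show ?case using add_closed_add[OF C] by (simp only: lie_add_right)
  qed
  then show ?thesis by (intro lie_prod_subset[OF C])
qed

lemma add_closed_N: "add_closed N" by (rule add_closed_lie_prod)

text \<open>For the converse, Lie elements lift to \<open>G\<close>, so \<open>a\<close> can be
  corrected by brackets with \<open>x\<close> and \<open>y\<close> until its leading part
  vanishes; it then lies in the next term of the lower central series, which is contained in
  \<open>N\<close>.\<close>

lemma N_iff: "a \<in> N \<longleftrightarrow> a \<in> G \<and> leading a \<in> L_image"
proof (intro iffI)
  assume a: "a \<in> G \<and> leading a \<in> L_image"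
  obtain l1 l2 where l: "l1 \<in> L" "l2 \<in> L" "leading a = DX l1 + DY l2" using a by (blast elim: L_imageE)
  obtain a1 where a1: "a1 \<in> G" "leading a1 = l1" using leading_surj[OF l(1)] .
  obtain a2 where a2: "a2 \<in> G" "leading a2 = l2" using leading_surj[OF l(2)] .
  let ?r = "lie a1 x + lie a2 y"
  have r: "?r \<in> N" by (intro add_closed_add[OF add_closed_N] lie_in_lie_prod a1 a2) simp_all
  have rG: "?r \<in> G" by (intro add_closed_add[OF add_closed_G] leading_lie a1 a2)
  have "leading ?r = leading a"
    by (simp add: leading_add leading_lie a1 a2 l(3))
  moreover have d: "a - ?r \<in> G" using a rG by (intro add_closed_diff[OF add_closed_G]) blast+
  moreover have "leading a = leading (a - ?r) + leading ?r"
    using leading_add[OF d rG] by simp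
  ultimately have "leading (a - ?r) = 0" by simp
  obtain f where f: "a - ?r = U f" "f \<in> lie_ge p" using d unfolding G_eq by blast
  then have "top_part p f = 0" using \<open>leading (a - ?r) = 0\<close> by (simp add: leading_U)
  then have "f \<in> lie_ge (Suc p)" using top_part_kernel[OF f(2) p_gt(1)] by blast
  then have "a - ?r \<in> lower_central derived_ideal (Suc p)"
    using lower_central_eq[of "Suc p"] f(1) by blast
  then have "a - ?r \<in> lie_prod G derived_ideal" by (simp only: lower_central_Suc[OF p_gt(1)])
  then have "a - ?r \<in> N"
    using lie_prod_subset[OF add_closed_N, of G derived_ideal] lie_in_lie_prod by blast
  from add_closed_add[OF add_closed_N this r] show "a \<in> N" by simp
qed (use N_subset in blast)

definition tor :: "nat \<times> nat \<Rightarrow> 'a"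
  where "tor = (\<lambda>(s, t). torsion_elem p x y (u_elem x y s t))"

text \<open>The divisibility by \<open>p\<close> is shown once, for three free letters \<open>(0,
  0)\<close>, \<open>(0, 1)\<close>, \<open>(1, 0)\<close> in the roles of \<open>u\<close>,
  \<open>[u, y]\<close>, \<open>[u, x]\<close>. In the associative ring it is
  \<open>tau_formula\<close>, and it can be pulled back because there is no torsion.\<close>

lemma torsion_pattern:
  obtains f0 :: "(nat \<times> nat) free_lie" where "f0 \<in> lie_ge p" "zmul (int p) f0 =
    (\<Sum>i = 0..p - 2. bracket ((0, 1) # replicate i (0, 0) @ [(1, 0)] @ replicate (p - 2 - i) (0, 0))
      - bracket ((1, 0) # replicate i (0, 0) @ [(0, 1)] @ replicate (p - 2 - i) (0, 0)))"
proof -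
  let ?w1 = "\<lambda>i. (0::nat, 1::nat) # replicate i (0, 0) @ [(1, 0)] @ replicate (p - 2 - i) (0, 0)"
  let ?w2 = "\<lambda>i. (1::nat, 0::nat) # replicate i (0, 0) @ [(0, 1)] @ replicate (p - 2 - i) (0, 0)"
  obtain c where c: "homog p c" "tau (0, 0) = lin (left_normed letter) c"
    using tau_in_L[of "(0, 0)"] unfolding lie_elts_def by blast
  define d where "d = zmul (int p) c - (\<Sum>i = 0..p - 2. frag_of (?w1 i) - frag_of (?w2 i))"
  have "homog p d" unfolding d_def
    by (intro homog_diff homog_zmul c add_closed_sum[OF add_closed_homog, unfolded mem_Collect_eq])
      (use p_gt in \<open>auto simp: homog_frag_of\<close>)
  moreover have "lin h d = zmul (int p) (lin h c) - (\<Sum>i = 0..p - 2. h (?w1 i) - h (?w2 i))"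
    for h :: "(nat \<times> nat) list \<Rightarrow> 'z::ab_group_add"
    by (simp add: d_def lin_diff lin_zmul additive.sum[OF additive_lin])
  note lin_d = this
  have "lin (left_normed letter) d = 0"
    unfolding lin_d using tau_formula[of "(0, 0)"] by (simp add: c(2) incx_def incy_def)
  then have "iota (lin bracket d) = 0" by (simp only: iota_lin)
  ultimately have "lin bracket d = 0" using iota_inj_homog p_gt(1) by blast
  then have "zmul (int p) (lin bracket c) = (\<Sum>i = 0..p - 2. bracket (?w1 i) - bracket (?w2 i))"
    unfolding lin_d by simp
  moreover have "lin bracket c \<in> lie_ge p"
    unfolding lie_ge_def using c(1) by (auto simp: homog_def)
  ultimately show ?thesis using that by blast
qed

text \<open>The substitution \<open>\<sigma>\<close> of \<open>u\<close>, \<open>[u, y]\<close>,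
  \<open>[u, x]\<close> for the three letters turns \<open>torsion_pattern\<close> into the
  division by \<open>p\<close> that defines the element. Its leading part depends only on the
  leading terms of the substituted elements, which are letters.\<close>

lemma tor: "tor v \<in> G" "leading (tor v) = tau v"
proof -
  obtain s t where v: "v = (s, t)" by (cases v)
  obtain f0 :: "(nat \<times> nat) free_lie" where f0: "f0 \<in> lie_ge p" "zmul (int p) f0 =
    (\<Sum>i = 0..p - 2. bracket ((0, 1) # replicate i (0, 0) @ [(1, 0)] @ replicate (p - 2 - i) (0, 0))
      - bracket ((1, 0) # replicate i (0, 0) @ [(0, 1)] @ replicate (p - 2 - i) (0, 0)))"
    by (rule torsion_pattern)
  define g :: "nat \<times> nat \<Rightarrow> (nat \<times> nat) free_lie" where "g = (\<lambda>w. if w = (0, 0) then free_gen v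
    else if w = (0, 1) then dy (free_gen v) else if w = (1, 0) then dx (free_gen v) else 0)"
  define \<sigma> where "\<sigma> = free_lie_lift g"
  have \<sigma>: "lie_hom \<sigma>" unfolding \<sigma>_def by (rule free_lie_lift_hom)
  have \<sigma>_lnf: "\<sigma> (bracket w) = left_normed g w" for w
    by (simp add: lie_hom_left_normed[OF \<sigma>]) (simp add: \<sigma>_def free_lie_lift_gen)
  define u where "u = u_elem x y s t"
  let ?S = "\<Sum>i = 0..p - 2.
      lie_products (lie u y) (replicate i u @ [lie u x] @ replicate (p - 2 - i) u)
      - lie_products (lie u x) (replicate i u @ [lie u y] @ replicate (p - 2 - i) u)"
  have Ug: "U (g (0, 0)) = u" "U (g (0, 1)) = lie u y" "U (g (1, 0)) = lie u x"
    by (simp_all add: g_def v u_map_gen u_def flip: dx(2) dy(2))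
  have U\<sigma>: "lie_hom (\<lambda>f. U (\<sigma> f))" by (rule lie_hom_comp[OF lie_hom_u_map \<sigma>])
  have U\<sigma>_lnf: "U (\<sigma> (bracket w)) = left_normed (\<lambda>v. U (g v)) w" for w
    by (simp add: \<sigma>_lnf lie_hom_left_normed[OF lie_hom_u_map])
  have "zmul (int p) (U (\<sigma> f0)) = U (\<sigma> (zmul (int p) f0))"
    by (rule additive_zmul[OF lie_hom_additive[OF U\<sigma>], symmetric])
  also have "\<dots> = ?S"
    unfolding f0(2) additive.sum[OF lie_hom_additive[OF U\<sigma>]] additive.diff[OF lie_hom_additive[OF U\<sigma>]]
      U\<sigma>_lnf
    unfolding left_normed_Cons map_append map_replicate list.map Ug ..
  finally have pS: "zmul (int p) (U (\<sigma> f0)) = ?S" .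
  have "exact_div p ?S = U (\<sigma> f0)"
    unfolding exact_div_def
  proof (rule the_equality)
    show "(\<Sum>j<p. U (\<sigma> f0)) = ?S" using pS by (simp only: zmul_of_nat)
    fix z assume "(\<Sum>j<p. z) = ?S"
    then have "zmul (int p) (z - U (\<sigma> f0)) = 0"
      unfolding pS[symmetric] zmul_of_nat[symmetric] by (simp add: zmul_diff_right)
    then show "z = U (\<sigma> f0)" using torsion_free[of "int p" "z - U (\<sigma> f0)"] p_gt by simp
  qed
  then have tor_eq: "tor v = U (\<sigma> f0)" by (simp add: tor_def v torsion_elem_def u_def)
  have \<sigma>f0: "\<sigma> f0 \<in> lie_ge p"
  proof (rule lie_ge_additive[OF lie_hom_additive[OF \<sigma>] add_closed_lie_ge f0(1)])
    fix w :: "(nat \<times> nat) list" assume "p \<le> length w"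
    from subsetD[OF lie_ge_mono[OF this] left_normed_in_lie_ge] show "\<sigma> (bracket w) \<in> lie_ge p" unfolding \<sigma>_lnf .
  qed
  then show "tor v \<in> G" unfolding tor_eq G_eq by blast
  define k :: "nat \<times> nat \<Rightarrow> nat \<times> nat" where "k = (\<lambda>(a, b). (s + a, t + b))"
  have k: "k (0, 0) = v" "k (0, 1) = incy v" "k (1, 0) = incx v"
    by (simp_all add: k_def v incx_def incy_def)
  have approx: "g w - free_gen (k w) \<in> lie_ge 2" if "w \<in> {(0, 0), (0, 1), (1, 0)}" for w
    using that dx(3)[of v] dy_approx[of v] k by (auto simp: g_def add_closed_0[OF add_closed_lie_ge])
  have top: "top_part p (left_normed g w) = left_normed letter (map k w)"
    if "set w \<subseteq> {(0, 0), (0, 1), (1, 0)}" "length w = p" for w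
    by (rule top_part_left_normed) (use approx that in auto)
  have "zmul (int p) (top_part p (\<sigma> f0)) = top_part p (\<sigma> (zmul (int p) f0))"
    by (rule additive_zmul[OF additive_comp[OF additive_top_part lie_hom_additive[OF \<sigma>]], symmetric])
  also have "\<dots> = (\<Sum>i = 0..p - 2.
      left_normed letter (map k ((0, 1) # replicate i (0, 0) @ [(1, 0)] @ replicate (p - 2 - i) (0, 0)))
      - left_normed letter (map k ((1, 0) # replicate i (0, 0) @ [(0, 1)] @ replicate (p - 2 - i) (0, 0))))"
    unfolding f0(2) additive.sum[OF lie_hom_additive[OF \<sigma>]] additive.diff[OF lie_hom_additive[OF \<sigma>]]
      additive.sum[OF additive_top_part] additive.diff[OF additive_top_part] \<sigma>_lnf
    by (intro sum.cong arg_cong2[of _ _ _ _ "(-)"] top) (use p_gt in auto)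
  also have "\<dots> = zmul (int p) (tau v)"
    unfolding tau_formula map_append map_replicate list.map k ..
  finally have "zmul (int p) (top_part p (\<sigma> f0) - tau v) = 0" by (simp add: zmul_diff_right)
  then show "leading (tor v) = tau v"
    using p_gt unfolding tor_eq leading_U by (simp add: zmul_frag_eq_0)
qed

end

section \<open>Quotients of abelian groups with elementary torsion\<close>

locale abelian_quotient =
  fixes G N :: "'a::ab_group_add set"
  assumes add_closed_G: "add_closed G" and add_closed_N: "add_closed N" and N_subset: "N \<subseteq> G"
begin

abbreviation "A \<equiv> additive_group G"
abbreviation "Q \<equiv> A Mod N"

definition coset_class :: "'a \<Rightarrow> 'a set" where "coset_class a = N #>\<^bsub>A\<^esub> a"

lemma A_simps [simp]: "carrier A = G" "x \<otimes>\<^bsub>A\<^esub> y = x + y" "\<one>\<^bsub>A\<^esub> = 0"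
  by (simp_all add: additive_group_def)

lemma comm_group_A: "comm_group A"
proof (rule comm_groupI)
  fix x assume "x \<in> carrier A"
  then have "- x \<in> carrier A" "- x \<otimes>\<^bsub>A\<^esub> x = \<one>\<^bsub>A\<^esub>"
    using add_closed_minus[OF add_closed_G] by simp_all
  then show "\<exists>y\<in>carrier A. y \<otimes>\<^bsub>A\<^esub> x = \<one>\<^bsub>A\<^esub>" by blast
qed (simp_all add: add_closed_0[OF add_closed_G] add_closed_add[OF add_closed_G] ac_simps)

interpretation A: comm_group A by (rule comm_group_A)

lemma inv_A: "a \<in> G \<Longrightarrow> inv\<^bsub>A\<^esub> a = - a"
  using A.inv_equality[of "- a" a] add_closed_minus[OF add_closed_G] by simp

lemma subgroup_N: "subgroup N A"
  by (rule A.subgroupI)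
    (use N_subset add_closed_0[OF add_closed_N] in \<open>auto simp: inv_A subsetD
      intro: add_closed_add[OF add_closed_N] add_closed_minus[OF add_closed_N]\<close>)

lemma comm_group_Q: "comm_group Q" by (rule A.abelian_FactGroup[OF subgroup_N])

interpretation Q: comm_group Q by (rule comm_group_Q)

lemma coset_class_mem: "b \<in> coset_class a \<longleftrightarrow> b - a \<in> N"
  by (auto simp: coset_class_def r_coset_def) (metis diff_add_cancel)

lemma coset_class_eq_iff: "coset_class a = coset_class b \<longleftrightarrow> a - b \<in> N"
proof
  assume "coset_class a = coset_class b"
  moreover have "a \<in> coset_class a" by (simp add: coset_class_mem add_closed_0[OF add_closed_N])
  ultimately show "a - b \<in> N" by (simp add: coset_class_mem)
next
  assume ab: "a - b \<in> N"
  have "c - a \<in> N \<longleftrightarrow> c - b \<in> N" for c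
    using add_closed_add[OF add_closed_N _ ab, of "c - a"] add_closed_diff[OF add_closed_N _ ab, of "c - b"]
    by auto
  then show "coset_class a = coset_class b" by (auto simp: coset_class_mem)
qed

lemma carrier_Q: "carrier Q = coset_class ` G"
  by (auto simp: FactGroup_def RCOSETS_def coset_class_def)

lemma one_Q: "\<one>\<^bsub>Q\<^esub> = coset_class 0"
  by (auto simp: coset_class_mem)

lemma coset_class_0 [simp]: "coset_class 0 = N" by (auto simp: coset_class_mem)

lemma coset_class_eq_N [simp]: "coset_class a = N \<longleftrightarrow> a \<in> N" using coset_class_eq_iff[of a 0] by simp

lemma mult_Q:
  assumes "a \<in> G" "b \<in> G"
  shows "coset_class a \<otimes>\<^bsub>Q\<^esub> coset_class b = coset_class (a + b)" "coset_class a <#>\<^bsub>A\<^esub> coset_class b = coset_class (a + b)"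
  using normal.rcos_sum[OF A.subgroup_imp_normal[OF subgroup_N], of a b] assms
  by (simp_all add: coset_class_def)

lemma coset_class_in_Q [simp]: "a \<in> G \<Longrightarrow> coset_class a \<in> carrier Q" by (simp add: carrier_Q)

lemma inv_Q: "a \<in> G \<Longrightarrow> inv\<^bsub>Q\<^esub> coset_class a = coset_class (- a)"
  by (rule Q.inv_equality) (simp_all add: mult_Q one_Q add_closed_minus[OF add_closed_G])

lemma pow_Q: "a \<in> G \<Longrightarrow> coset_class a [^]\<^bsub>Q\<^esub> (n::nat) = coset_class (zmul (int n) a)"
proof (induction n)
  case (Suc n)
  then show ?case
    using zmul_Suc[of "int n" a]
    by (simp add: mult_Q add_closed_zmul[OF add_closed_G] add.commute[of 1])
qed (simp add: one_Q)

lemma int_pow_Q: "a \<in> G \<Longrightarrow> coset_class a [^]\<^bsub>Q\<^esub> (k::int) = coset_class (zmul k a)"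
  by (cases k rule: int_cases2)
    (simp_all add: int_pow_int Q.int_pow_neg pow_Q inv_Q add_closed_zmul[OF add_closed_G] zmul_minus_left)

end

text \<open>The values of \<open>\<theta>\<close> lie in a free abelian group of countable rank, so the
  kernel of \<open>\<theta>\<close> modulo \<open>N\<close> is the torsion of the quotient; it
  has the classes of the \<open>e i\<close> as a basis over \<open>\<int>/p\<close>.\<close>

locale elementary_torsion = abelian_quotient G N for G N :: "'a::ab_group_add set" +
  fixes \<theta> :: "'a \<Rightarrow> 'c::countable \<Rightarrow>\<^sub>0 int" and e :: "'i \<Rightarrow> 'a" and p :: nat
  assumes p: "1 < p"
    and \<theta>_add: "a \<in> G \<Longrightarrow> b \<in> G \<Longrightarrow> \<theta> (a + b) = \<theta> a + \<theta> b"
    and \<theta>_N: "a \<in> N \<Longrightarrow> \<theta> a = 0"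
    and e_G: "e i \<in> G" and \<theta>_e: "\<theta> (e i) = 0" and p_e: "zmul (int p) (e i) \<in> N"
    and kernel: "a \<in> G \<Longrightarrow> \<theta> a = 0 \<Longrightarrow> \<exists>\<nu>. a - lin e \<nu> \<in> N"
    and independent: "lin e \<nu> \<in> N \<Longrightarrow> int p dvd lookup \<nu> i"
begin

interpretation A: comm_group A by (rule comm_group_A)
interpretation Q: comm_group Q by (rule comm_group_Q)

lemma \<theta>_0: "\<theta> 0 = 0" by (rule \<theta>_N[OF add_closed_0[OF add_closed_N]])

lemma \<theta>_minus: "a \<in> G \<Longrightarrow> \<theta> (- a) = - \<theta> a"
  using \<theta>_add[of a "- a"] \<theta>_0 add_closed_minus[OF add_closed_G] by (simp add: eq_neg_iff_add_eq_0 add.commute)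

lemma \<theta>_diff: "a \<in> G \<Longrightarrow> b \<in> G \<Longrightarrow> \<theta> (a - b) = \<theta> a - \<theta> b"
  using \<theta>_add[of a "- b"] \<theta>_minus add_closed_minus[OF add_closed_G] by simp

lemma \<theta>_zmul: "a \<in> G \<Longrightarrow> \<theta> (zmul k a) = zmul k (\<theta> a)"
  by (induction k rule: int_induct[where k=0])
    (simp_all add: \<theta>_0 zmul_Suc zmul_pred \<theta>_add \<theta>_diff add_closed_zmul[OF add_closed_G])

lemma lin_G: "(\<And>i. i \<in> keys \<nu> \<Longrightarrow> h i \<in> G) \<Longrightarrow> lin h \<nu> \<in> G"
  by (rule add_closed_lin[OF add_closed_G])

lemma \<theta>_lin: "(\<And>i. i \<in> keys \<nu> \<Longrightarrow> h i \<in> G) \<Longrightarrow> \<theta> (lin h \<nu>) = lin (\<lambda>i. \<theta> (h i)) \<nu>"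
proof -
  assume h: "\<And>i. i \<in> keys \<nu> \<Longrightarrow> h i \<in> G"
  have "\<theta> (\<Sum>i\<in>I. zmul (lookup \<nu> i) (h i)) = (\<Sum>i\<in>I. zmul (lookup \<nu> i) (\<theta> (h i)))"
    if "finite I" "I \<subseteq> keys \<nu>" for I
    using that
  proof (induction I rule: finite_induct)
    case (insert i I)
    have "(\<Sum>i\<in>I. zmul (lookup \<nu> i) (h i)) \<in> G" "h i \<in> G"
      using insert.prems h by (auto intro!: add_closed_sum[OF add_closed_G] add_closed_zmul[OF add_closed_G])
    then show ?case
      using insert by (simp add: \<theta>_add \<theta>_zmul add_closed_zmul[OF add_closed_G])
  qed (simp add: \<theta>_0)
  then show ?thesis by (simp add: lin_def)
qed

abbreviation "K \<equiv> {a \<in> G. \<theta> a = 0}"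

lemma p_K: "a \<in> K \<Longrightarrow> zmul (int p) a \<in> N"
proof -
  assume "a \<in> K"
  then obtain \<nu> where \<nu>: "a - lin e \<nu> \<in> N" using kernel by blast
  have "zmul (int p) (a - lin e \<nu>) \<in> N" by (rule add_closed_zmul[OF add_closed_N \<nu>])
  moreover have "zmul (int p) (lin e \<nu>) \<in> N"
    unfolding additive_lin_comp[OF additive_zmul_right]
    by (rule add_closed_lin[OF add_closed_N]) (rule p_e)
  ultimately have "zmul (int p) (a - lin e \<nu>) + zmul (int p) (lin e \<nu>) \<in> N"
    by (rule add_closed_add[OF add_closed_N])
  then show ?thesis by (simp add: zmul_diff_right)
qed

lemma zmul_mod_K: "a \<in> K \<Longrightarrow> coset_class (zmul (k mod int p) a) = coset_class (zmul k a)"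
proof -
  assume a: "a \<in> K"
  have "zmul (k mod int p) a - zmul k a = zmul (- (k div int p)) (zmul (int p) a)"
    unfolding zmul_zmul zmul_diff_left[symmetric]
    by (simp add: minus_mult_div_eq_mod[symmetric] mult.commute)
  then show ?thesis
    unfolding coset_class_eq_iff using add_closed_zmul[OF add_closed_N p_K[OF a]] by simp
qed

lemma torsion_eq: "torsion Q = coset_class ` K"
proof
  show "coset_class ` K \<subseteq> torsion Q"
  proof
    fix c assume "c \<in> coset_class ` K"
    then obtain a where a: "c = coset_class a" "a \<in> K" by blast
    then have "c [^]\<^bsub>Q\<^esub> p = \<one>\<^bsub>Q\<^esub>" using p_K[of a] unfolding one_Q by (simp add: pow_Q coset_class_eq_iff)
    moreover have "0 < p" using p by simp
    ultimately show "c \<in> torsion Q" using a unfolding torsion_def by auto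
  qed
  show "torsion Q \<subseteq> coset_class ` K"
  proof
    fix c assume "c \<in> torsion Q"
    then obtain a n where a: "c = coset_class a" "a \<in> G" "n > 0" "c [^]\<^bsub>Q\<^esub> (n::nat) = \<one>\<^bsub>Q\<^esub>"
      by (auto simp: torsion_def carrier_Q)
    have "zmul (int n) a \<in> N" using a(4) unfolding one_Q a(1) pow_Q[OF a(2)] coset_class_eq_iff by simp
    then have "zmul (int n) (\<theta> a) = 0" using \<theta>_N \<theta>_zmul[OF a(2)] by metis
    then have "\<theta> a = 0" using a(3) by (simp add: zmul_frag_eq_0)
    then show "c \<in> coset_class ` K" using a by blast
  qed
qed

lemma K_closed: "add_closed K"
  using add_closed_0[OF add_closed_G] add_closed_diff[OF add_closed_G]
  by (auto simp: add_closed_def \<theta>_0 \<theta>_diff)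

lemma subgroup_torsion: "subgroup (torsion Q) Q"
proof (rule Q.subgroupI)
  show "torsion Q \<subseteq> carrier Q" by (auto simp: torsion_def)
  show "torsion Q \<noteq> {}" using add_closed_0[OF K_closed] unfolding torsion_eq by blast
  show "inv\<^bsub>Q\<^esub> c \<in> torsion Q" if "c \<in> torsion Q" for c
    using that add_closed_minus[OF K_closed] unfolding torsion_eq by (auto simp: inv_Q simp del: mem_Collect_eq) (auto simp: inv_Q)
  show "c \<otimes>\<^bsub>Q\<^esub> d \<in> torsion Q" if cd: "c \<in> torsion Q" "d \<in> torsion Q" for c d
  proof -
    obtain a b where ab: "c = coset_class a" "d = coset_class b" "a \<in> K" "b \<in> K" using cd unfolding torsion_eq by blast
    then have "c \<otimes>\<^bsub>Q\<^esub> d = coset_class (a + b)" by (simp add: mult_Q)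
    then show ?thesis unfolding torsion_eq using add_closed_add[OF K_closed ab(3,4)] by blast
  qed
qed

abbreviation "E \<equiv> Q\<lparr>carrier := torsion Q\<rparr>"

lemma comm_group_E: "comm_group E"
  by (rule group.group_comm_groupI[OF Q.subgroup_imp_group[OF subgroup_torsion]])
    (auto simp: torsion_eq mult_Q add.commute)

lemma elementary_E: "elementary_abelian p E"
  unfolding elementary_abelian_def
proof (intro conjI ballI comm_group_E)
  fix c assume "c \<in> carrier E"
  then obtain a where a: "c = coset_class a" "a \<in> K" by (auto simp: torsion_eq)
  have "c [^]\<^bsub>E\<^esub> p = c [^]\<^bsub>Q\<^esub> p" by (simp add: nat_pow_def)
  also have "\<dots> = \<one>\<^bsub>E\<^esub>" using a p_K[of a] by (simp add: pow_Q)
  finally show "c [^]\<^bsub>E\<^esub> p = \<one>\<^bsub>E\<^esub>" .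
qed

subsection \<open>The basis of the torsion subgroup\<close>

abbreviation "R \<equiv> residue_ring (int p)"
abbreviation "M \<equiv> torsion_module Q"

lemma M_simps [simp]: "carrier M = coset_class ` K" "add M = monoid.mult Q" "zero M = \<one>\<^bsub>Q\<^esub>"
  "c \<odot>\<^bsub>M\<^esub> a = a [^]\<^bsub>Q\<^esub> c"
  by (simp_all add: torsion_module_def torsion_eq)

lemma R_simps [simp]: "carrier R = {0..int p - 1}" "k \<oplus>\<^bsub>R\<^esub> l = (k + l) mod int p"
  "k \<otimes>\<^bsub>R\<^esub> l = (k * l) mod int p" "\<one>\<^bsub>R\<^esub> = 1" "\<zero>\<^bsub>R\<^esub> = 0"
  by (simp_all add: residue_ring_def)

lemma abelian_group_M: "abelian_group M"
proof -
  interpret E: comm_group E by (rule comm_group_E)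
  note m = E.m_closed E.m_assoc E.m_comm E.l_one E.one_closed E.l_inv_ex
  show ?thesis
    by (rule abelian_groupI; use m in \<open>simp add: torsion_eq\<close>)
qed

interpretation M: abelian_group M by (rule abelian_group_M)

lemma module_M: "Module.module R M"
proof (rule moduleI)
  have "residues (int p)" using p by unfold_locales simp
  then show "cring R" using residues.cring by blast
  show "abelian_group M" by (rule abelian_group_M)
next
  fix k c assume "k \<in> carrier R" "c \<in> carrier M"
  then obtain a where a: "c = coset_class a" "a \<in> K" by auto
  then have "k \<odot>\<^bsub>M\<^esub> c = coset_class (zmul k a)" by (simp add: int_pow_Q)
  then show "k \<odot>\<^bsub>M\<^esub> c \<in> carrier M" using add_closed_zmul[OF K_closed a(2), of k] by auto
next
  fix k l c assume "c \<in> carrier M"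
  then obtain a where a: "c = coset_class a" "a \<in> K" by auto
  have aG: "a \<in> G" using a by simp
  show "(k \<oplus>\<^bsub>R\<^esub> l) \<odot>\<^bsub>M\<^esub> c = k \<odot>\<^bsub>M\<^esub> c \<oplus>\<^bsub>M\<^esub> l \<odot>\<^bsub>M\<^esub> c"
    by (simp add: a(1) int_pow_Q[OF aG] zmul_mod_K[OF a(2)] mult_Q add_closed_zmul[OF add_closed_G aG] zmul_add_left)
  show "(k \<otimes>\<^bsub>R\<^esub> l) \<odot>\<^bsub>M\<^esub> c = k \<odot>\<^bsub>M\<^esub> (l \<odot>\<^bsub>M\<^esub> c)"
    by (simp add: a(1) int_pow_Q[OF aG] int_pow_Q add_closed_zmul[OF add_closed_G aG] zmul_mod_K[OF a(2)] zmul_zmul)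
next
  fix k c d assume "c \<in> carrier M" "d \<in> carrier M"
  then obtain a b where a: "c = coset_class a" "d = coset_class b" "a \<in> G" "b \<in> G" by auto
  then show "k \<odot>\<^bsub>M\<^esub> (c \<oplus>\<^bsub>M\<^esub> d) = k \<odot>\<^bsub>M\<^esub> c \<oplus>\<^bsub>M\<^esub> k \<odot>\<^bsub>M\<^esub> d"
    by (simp add: mult_Q int_pow_Q add_closed_add[OF add_closed_G] add_closed_zmul[OF add_closed_G] zmul_add_right)
next
  fix c assume "c \<in> carrier M"
  then obtain a where a: "c = coset_class a" "a \<in> G" by auto
  then show "\<one>\<^bsub>R\<^esub> \<odot>\<^bsub>M\<^esub> c = c" by (simp add: int_pow_Q)
qed

lemma e_K: "e i \<in> K" by (simp add: e_G \<theta>_e)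

lemma finsum_M:
  assumes "finite J"
  shows "(\<Oplus>\<^bsub>M\<^esub>j\<in>J. c j \<odot>\<^bsub>M\<^esub> coset_class (e j)) = coset_class (\<Sum>j\<in>J. zmul (c j) (e j))"
  using assms
proof (induction J rule: finite_induct)
  case empty
  then show ?case by simp
next
  case (insert i J)
  have mem: "(\<lambda>j. c j \<odot>\<^bsub>M\<^esub> coset_class (e j)) \<in> I \<rightarrow> carrier M" for I
    using add_closed_zmul[OF K_closed e_K] by (auto simp: int_pow_Q[OF e_G] simp del: mem_Collect_eq)
  have sum: "(\<Sum>j\<in>J. zmul (c j) (e j)) \<in> G"
    by (intro add_closed_sum[OF add_closed_G] add_closed_zmul[OF add_closed_G] e_G)
  have "(\<Oplus>\<^bsub>M\<^esub>j\<in>insert i J. c j \<odot>\<^bsub>M\<^esub> coset_class (e j)) =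
    (c i \<odot>\<^bsub>M\<^esub> coset_class (e i)) \<oplus>\<^bsub>M\<^esub> (\<Oplus>\<^bsub>M\<^esub>j\<in>J. c j \<odot>\<^bsub>M\<^esub> coset_class (e j))"
    using insert.hyps mem[of J] mem[of "{i}"] by (intro M.finsum_insert) auto
  then show ?case
    using insert.hyps sum by (simp add: insert.IH int_pow_Q[OF e_G] mult_Q add_closed_zmul[OF add_closed_G e_G] del: M_simps(4))
      (simp add: int_pow_Q[OF e_G] mult_Q add_closed_zmul[OF add_closed_G e_G])
qed

lemma torsion_basis: "module_basis R M UNIV (\<lambda>i. coset_class (e i))"
  unfolding module_basis_def
proof (intro conjI module_M)
  show "(\<lambda>i. coset_class (e i)) \<in> UNIV \<rightarrow> carrier M" using e_K by auto
  show "module_independent R M UNIV (\<lambda>i. coset_class (e i))"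
    unfolding module_independent_def
  proof (intro allI impI ballI)
    fix J and c :: "'i \<Rightarrow> int" and j
    assume *: "finite J \<and> J \<subseteq> UNIV \<and> c \<in> J \<rightarrow> carrier R \<and> (\<Oplus>\<^bsub>M\<^esub>j\<in>J. c j \<odot>\<^bsub>M\<^esub> coset_class (e j)) = \<zero>\<^bsub>M\<^esub>"
      and j: "j \<in> J"
    then have J: "finite J" and 0: "(\<Oplus>\<^bsub>M\<^esub>j\<in>J. c j \<odot>\<^bsub>M\<^esub> coset_class (e j)) = \<zero>\<^bsub>M\<^esub>" by blast+
    from trans[OF finsum_M[OF J, of c, symmetric] 0]
    have sum: "(\<Sum>j\<in>J. zmul (c j) (e j)) \<in> N" by simp
    define \<nu> where "\<nu> = (\<Sum>j\<in>J. zmul (c j) (frag_of j))"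
    have "lin e \<nu> = (\<Sum>j\<in>J. zmul (c j) (e j))"
      by (simp add: \<nu>_def additive.sum[OF additive_lin] lin_zmul)
    then have "int p dvd lookup \<nu> j" using independent sum by simp
    moreover have "lookup \<nu> j = (\<Sum>i\<in>J. if i = j then c i else 0)"
      unfolding \<nu>_def lookup_sum by (rule sum.cong) auto
    then have "lookup \<nu> j = c j" using J j by simp
    moreover have "c j \<in> {0..int p - 1}" using * j by auto
    ultimately show "c j = \<zero>\<^bsub>R\<^esub>" using zdvd_not_zless[of "c j" "int p"] by force
  qed
  show "module_spanning R M UNIV (\<lambda>i. coset_class (e i))"
    unfolding module_spanning_def
  proof
    fix m assume "m \<in> carrier M"
    then obtain a where a: "m = coset_class a" "a \<in> K" by auto
    then obtain \<nu> where \<nu>: "a - lin e \<nu> \<in> N" using kernel by blast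
    let ?c = "\<lambda>i. lookup \<nu> i mod int p"
    have "zmul (?c i) (e i) - zmul (lookup \<nu> i) (e i) \<in> N" for i
      using zmul_mod_K[OF e_K] by (simp only: coset_class_eq_iff)
    then have "(\<Sum>i\<in>keys \<nu>. zmul (?c i) (e i) - zmul (lookup \<nu> i) (e i)) \<in> N"
      by (rule add_closed_sum[OF add_closed_N])
    from add_closed_diff[OF add_closed_N \<nu> this] have "m = coset_class (\<Sum>i\<in>keys \<nu>. zmul (?c i) (e i))"
      unfolding a(1) coset_class_eq_iff by (simp add: sum_subtractf lin_def)
    then have "m = (\<Oplus>\<^bsub>M\<^esub>j\<in>keys \<nu>. ?c j \<odot>\<^bsub>M\<^esub> coset_class (e j))" by (simp only: finsum_M finite_keys)
    moreover have "?c \<in> keys \<nu> \<rightarrow> carrier R" using p by (auto simp: zle_diff1_eq)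
    ultimately show "\<exists>J c. finite J \<and> J \<subseteq> UNIV \<and> c \<in> J \<rightarrow> carrier R \<and>
        m = (\<Oplus>\<^bsub>M\<^esub>j\<in>J. c j \<odot>\<^bsub>M\<^esub> coset_class (e j))"
      by (intro exI[of _ "keys \<nu>"] exI[of _ ?c]) simp
  qed
qed

subsection \<open>The free complement\<close>

definition bounded :: "nat \<Rightarrow> 'a set"
  where "bounded n = {a \<in> G. \<forall>k. n \<le> to_nat k \<longrightarrow> lookup (\<theta> a) k = 0}"

lemma bounded_closed: "add_closed (bounded n)"
  using add_closed_0[OF add_closed_G] add_closed_diff[OF add_closed_G]
  by (auto simp: add_closed_def bounded_def \<theta>_0 \<theta>_diff lookup_minus)

text \<open>Gaussian elimination for the image of \<open>\<theta>\<close>, with the coordinates in the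
  order of their numbers: among the elements with no later coordinate than \<open>k\<close>,
  one whose coordinate at \<open>k\<close> generates the ideal of all these coordinates. The
  pivots with nonzero coordinate map to a basis of the image.\<close>

definition pivot :: "'c \<Rightarrow> 'a"
  where "pivot k = (SOME g. g \<in> bounded (Suc (to_nat k)) \<and>
    (\<forall>a\<in>bounded (Suc (to_nat k)). lookup (\<theta> g) k dvd lookup (\<theta> a) k))"

lemma pivot: "pivot k \<in> bounded (Suc (to_nat k))"
  "a \<in> bounded (Suc (to_nat k)) \<Longrightarrow> lookup (\<theta> (pivot k)) k dvd lookup (\<theta> a) k"
proof -
  let ?B = "bounded (Suc (to_nat k))" and ?l = "\<lambda>a. lookup (\<theta> a) k"
  have G: "a \<in> G" if "a \<in> ?B" for a using that by (simp add: bounded_def)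
  have "\<exists>g\<in>?B. \<forall>a\<in>?B. ?l g dvd ?l a"
  proof (cases "\<exists>a\<in>?B. ?l a \<noteq> 0")
    case False
    then show ?thesis using add_closed_0[OF bounded_closed] by force
  next
    case True
    \<comment> \<open>an element of least nonzero absolute coordinate, by division with remainder\<close>
    then have "\<exists>n. \<exists>g\<in>?B. ?l g \<noteq> 0 \<and> n = nat \<bar>?l g\<bar>" by blast
    from LeastI_ex[OF this] Least_le[of "\<lambda>n. \<exists>g\<in>?B. ?l g \<noteq> 0 \<and> n = nat \<bar>?l g\<bar>"]
    obtain g where g: "g \<in> ?B" "?l g \<noteq> 0"
      and least: "\<And>a. a \<in> ?B \<Longrightarrow> ?l a \<noteq> 0 \<Longrightarrow> nat \<bar>?l g\<bar> \<le> nat \<bar>?l a\<bar>"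
      by (metis (no_types, lifting))
    have "?l g dvd ?l a" if a: "a \<in> ?B" for a
    proof (rule ccontr)
      assume n: "\<not> ?l g dvd ?l a"
      let ?r = "a - zmul (?l a div ?l g) g"
      have r: "?r \<in> ?B" by (intro add_closed_diff[OF bounded_closed] add_closed_zmul[OF bounded_closed] a g)
      have "?l ?r = ?l a mod ?l g"
        using G[OF a] G[OF g(1)]
        by (simp add: \<theta>_diff \<theta>_zmul add_closed_zmul[OF add_closed_G] lookup_minus minus_div_mult_eq_mod)
      moreover have "\<bar>?l a mod ?l g\<bar> < \<bar>?l g\<bar>" by (rule abs_mod_less[OF g(2)])
      ultimately show False using least[OF r] n by (simp add: dvd_eq_mod_eq_0)
    qed
    then show ?thesis using g(1) by blast
  qed
  then have "\<exists>g. g \<in> ?B \<and> (\<forall>a\<in>?B. ?l g dvd ?l a)" by blast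
  from someI_ex[OF this] show "pivot k \<in> ?B" "a \<in> ?B \<Longrightarrow> ?l (pivot k) dvd ?l a"
    unfolding pivot_def[symmetric] by blast+
qed

definition pivots :: "'c set" where "pivots = {k. lookup (\<theta> (pivot k)) k \<noteq> 0}"

lemma pivot_G: "pivot k \<in> G" using pivot(1)[of k] by (simp add: bounded_def)

text \<open>Subtracting a multiple of the pivot removes the last coordinate.\<close>

lemma pivots_span_bounded:
  "a \<in> bounded n \<Longrightarrow> \<exists>\<nu>. keys \<nu> \<subseteq> pivots \<and> a - lin pivot \<nu> \<in> K"
proof (induction n arbitrary: a)
  case 0
  then have "\<theta> a = 0" by (intro poly_mapping_eqI) (simp add: bounded_def)
  then show ?case using 0 by (intro exI[of _ 0]) (simp add: bounded_def)
next
  case (Suc n)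
  show ?case
  proof (cases "\<exists>k::'c. to_nat k = n \<and> lookup (\<theta> a) k \<noteq> 0")
    case False
    have "a \<in> bounded n"
      using Suc.prems False by (auto simp: bounded_def) (metis Suc_leI le_neq_implies_less)
    then show ?thesis by (rule Suc.IH)
  next
    case True
    then obtain k :: 'c where k: "to_nat k = n" "lookup (\<theta> a) k \<noteq> 0" by blast
    have dvd: "lookup (\<theta> (pivot k)) k dvd lookup (\<theta> a) k" using pivot(2)[of a k] Suc.prems k by simp
    then have kp: "k \<in> pivots" using k(2) by (auto simp: pivots_def)
    define q where "q = lookup (\<theta> a) k div lookup (\<theta> (pivot k)) k"
    let ?b = "a - zmul q (pivot k)"
    have aG: "a \<in> G" using Suc.prems by (simp add: bounded_def)
    have "?b \<in> bounded (Suc n)"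
      using pivot(1)[of k] k(1) Suc.prems
      by (intro add_closed_diff[OF bounded_closed] add_closed_zmul[OF bounded_closed]) simp_all
    moreover have "lookup (\<theta> ?b) k = 0"
      using dvd aG pivot_G by (simp add: \<theta>_diff \<theta>_zmul add_closed_zmul[OF add_closed_G] lookup_minus q_def)
    ultimately have "?b \<in> bounded n"
      using k(1) by (auto simp: bounded_def) (metis Suc_leI le_neq_implies_less to_nat_split inj_to_nat injD)
    from Suc.IH[OF this] obtain \<nu> where \<nu>: "keys \<nu> \<subseteq> pivots" "?b - lin pivot \<nu> \<in> K" by blast
    let ?\<nu> = "\<nu> + zmul q (frag_of k)"
    have "keys ?\<nu> \<subseteq> keys \<nu> \<union> {k}" by (auto simp: in_keys_iff lookup_add split: if_splits)
    then have "keys ?\<nu> \<subseteq> pivots" using \<nu>(1) kp by blast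
    moreover have "a - lin pivot ?\<nu> = ?b - lin pivot \<nu>"
      by (simp add: lin_add lin_zmul algebra_simps)
    ultimately show ?thesis using \<nu>(2) by metis
  qed
qed

lemma pivots_span: "a \<in> G \<Longrightarrow> \<exists>\<nu>. keys \<nu> \<subseteq> pivots \<and> a - lin pivot \<nu> \<in> K"
proof -
  assume a: "a \<in> G"
  define n where "n = Suc (Max (insert 0 (to_nat ` keys (\<theta> a))))"
  have "lookup (\<theta> a) k = 0" if "n \<le> to_nat k" for k
  proof (rule ccontr)
    assume "lookup (\<theta> a) k \<noteq> 0"
    then have "to_nat k \<le> Max (insert 0 (to_nat ` keys (\<theta> a)))"
      by (intro Max_ge) (auto simp: in_keys_iff)
    with that show False by (simp add: n_def)
  qed
  with a have "a \<in> bounded n" by (simp add: bounded_def)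
  then show ?thesis by (rule pivots_span_bounded)
qed

text \<open>The last coordinate of a combination is that of a single pivot.\<close>

lemma pivots_independent:
  assumes "keys \<nu> \<subseteq> pivots" "\<theta> (lin pivot \<nu>) = 0"
  shows "\<nu> = 0"
proof (rule ccontr)
  assume "\<nu> \<noteq> 0"
  then have ne: "to_nat ` keys \<nu> \<noteq> {}" by simp
  have "Max (to_nat ` keys \<nu>) \<in> to_nat ` keys \<nu>" by (rule Max_in) (use ne in auto)
  then obtain k where k: "k \<in> keys \<nu>" "to_nat k = Max (to_nat ` keys \<nu>)" by (metis imageE)
  have 0: "lookup (\<theta> (pivot l)) k = 0" if "l \<in> keys \<nu>" "l \<noteq> k" for l
  proof -
    have "to_nat l \<le> to_nat k" using that k by simp
    moreover have "to_nat l \<noteq> to_nat k" using that(2) by simp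
    ultimately have "Suc (to_nat l) \<le> to_nat k" by linarith
    then show ?thesis using pivot(1)[of l] unfolding bounded_def by blast
  qed
  have "lookup (\<theta> (lin pivot \<nu>)) k = (\<Sum>l\<in>keys \<nu>. lookup \<nu> l * lookup (\<theta> (pivot l)) k)"
    by (simp add: \<theta>_lin[OF pivot_G] lookup_lin)
  also have "\<dots> = (\<Sum>l\<in>keys \<nu>. if l = k then lookup \<nu> k * lookup (\<theta> (pivot k)) k else 0)"
    by (rule sum.cong) (auto simp: 0)
  also have "\<dots> = lookup \<nu> k * lookup (\<theta> (pivot k)) k" using k(1) by simp
  finally show False using assms k(1) by (auto simp: pivots_def in_keys_iff)
qed

text \<open>The image of \<open>\<theta>\<close> is free, so the quotient splits over the torsion.\<close>

lemma split_iso: "free_Abelian_group pivots \<times>\<times> E \<cong> Q"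
proof (rule is_isoI, rule isoI)
  let ?F = "free_Abelian_group pivots"
  let ?h = "\<lambda>(\<nu>, t). coset_class (lin pivot \<nu>) \<otimes>\<^bsub>Q\<^esub> t"
  have L: "lin pivot \<nu> \<in> G" for \<nu> by (rule lin_G) (rule pivot_G)
  have h: "?h (\<nu>, coset_class a) = coset_class (lin pivot \<nu> + a)" if "a \<in> G" for \<nu> a
    using that L by (simp add: mult_Q)
  show "?h \<in> hom (?F \<times>\<times> E) Q"
  proof (rule homI)
    fix c assume "c \<in> carrier (?F \<times>\<times> E)"
    then obtain \<nu> a where "c = (\<nu>, coset_class a)" "a \<in> G" by (auto simp: torsion_eq)
    then show "?h c \<in> carrier Q"
      using h add_closed_add[OF add_closed_G L] by (metis coset_class_in_Q)
  next
    fix c d assume "c \<in> carrier (?F \<times>\<times> E)" "d \<in> carrier (?F \<times>\<times> E)"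
    then obtain \<nu> a \<mu> b where c: "c = (\<nu>, coset_class a)" "a \<in> G" and d: "d = (\<mu>, coset_class b)" "b \<in> G"
      by (auto simp: torsion_eq)
    have "c \<otimes>\<^bsub>?F \<times>\<times> E\<^esub> d = (\<nu> + \<mu>, coset_class (a + b))" using c d by (simp add: mult_Q)
    then have "?h (c \<otimes>\<^bsub>?F \<times>\<times> E\<^esub> d) = coset_class (lin pivot (\<nu> + \<mu>) + (a + b))"
      using h add_closed_add[OF add_closed_G c(2) d(2)] by metis
    also have "\<dots> = coset_class ((lin pivot \<nu> + a) + (lin pivot \<mu> + b))" by (simp add: lin_add ac_simps)
    also have "\<dots> = ?h c \<otimes>\<^bsub>Q\<^esub> ?h d"
      using c d h mult_Q add_closed_add[OF add_closed_G L] by metis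
    finally show "?h (c \<otimes>\<^bsub>?F \<times>\<times> E\<^esub> d) = ?h c \<otimes>\<^bsub>Q\<^esub> ?h d" .
  qed
  show "bij_betw ?h (carrier (?F \<times>\<times> E)) (carrier Q)"
    unfolding bij_betw_def
  proof
    show "inj_on ?h (carrier (?F \<times>\<times> E))"
    proof (rule inj_onI)
      fix c d assume cd: "c \<in> carrier (?F \<times>\<times> E)" "d \<in> carrier (?F \<times>\<times> E)" "?h c = ?h d"
      obtain \<nu> a where c: "c = (\<nu>, coset_class a)" "a \<in> K" "keys \<nu> \<subseteq> pivots" using cd(1) by (auto simp: torsion_eq)
      obtain \<mu> b where d: "d = (\<mu>, coset_class b)" "b \<in> K" "keys \<mu> \<subseteq> pivots" using cd(2) by (auto simp: torsion_eq)
      have "coset_class (lin pivot \<nu> + a) = coset_class (lin pivot \<mu> + b)"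
        using cd(3) h[of a \<nu>] h[of b \<mu>] c d by simp
      then have N: "(lin pivot \<nu> + a) - (lin pivot \<mu> + b) \<in> N" by (simp only: coset_class_eq_iff)
      have eq: "(lin pivot \<nu> + a) - (lin pivot \<mu> + b) = lin pivot (\<nu> - \<mu>) + (a - b)"
        by (simp add: lin_diff algebra_simps)
      have ab: "a - b \<in> K" by (rule add_closed_diff[OF K_closed c(2) d(2)])
      then have "\<theta> (lin pivot (\<nu> - \<mu>)) = 0"
        using \<theta>_N[OF N] L[of "\<nu> - \<mu>"] unfolding eq by (simp add: \<theta>_add)
      moreover have "keys (\<nu> - \<mu>) \<subseteq> pivots" using c(3) d(3) keys_diff[of \<nu> \<mu>] by blast
      ultimately have z: "\<nu> - \<mu> = 0" by (rule pivots_independent[rotated])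
      have "a - b \<in> N" using N unfolding eq z by simp
      then have "coset_class a = coset_class b" by (simp only: coset_class_eq_iff)
      with z c(1) d(1) show "c = d" by simp
    qed
    show "?h ` carrier (?F \<times>\<times> E) = carrier Q"
    proof
      show "?h ` carrier (?F \<times>\<times> E) \<subseteq> carrier Q"
      proof (rule image_subsetI)
        fix c assume "c \<in> carrier (?F \<times>\<times> E)"
        then obtain \<nu> a where "c = (\<nu>, coset_class a)" "a \<in> G" by (auto simp: torsion_eq)
        then show "?h c \<in> carrier Q" using h add_closed_add[OF add_closed_G L] by (metis coset_class_in_Q)
      qed
      show "carrier Q \<subseteq> ?h ` carrier (?F \<times>\<times> E)"
      proof
        fix q assume "q \<in> carrier Q"
        then obtain a where a: "q = coset_class a" "a \<in> G" by (auto simp: carrier_Q)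
        obtain \<nu> where \<nu>: "keys \<nu> \<subseteq> pivots" "a - lin pivot \<nu> \<in> K" using pivots_span[OF a(2)] by blast
        have "q = ?h (\<nu>, coset_class (a - lin pivot \<nu>))" using h[of "a - lin pivot \<nu>" \<nu>] \<nu>(2) a(1) by simp
        moreover have "(\<nu>, coset_class (a - lin pivot \<nu>)) \<in> carrier (?F \<times>\<times> E)"
          using \<nu> by (simp add: torsion_eq)
        ultimately show "q \<in> ?h ` carrier (?F \<times>\<times> E)" by blast
      qed
    qed
  qed
qed

text \<open>The basis has to be a set of classes; the pivots are indexed by their coordinates, so it is
  transported along the injection into the quotient.\<close>

lemma Q_splits:
  "\<exists>(B :: 'a set set) (E :: 'a set monoid). elementary_abelian p E \<and> Q \<cong> free_Abelian_group B \<times>\<times> E"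
proof -
  let ?B = "(\<lambda>k. coset_class (pivot k)) ` pivots"
  have "inj_on (\<lambda>k. coset_class (pivot k)) pivots"
  proof (rule inj_onI)
    fix k l assume kl: "k \<in> pivots" "l \<in> pivots" "coset_class (pivot k) = coset_class (pivot l)"
    have "\<theta> (lin pivot (frag_of k - frag_of l)) = 0"
      using kl(3) \<theta>_N by (simp add: lin_diff coset_class_eq_iff)
    moreover have "keys (frag_of k - frag_of l) \<subseteq> pivots"
      by (rule subset_trans[OF keys_diff]) (use kl(1,2) in simp)
    ultimately have "frag_of k - frag_of l = 0" by (rule pivots_independent[rotated])
    then have "frag_of k = frag_of l" by (simp only: right_minus_eq)
    then show "k = l" by (simp only: frag_of_eq)
  qed
  then have "pivots \<approx> ?B" by (rule inj_on_image_eqpoll_self[THEN eqpoll_sym])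
  then have "free_Abelian_group pivots \<cong> free_Abelian_group ?B"
    by (simp add: isomorphic_free_Abelian_groups)
  moreover have "E \<cong> E" by (rule iso_refl)
  ultimately have "free_Abelian_group pivots \<times>\<times> E \<cong> free_Abelian_group ?B \<times>\<times> E"
    by (rule group.DirProd_iso_trans[OF group_free_Abelian_group])
  moreover have "group (free_Abelian_group pivots \<times>\<times> E)"
    by (rule DirProd_group[OF group_free_Abelian_group comm_group.axioms(2)[OF comm_group_E]])
  from group.iso_sym[OF this split_iso] have "Q \<cong> free_Abelian_group pivots \<times>\<times> E" .
  ultimately have "Q \<cong> free_Abelian_group ?B \<times>\<times> E" using iso_trans by blast
  with elementary_E show ?thesis by (intro exI[of _ ?B] exI[of _ E] conjI)
qed

end

section \<open>The torsion of the lower central factor\<close>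

context free_rank_two
begin

definition theta :: "'a \<Rightarrow> (nat \<times> nat) list \<Rightarrow>\<^sub>0 int"
  where "theta a = remainder p (leading a)"

lemma theta_eq_0: "a \<in> G \<Longrightarrow> theta a = 0 \<longleftrightarrow> leading a \<in> shift_image p"
proof -
  assume a: "a \<in> G"
  obtain q where "p = Suc q" using p_Suc by blast
  then show ?thesis
    unfolding theta_def using remainder_eq_0_iff[of q "leading a"] homog_lie_elts[OF leading_in_L[OF a]]
    by simp
qed

text \<open>Combinations are formed in the free Lie ring on pairs, as \<open>leading\<close> is additive
  only on \<open>G\<close>.\<close>

lemma leading_lin: "leading (lin tor \<nu>) = lin tau \<nu>"
proof -
  have "\<forall>v. \<exists>f. tor v = U f" using tor(1) unfolding G_eq by blast
  from choice[OF this] obtain f where f: "\<And>v. tor v = U (f v)" by blast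
  have "lin tor \<nu> = U (lin f \<nu>)"
    unfolding additive_lin_comp[OF additive_u_map] by (simp add: f[abs_def])
  then have "leading (lin tor \<nu>) = lin (\<lambda>v. top_part p (f v)) \<nu>"
    by (simp add: leading_U additive_lin_comp[OF additive_top_part])
  then show ?thesis using tor(2) by (simp add: f leading_U lin_def)
qed

lemma lin_tor_G: "lin tor \<nu> \<in> G"
  by (rule add_closed_lin[OF add_closed_G]) (rule tor(1))

lemma leading_diff: "a \<in> G \<Longrightarrow> b \<in> G \<Longrightarrow> leading (a - b) = leading a - leading b"
  using leading_add[of "a - b" b] add_closed_diff[OF add_closed_G] by simp

lemma elementary_torsion_lower_central: "elementary_torsion G N theta tor p"
proof (unfold_locales, goal_cases)
  case 3
  then show ?case using N_subset by blast
next
  case 4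
  then show ?case by (rule p_gt)
next
  case (5 a b)
  have "homog p (leading a)" "homog p (leading b)"
    using 5 homog_lie_elts[OF leading_in_L] by blast+
  moreover obtain q where "p = Suc q" using p_Suc by blast
  ultimately have "remainder p (leading a + leading b) = remainder p (leading a) + remainder p (leading b)"
    using remainder_add[of q "leading a" "leading b"] by simp
  then show ?case by (simp add: theta_def leading_add[OF 5])
next
  case (6 a)
  then show ?case using theta_eq_0 L_image_subset(2) by (simp add: N_iff)
next
  case (7 v)
  then show ?case by (rule tor)
next
  case (8 v)
  then show ?case using theta_eq_0[OF tor(1)] tau_in_shift_image by (simp add: tor)
next
  case (9 v)
  have "zmul (int p) (tor v) = lin tor (zmul (int p) (frag_of v))" by (simp add: lin_zmul)
  moreover have "leading (lin tor (zmul (int p) (frag_of v))) \<in> L_image"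
    unfolding leading_lin using p_tau_in_L_image by (simp add: lin_zmul)
  ultimately show ?case using lin_tor_G by (simp add: N_iff)
next
  case (10 a)
  then have "leading a \<in> shift_image p" by (simp add: theta_eq_0)
  then obtain \<nu> where "leading a - lin tau \<nu> \<in> L_image"
    by (rule tau_spans[OF leading_in_L[OF 10(1)]])
  then have "a - lin tor \<nu> \<in> N"
    using 10(1) lin_tor_G by (simp add: N_iff leading_diff leading_lin add_closed_diff[OF add_closed_G])
  then show ?case by blast
next
  case (11 \<nu> v)
  then show ?case using tau_independent by (simp add: N_iff leading_lin)
qed (rule add_closed_G add_closed_N)+

end

theorem theorem5p1:
  fixes x y :: "'a::lie_ring" and p :: nat
  assumes "free_generators (case_bool x y)"
    and "prime p"
  shows "(\<exists>(B :: 'a set set) (E :: 'a set monoid). elementary_abelian p E \<and>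
            (lower_central_quotient p :: 'a set monoid) \<cong> free_Abelian_group B \<times>\<times> E)
    \<and> module_basis (residue_ring (int p)) (torsion_module (lower_central_quotient p :: 'a set monoid))
        (UNIV :: (nat \<times> nat) set)
        (\<lambda>(s, t). quotient_class p (torsion_elem p x y (u_elem x y s t)))"
proof -
  interpret free_rank_two p x y by standard (fact assms)+
  interpret T: elementary_torsion G N theta tor p by (rule elementary_torsion_lower_central)
  have "(\<lambda>(s, t). quotient_class p (torsion_elem p x y (u_elem x y s t))) = (\<lambda>v. T.coset_class (tor v))"
    by (auto simp: quotient_class_def T.coset_class_def tor_def)
  then show ?thesis using T.Q_splits T.torsion_basis by (simp add: lower_central_quotient_def)
qed

end
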